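(* Let $\lambda,\mu,b_1,\dots,b_6$ be generic parameters subject to $b_1b_2b_3b_4b_5b_6=q$. Then $$\left\{\theta(\mu b_1,\dots,\mu b_6)-\frac{q}{\mu^2}\,\theta(\mu/b_1,\dots,\mu/b_6)\right\}\frac{(1-\lambda^2)\prod_{j=1}^6(q\lambda^\pm/b_j)_\infty}{\theta(\mu/\lambda)}\;{}_8\psi_8\left(\begin{matrix}\lambda q,-\lambda q,\lambda b_1,\dots,\lambda b_6\\ \lambda,-\lambda,\lambda q/b_1,\dots,\lambda q/b_6\end{matrix};q\right)+\mathrm{idem}(\lambda;\mu)$$ $$=(q)_\infty\,\theta(\lambda^2,\mu^2,\lambda\mu)\prod_{1\leq i<j\leq 6}(q/b_ib_j)_\infty .$$
   Context: Throughout, $q$ is a fixed complex number with $0<|q|<1$ (the base $q$ is suppressed from the notation). For $k\in\mathbb Z_{\ge 0}$, $(a)_k=(1-a)(1-aq)\cdots(1-aq^{k-1})$; for $k\in\mathbb Z_{<0}$, $(a)_k=\left((1-aq^{-1})(1-aq^{-2})\cdots(1-aq^{k})\right)^{-1}$; and $(a)_\infty=\prod_{j=0}^\infty(1-aq^j)$. The theta function is $\theta(x)=(x)_\infty(q/x)_\infty$. Repeated arguments and $\pm$ denote products, e.g. $\theta(x,y)=\theta(x)\theta(y)$ and $(q\lambda^{\pm}/b)_\infty=(q\lambda/b)_\infty(q\lambda^{-1}/b)_\infty$. The bilateral series is $${}_{r}\psi_r\left(\begin{matrix}a_1,\dots,a_{r}\\c_1,\dots,c_r\end{matrix};z\right)=\sum_{k=-\infty}^\infty\frac{(a_1)_k\cdots(a_{r})_k}{(c_1)_k\cdots(c_r)_k}\,z^k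 .$$ The notation $f(\lambda,\mu)+\mathrm{idem}(\lambda;\mu)$ means $f(\lambda,\mu)+f(\mu,\lambda)$ (where $f(\lambda,\mu)$ is the whole preceding expression). "Generic" means that all parameters are nonzero complex numbers and that no factor in a denominator (in the prefactors or in the terms of the series) vanishes. *)

theory Defs
  imports "HOL-Analysis.Analysis"
begin

definition qpoch :: "complex \<Rightarrow> complex \<Rightarrow> int \<Rightarrow> complex" where
  "qpoch q a k =
     (if k \<ge> 0 then \<Prod>j<nat k. (1 - a * q ^ j)
      else inverse (\<Prod>j=1..nat (- k). (1 - a * q powi (- int j))))"

definition qpoch_inf :: "complex \<Rightarrow> complex \<Rightarrow> complex" where
  "qpoch_inf q a = (\<Prod>j. 1 - a * q ^ j)"

definition theta :: "complex \<Rightarrow> complex \<Rightarrow> complex" where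
  "theta q x = qpoch_inf q x * qpoch_inf q (q / x)"

definition bilateral_psi ::
  "complex \<Rightarrow> complex list \<Rightarrow> complex list \<Rightarrow> complex \<Rightarrow> complex" where
  "bilateral_psi q as cs z =
     (\<Sum>\<^sub>\<infinity>k\<in>(UNIV::int set).
        (\<Prod>a\<leftarrow>as. qpoch q a k) / (\<Prod>c\<leftarrow>cs. qpoch q c k) * z powi k)"

text \<open>
  No factor in a denominator of a term of the bilateral series vanishes. Such factors come from
  the upper parameters when \<open>k < 0\<close> and from the lower parameters when \<open>k \<ge> 0\<close>. For \<open>k < 0\<close> the
  reciprocal of \<open>qpoch q c k\<close> is a polynomial in \<open>c\<close>, so it contributes no denominator. Since
  \<open>inverse 0 = 0\<close>, dividing by \<open>qpoch q c k\<close> gives the value of that polynomial even where it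
  vanishes.
\<close>
definition psi_denominators_nonzero ::
  "complex \<Rightarrow> complex list \<Rightarrow> complex list \<Rightarrow> bool" where
  "psi_denominators_nonzero q as cs \<longleftrightarrow>
     (\<forall>a\<in>set as. \<forall>m\<ge>1::nat. 1 - a * q powi (- int m) \<noteq> 0) \<and>
     (\<forall>c\<in>set cs. \<forall>m::nat. 1 - c * q ^ m \<noteq> 0)"

definition upper_params :: "complex \<Rightarrow> complex \<Rightarrow> (nat \<Rightarrow> complex) \<Rightarrow> complex list" where
  "upper_params q l b = [l * q, - l * q] @ map (\<lambda>j. l * b j) [1..<7]"

definition lower_params :: "complex \<Rightarrow> complex \<Rightarrow> (nat \<Rightarrow> complex) \<Rightarrow> complex list" where
  "lower_params q l b = [l, - l] @ map (\<lambda>j. l * q / b j) [1..<7]"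

text \<open>With \<open>l\<close> for \<open>\<lambda>\<close> and \<open>m\<close> for \<open>\<mu>\<close>, the summand \<open>f(\<lambda>, \<mu>)\<close> to which \<open>idem(\<lambda>; \<mu>)\<close> is applied.\<close>
definition psi_side :: "complex \<Rightarrow> (nat \<Rightarrow> complex) \<Rightarrow> complex \<Rightarrow> complex \<Rightarrow> complex" where
  "psi_side q b l m =
     ((\<Prod>j=1..6. theta q (m * b j)) - q / m ^ 2 * (\<Prod>j=1..6. theta q (m / b j)))
     * ((1 - l ^ 2) * (\<Prod>j=1..6. qpoch_inf q (q * l / b j) * qpoch_inf q (q * inverse l / b j))
        / theta q (m / l))
     * bilateral_psi q (upper_params q l b) (lower_params q l b) q"

end

theory Submission
  imports Defs "HOL-Complex_Analysis.Complex_Analysis"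
begin

text \<open>
  Let \<open>\<Phi>(x)\<close> be the bilateral series with its prefactor \<open>(1 - x\<^sup>2) \<Prod>\<^sub>j (q x / b\<^sub>j)\<^sub>\<infinity> (q / (x b\<^sub>j))\<^sub>\<infinity>\<close>, and
  let \<open>G(x)\<close> be the combination of theta functions in braces. The prefactor cancels all denominators in the
  series, so \<open>\<Phi>\<close> is holomorphic on the punctured plane. Shifting and reversing the summation index shows that
  \<open>\<Phi>(x)\<close> obeys the laws \<open>f(q x) = f(x) / (x^6 q\<^sup>2)\<close> and \<open>f(1/x) = - f(x) / x\<^sup>2\<close>. The same laws hold for \<open>G(x) / x\<close>.
  A function with these properties is called an odd theta function below (\<open>odd_theta\<close>).

  Multiplied by \<open>\<theta>(\<mu>/\<lambda>)\<close>, the left-hand side of the theorem is the determinant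
  \<open>\<Phi>(\<lambda>) G(\<mu>) - (\<mu>/\<lambda>) \<Phi>(\<mu>) G(\<lambda>)\<close> (\<open>det_fun\<close>). It is an odd theta function of \<open>\<lambda>\<close> that vanishes at \<open>\<lambda> = \<mu>\<close>. Odd theta
  functions vanish whenever \<open>\<lambda>\<^sup>2\<close> is a power of \<open>q\<close>, so the determinant has all the zeros of
  \<open>\<theta>(\<lambda>\<^sup>2) \<theta>(\<lambda>\<mu>) \<theta>(\<mu>/\<lambda>)\<close>. The quotient is holomorphic and \<open>q\<close>-periodic, hence constant in \<open>\<lambda>\<close>, by Liouville's theorem
  (\<open>odd_theta_eq_basis\<close>, \<open>det_fun_eq_basis\<close>).

  To find the constant, move two parameters: \<open>b\<^sub>1 = s\<close> and \<open>b\<^sub>2 = p / s\<close>, with the other parameters fixed. If \<open>b\<^sub>i b\<^sub>j = q^n\<close>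
  with \<open>n \<ge> 1\<close>, then \<open>\<Phi>\<close> and \<open>G\<close> both vanish at \<open>b\<^sub>i\<close>, so the constant is zero (\<open>det_fun_eq_0_if_pair\<close>).
  Therefore, for generic values of the fixed quantities, the determinant vanishes at all zeros of the factors
  \<open>(q / (b\<^sub>i b\<^sub>j))\<^sub>\<infinity>\<close> that depend on \<open>s\<close>.
  When \<open>|p| < 1\<close>, the determinant and the product of these factors grow at the same rate under \<open>s \<mapsto> q^N s\<close>
  (\<open>det_fun_upper_bound\<close>, \<open>pair_fun_lower_bound\<close>). Their quotient is then a bounded holomorphic function on the
  punctured \<open>s\<close>-plane, so it is constant, again by Liouville's theorem (\<open>det_fam_eq_const_mult\<close>).

  The quotient is evaluated where \<open>b\<^sub>1 b\<^sub>3 = 1\<close>. There \<open>G(b\<^sub>1) = 0\<close> and the series at \<open>b\<^sub>1\<close> consists of one term, and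
  everything becomes a product (\<open>det_fun_at_terminating\<close>). The argument needs zeros to be simple, which is
  true for generic parameters; the general case follows by continuity. By symmetry one may assume \<open>|p| < 1\<close>,
  since one of \<open>b\<^sub>1 b\<^sub>2\<close>, \<open>b\<^sub>3 b\<^sub>4\<close>, \<open>b\<^sub>5 b\<^sub>6\<close> has modulus less than 1 (\<open>det_fun_eval\<close>).
\<close>

section \<open>The q-Pochhammer symbol and the theta function\<close>

definition fpoch :: "complex \<Rightarrow> complex \<Rightarrow> nat \<Rightarrow> complex" where
  "fpoch q a n = (\<Prod>j<n. 1 - a * q ^ j)"

text \<open>
  The group \<open>q^\<int>\<close>; every genericity condition below says that some monomial in the parameters avoids it.
\<close>

definition qpowers :: "complex \<Rightarrow> complex set" where
  "qpowers q = range (\<lambda>n::int. q powi n)"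

definition simple_zero :: "(complex \<Rightarrow> complex) \<Rightarrow> complex \<Rightarrow> bool" where
  "simple_zero f z \<longleftrightarrow> f z = 0 \<and> (\<exists>D. D \<noteq> 0 \<and> (f has_field_derivative D) (at z))"

lemma simple_zero_mult_left:
  assumes "simple_zero f z" "g field_differentiable at z" "g z \<noteq> 0"
  shows "simple_zero (\<lambda>x. f x * g x) z"
proof -
  obtain D where D: "D \<noteq> 0" "(f has_field_derivative D) (at z)" "f z = 0"
    using assms(1) by (auto simp: simple_zero_def)
  obtain E where E: "(g has_field_derivative E) (at z)"
    using assms(2) by (auto simp: field_differentiable_def)
  have "((\<lambda>x. f x * g x) has_field_derivative (D * g z)) (at z)"
    using DERIV_mult[OF D(2) E] D(3) by simp
  then show ?thesis using D assms(3)
    unfolding simple_zero_def by (intro conjI exI[of _ "D * g z"]) auto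
qed

lemma simple_zero_mult_right:
  assumes "simple_zero f z" "g field_differentiable at z" "g z \<noteq> 0"
  shows "simple_zero (\<lambda>x. g x * f x) z"
  using simple_zero_mult_left[OF assms] by (simp add: mult.commute)

lemma simple_zero_compose:
  assumes "simple_zero f (h z)" "(h has_field_derivative D) (at z)" "D \<noteq> 0"
  shows "simple_zero (\<lambda>x. f (h x)) z"
proof -
  obtain E where E: "E \<noteq> 0" "(f has_field_derivative E) (at (h z))" "f (h z) = 0"
    using assms(1) by (auto simp: simple_zero_def)
  have "((\<lambda>x. f (h x)) has_field_derivative (E * D)) (at z)"
    using DERIV_chain2[OF E(2) assms(2)] .
  then show ?thesis using E assms(3)
    unfolding simple_zero_def by (intro conjI exI[of _ "E * D"]) auto
qed

lemma simple_zero_prod: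
  assumes "finite I" "i \<in> I" "simple_zero (F i) z"
    and "\<And>j. j \<in> I \<Longrightarrow> j \<noteq> i \<Longrightarrow> F j field_differentiable at z \<and> F j z \<noteq> 0"
  shows "simple_zero (\<lambda>z. \<Prod>j\<in>I. F j z) z"
proof -
  have eq: "(\<lambda>z. \<Prod>j\<in>I. F j z) = (\<lambda>z. F i z * (\<Prod>j\<in>I - {i}. F j z))"
    using assms(1,2) by (simp add: prod.remove)
  have "(\<lambda>z. \<Prod>j\<in>J. F j z) field_differentiable at z" if "finite J" "J \<subseteq> I - {i}" for J
    using that
  proof (induction J rule: finite_induct)
    case (insert j J)
    then show ?case using assms(4)[of j] by (auto intro!: field_differentiable_mult)
  qed (simp add: field_differentiable_const)
  moreover have "(\<Prod>j\<in>I - {i}. F j z) \<noteq> 0"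
    using assms(1,4) by (simp add: prod_zero_iff)
  ultimately show ?thesis
    unfolding eq using assms(1) by (intro simple_zero_mult_left[OF assms(3)]) auto
qed

lemma fpoch_0 [simp]: "fpoch q a 0 = 1"
  by (simp add: fpoch_def)

lemma fpoch_Suc: "fpoch q a (Suc n) = fpoch q a n * (1 - a * q ^ n)"
  by (simp add: fpoch_def)

lemma fpoch_Suc_left: "fpoch q a (Suc n) = (1 - a) * fpoch q (a * q) n"
  unfolding fpoch_def by (subst prod.lessThan_Suc_shift) (simp add: mult.assoc)

lemma fpoch_1_Suc [simp]: "fpoch q 1 (Suc n) = 0"
  by (simp add: fpoch_Suc_left)

lemma fpoch_split: "fpoch q a (m + n) = fpoch q a m * fpoch q (a * q ^ m) n"
  by (induction n) (simp_all add: fpoch_Suc power_add mult.assoc)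

lemma holomorphic_fpoch [holomorphic_intros]:
  "f holomorphic_on A \<Longrightarrow> (\<lambda>z. fpoch q (f z) n) holomorphic_on A"
  unfolding fpoch_def by (intro holomorphic_intros)

locale q_base =
  fixes q :: complex
  assumes q_nz: "q \<noteq> 0" and q_lt: "norm q < 1"
begin

lemma norm_q_pos: "0 < norm q"
  using q_nz by simp

lemma q_power_nz [simp]: "q ^ n \<noteq> 0" "q powi i \<noteq> 0"
  using q_nz by auto

text \<open>
  Each factor \<open>1 - y / q^j\<close> equals \<open>- y / q^j\<close> times \<open>1 - q^j / y\<close>. This turns a finite product whose
  factors grow into an explicit monomial times a bounded product; all growth estimates rest on it.
\<close>

lemma fpoch_reflect:
  assumes "y \<noteq> 0"
  shows "fpoch q (y / q ^ n) n = (- y) ^ n / q ^ (\<Sum>{..n}) * fpoch q (q / y) n"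
proof (induction n)
  case (Suc n)
  have "fpoch q (y / q ^ Suc n) (Suc n) = (1 - y / q ^ Suc n) * fpoch q (y / q ^ n) n"
    using q_nz by (simp add: fpoch_Suc_left)
  also have "(1 - y / q ^ Suc n) = (- y) / q ^ Suc n * (1 - q / y * q ^ n)"
    using q_nz assms by (simp add: field_simps)
  finally show ?case
    unfolding Suc by (simp add: fpoch_Suc power_add mult_ac)
qed simp

lemma convergent_prod_qinf: "convergent_prod (\<lambda>j. 1 - a * q ^ j)"
proof -
  have "summable (\<lambda>i. norm ((1 - a * q ^ i) - 1))"
    using q_lt by (simp add: norm_mult norm_power summable_mult summable_geometric)
  then show ?thesis
    by (intro abs_convergent_prod_imp_convergent_prod summable_imp_abs_convergent_prod)
qed

lemma fpoch_LIMSEQ: "(\<lambda>n. fpoch q a n) \<longlonglongrightarrow> qpoch_inf q a"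
proof -
  have "(\<lambda>n. \<Prod>i\<le>n. 1 - a * q ^ i) \<longlonglongrightarrow> qpoch_inf q a"
    unfolding qpoch_inf_def by (rule convergent_prod_LIMSEQ[OF convergent_prod_qinf])
  then have "(\<lambda>n. fpoch q a (Suc n)) \<longlonglongrightarrow> qpoch_inf q a"
    by (simp add: fpoch_def lessThan_Suc_atMost)
  then show ?thesis by (rule LIMSEQ_imp_Suc)
qed

lemma qinf_split: "qpoch_inf q a = fpoch q a n * qpoch_inf q (a * q ^ n)"
proof -
  have "(\<lambda>m. fpoch q a (m + n)) \<longlonglongrightarrow> qpoch_inf q a"
    by (rule LIMSEQ_ignore_initial_segment[OF fpoch_LIMSEQ])
  moreover have "(\<lambda>m. fpoch q a n * fpoch q (a * q ^ n) m) \<longlonglongrightarrow> fpoch q a n * qpoch_inf q (a * q ^ n)"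
    by (intro tendsto_intros fpoch_LIMSEQ)
  ultimately show ?thesis
    by (simp add: LIMSEQ_unique fpoch_split add.commute[of _ n])
qed

lemma qinf_Suc: "qpoch_inf q a = (1 - a) * qpoch_inf q (a * q)"
  using qinf_split[of a 1] by (simp add: fpoch_def)

lemma qinf_nonzero:
  assumes "\<And>n. a * q ^ n \<noteq> 1"
  shows "qpoch_inf q a \<noteq> 0"
  unfolding qpoch_inf_def
  by (rule prodinf_nonzero[OF convergent_prod_qinf]) (use assms in \<open>metis eq_iff_diff_eq_0\<close>)

lemma qinf_eq_0_iff: "qpoch_inf q a = 0 \<longleftrightarrow> (\<exists>n. a * q ^ n = 1)"
proof
  assume "\<exists>n. a * q ^ n = 1"
  then obtain n where "a * q ^ n = 1" by blast
  then show "qpoch_inf q a = 0"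
    using qinf_split[of a "Suc n"] by (simp add: fpoch_Suc)
qed (use qinf_nonzero in blast)

lemma fpoch_eq_0_iff: "fpoch q a n = 0 \<longleftrightarrow> (\<exists>j<n. a * q ^ j = 1)"
  by (auto simp: fpoch_def)

lemma q_power_neq_1: "q ^ Suc n \<noteq> 1"
proof
  assume "q ^ Suc n = 1"
  then have "norm q ^ Suc n = 1" by (metis norm_one norm_power)
  moreover have "norm q ^ Suc n < 1"
    by (rule power_Suc_less_one) (use q_lt norm_q_pos in auto)
  ultimately show False by simp
qed

lemma qinf_q_nonzero: "qpoch_inf q q \<noteq> 0"
  by (rule qinf_nonzero) (use q_power_neq_1 in simp)

text \<open>
  From \<open>1 + x \<le> exp x\<close> and the geometric series. The point of the bound is that it is uniform in \<open>n\<close> and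
  monotone in \<open>norm a\<close>.
\<close>

lemma norm_fpoch_le: "norm (fpoch q a n) \<le> exp (norm a / (1 - norm q))"
proof -
  have "norm (fpoch q a n) \<le> (\<Prod>j<n. 1 + norm a * norm q ^ j)"
    unfolding fpoch_def prod_norm[symmetric]
    by (intro prod_mono) (auto intro!: order_trans[OF norm_triangle_ineq4] simp: norm_mult norm_power)
  also have "\<dots> \<le> exp (\<Sum>j<n. norm a * norm q ^ j)"
    by (rule prod_le_exp_sum) auto
  also have "(\<Sum>j<n. norm a * norm q ^ j) \<le> (\<Sum>j. norm a * norm q ^ j)"
    by (intro sum_le_suminf summable_mult summable_geometric) (use q_lt in auto)
  also have "\<dots> = norm a / (1 - norm q)"
    using q_lt by (simp add: suminf_mult suminf_geometric summable_geometric)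
  finally show ?thesis by simp
qed

lemma norm_qinf_le: "norm (qpoch_inf q a) \<le> exp (norm a / (1 - norm q))"
  by (rule LIMSEQ_le_const2[OF tendsto_norm[OF fpoch_LIMSEQ]]) (use norm_fpoch_le in blast)

lemma norm_fpoch_le': "norm a \<le> R \<Longrightarrow> norm (fpoch q a n) \<le> exp (R / (1 - norm q))"
  by (rule order_trans[OF norm_fpoch_le]) (use q_lt in \<open>simp add: divide_right_mono\<close>)

lemma norm_qinf_le': "norm a \<le> R \<Longrightarrow> norm (qpoch_inf q a) \<le> exp (R / (1 - norm q))"
  by (rule order_trans[OF norm_qinf_le]) (use q_lt in \<open>simp add: divide_right_mono\<close>)

lemma holomorphic_qinf: "qpoch_inf q holomorphic_on UNIV"
proof (rule holomorphic_uniform_sequence[where f = "\<lambda>n z. fpoch q z n"])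
  fix z0 :: complex
  define X where "X = cball z0 1"
  have "uniformly_convergent_on X (\<lambda>N z. \<Prod>n<N. 1 - z * q ^ n)"
  proof (rule uniformly_convergent_on_prod')
    show "uniformly_convergent_on X (\<lambda>N z. \<Sum>n<N. norm ((1 - z * q ^ n) - 1))"
    proof (rule Weierstrass_m_test'[where M = "\<lambda>n. (norm z0 + 1) * norm q ^ n"])
      fix n z assume "z \<in> X"
      then have "norm z \<le> norm z0 + 1"
        unfolding X_def using norm_triangle_ineq2[of z z0] by (simp add: dist_norm norm_minus_commute)
      then show "norm (norm ((1 - z * q ^ n) - 1)) \<le> (norm z0 + 1) * norm q ^ n"
        by (simp add: norm_mult norm_power mult_right_mono)
    qed (use q_lt in \<open>simp add: summable_mult summable_geometric\<close>)
  qed (auto simp: X_def intro!: continuous_intros)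
  then have "uniform_limit X (\<lambda>n z. fpoch q z n) (\<lambda>z. lim (\<lambda>n. fpoch q z n)) sequentially"
    by (simp add: uniformly_convergent_uniform_limit_iff fpoch_def)
  moreover have "lim (\<lambda>n. fpoch q z n) = qpoch_inf q z" for z
    by (rule limI[OF fpoch_LIMSEQ])
  ultimately show "\<exists>d>0. cball z0 d \<subseteq> UNIV \<and> uniform_limit (cball z0 d) (\<lambda>n z. fpoch q z n) (qpoch_inf q) sequentially"
    by (auto simp: X_def intro!: exI[of _ 1])
qed (auto intro!: holomorphic_intros)

lemma holomorphic_qinf' [holomorphic_intros]:
  "f holomorphic_on A \<Longrightarrow> (\<lambda>z. qpoch_inf q (f z)) holomorphic_on A"
  using holomorphic_on_compose_gen[OF _ holomorphic_qinf, of f A] by (simp add: o_def)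

lemma holomorphic_theta' [holomorphic_intros]:
  "f holomorphic_on A \<Longrightarrow> (\<And>z. z \<in> A \<Longrightarrow> f z \<noteq> 0) \<Longrightarrow> (\<lambda>z. theta q (f z)) holomorphic_on A"
  unfolding theta_def by (intro holomorphic_intros) auto

text \<open>
  Splitting off the first \<open>n + 1\<close> factors isolates the vanishing factor \<open>1 - z * q^n\<close>. The others do not vanish,
  as \<open>norm q < 1\<close> makes the powers of \<open>q\<close> distinct.
\<close>

lemma simple_zero_qinf:
  assumes "qpoch_inf q z0 = 0"
  shows "simple_zero (qpoch_inf q) z0"
proof -
  obtain n where n: "z0 * q ^ n = 1" using assms qinf_eq_0_iff by blast
  have eq: "qpoch_inf q = (\<lambda>z. (1 - z * q ^ n) * (fpoch q z n * qpoch_inf q (z * q ^ Suc n)))"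
    by (rule ext, subst qinf_split[of _ "Suc n"]) (simp add: fpoch_Suc mult_ac)
  have nz: "z0 * q ^ j \<noteq> 1" if "j \<noteq> n" for j
  proof
    assume j: "z0 * q ^ j = 1"
    have "z0 \<noteq> 0" using n by auto
    then have "q ^ j = q ^ n" using j n by (metis mult_left_cancel)
    then have "norm q ^ j = norm q ^ n" by (metis norm_power)
    then show False
      using that power_strict_decreasing[of j n "norm q"] power_strict_decreasing[of n j "norm q"] q_lt norm_q_pos
      by (cases "j < n") auto
  qed
  have "simple_zero (\<lambda>z. (1 - z * q ^ n) * (fpoch q z n * qpoch_inf q (z * q ^ Suc n))) z0"
  proof (rule simple_zero_mult_left)
    have "((\<lambda>z. 1 - z * q ^ n) has_field_derivative (- (q ^ n))) (at z0)"
      by (auto intro!: derivative_eq_intros)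
    then show "simple_zero (\<lambda>z. 1 - z * q ^ n) z0"
      using n q_nz unfolding simple_zero_def by (intro conjI exI[of _ "- (q ^ n)"]) auto
    have "(\<lambda>z. fpoch q z n * qpoch_inf q (z * q ^ Suc n)) holomorphic_on UNIV"
      by (intro holomorphic_intros)
    then show "(\<lambda>z. fpoch q z n * qpoch_inf q (z * q ^ Suc n)) field_differentiable at z0"
      using holomorphic_on_imp_differentiable_at by blast
    have "fpoch q z0 n \<noteq> 0"
      using nz by (auto simp: fpoch_eq_0_iff)
    moreover have "z0 * q ^ Suc n * q ^ m \<noteq> 1" for m
      using nz[of "Suc n + m"] by (simp add: power_add mult.assoc)
    then have "qpoch_inf q (z0 * q ^ Suc n) \<noteq> 0" by (rule qinf_nonzero)
    ultimately show "fpoch q z0 n * qpoch_inf q (z0 * q ^ Suc n) \<noteq> 0" by simp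
  qed
  then show ?thesis using eq by simp
qed

lemma qpowers_mult: "x \<in> qpowers q \<Longrightarrow> y \<in> qpowers q \<Longrightarrow> x * y \<in> qpowers q"
  unfolding qpowers_def using q_nz by (auto simp flip: power_int_add)

lemma qpowers_inverse: "x \<in> qpowers q \<Longrightarrow> inverse x \<in> qpowers q"
  unfolding qpowers_def by (auto simp flip: power_int_minus)

lemma qpowers_divide: "x \<in> qpowers q \<Longrightarrow> y \<in> qpowers q \<Longrightarrow> x / y \<in> qpowers q"
  using qpowers_mult qpowers_inverse by (metis divide_inverse)

lemma qpowers_power: "q ^ n \<in> qpowers q"
  unfolding qpowers_def by (auto intro!: range_eqI[of _ _ "int n"])

lemma one_in_qpowers: "1 \<in> qpowers q" and q_in_qpowers: "q \<in> qpowers q"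
  using qpowers_power[of 0] qpowers_power[of 1] by auto

lemma qpowers_nz: "x \<in> qpowers q \<Longrightarrow> x \<noteq> 0"
  unfolding qpowers_def using q_nz by auto

lemma qinf_eq_0_imp: "qpoch_inf q x = 0 \<Longrightarrow> x \<in> qpowers q"
  unfolding qinf_eq_0_iff by (metis inverse_unique mult.commute qpowers_inverse qpowers_power)

lemma theta_eq_0_iff:
  assumes "x \<noteq> 0"
  shows "theta q x = 0 \<longleftrightarrow> x \<in> qpowers q"
proof
  assume "theta q x = 0"
  then have "x \<in> qpowers q \<or> q / x \<in> qpowers q"
    by (auto simp: theta_def dest: qinf_eq_0_imp)
  moreover have "x = q / (q / x)" using assms q_nz by simp
  ultimately show "x \<in> qpowers q" using qpowers_divide[OF q_in_qpowers] by metis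
next
  assume "x \<in> qpowers q"
  then obtain n :: int where n: "x = q powi n" by (auto simp: qpowers_def)
  show "theta q x = 0"
  proof (cases "n \<le> 0")
    case True
    then have "x * q ^ nat (- n) = 1"
      using n q_nz by (simp add: power_int_def field_simps)
    then show ?thesis by (auto simp: theta_def qinf_eq_0_iff)
  next
    case False
    then have "q / x * q ^ (nat n - 1) = 1"
      using n q_nz by (simp add: power_int_def field_simps flip: power_Suc)
    then show ?thesis by (auto simp: theta_def qinf_eq_0_iff)
  qed
qed

lemma theta_mult_q:
  assumes "x \<noteq> 0"
  shows "theta q (q * x) = - (theta q x) / x"
proof -
  have "theta q (q * x) = qpoch_inf q (x * q) * ((1 - 1 / x) * qpoch_inf q (q / x))"
    using qinf_Suc[of "1 / x"] q_nz by (simp add: theta_def mult_ac)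
  also have "1 - 1 / x = - (1 - x) / x" using assms by (simp add: field_simps)
  also have "qpoch_inf q (x * q) * (- (1 - x) / x * qpoch_inf q (q / x)) = - (theta q x) / x"
    unfolding theta_def using assms by (subst (3) qinf_Suc) (simp add: field_simps)
  finally show ?thesis .
qed

lemma theta_inverse:
  assumes "x \<noteq> 0"
  shows "theta q (1 / x) = - (theta q x) / x"
proof -
  have "theta q (1 / x) = theta q (q * x)"
    unfolding theta_def using q_nz by (simp add: mult_ac)
  then show ?thesis using theta_mult_q[OF assms] by simp
qed

lemma theta_divide_q:
  assumes "x \<noteq> 0"
  shows "theta q (x / q) = - (x / q) * theta q x"
  using theta_mult_q[of "x / q"] assms q_nz by simp

text \<open>
  The two factors of theta never vanish together: otherwise a positive power of \<open>q\<close> would be 1.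
\<close>

lemma simple_zero_theta:
  assumes "x \<noteq> 0" "theta q x = 0"
  shows "simple_zero (theta q) x"
proof -
  have *: "theta q = (\<lambda>x. qpoch_inf q x * qpoch_inf q (q / x))"
    by (simp add: theta_def fun_eq_iff)
  have d1: "qpoch_inf q field_differentiable at x"
    using holomorphic_qinf holomorphic_on_imp_differentiable_at by blast
  have "(\<lambda>x. qpoch_inf q (q / x)) holomorphic_on (- {0})"
    by (intro holomorphic_intros) auto
  then have d2: "(\<lambda>x. qpoch_inf q (q / x)) field_differentiable at x"
    using assms(1) by (intro holomorphic_on_imp_differentiable_at[where s = "- {0}"]) auto
  have notboth: "\<not> (qpoch_inf q x = 0 \<and> qpoch_inf q (q / x) = 0)"
  proof
    assume "qpoch_inf q x = 0 \<and> qpoch_inf q (q / x) = 0"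
    then obtain m n where "x * q ^ m = 1" "q / x * q ^ n = 1" by (auto simp: qinf_eq_0_iff)
    then have "(x * q ^ m) * (q / x * q ^ n) = 1" by simp
    then have "q ^ Suc (m + n) = 1" using assms(1) by (simp add: power_add mult_ac)
    then show False using q_power_neq_1 by blast
  qed
  show ?thesis
  proof (cases "qpoch_inf q x = 0")
    case True
    then show ?thesis unfolding * using notboth d2
      by (intro simple_zero_mult_left[OF simple_zero_qinf]) auto
  next
    case False
    then have z: "qpoch_inf q (q / x) = 0" using assms(2) by (simp add: theta_def)
    have "simple_zero (\<lambda>x. qpoch_inf q (q / x)) x"
      by (rule simple_zero_compose[where f = "qpoch_inf q" and h = "\<lambda>x. q / x", OF simple_zero_qinf[OF z],
              where D = "- (q / x\<^sup>2)"])
        (use assms(1) q_nz in \<open>auto intro!: derivative_eq_intros simp: power2_eq_square\<close>)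
    then show ?thesis unfolding * using False d1 by (intro simple_zero_mult_right) auto
  qed
qed

end

section \<open>Holomorphic functions on the punctured plane\<close>

text \<open>
  At a common zero the quotient has the limit \<open>f' / g'\<close>, so the singularity is removable.
\<close>

lemma holomorphic_divide_simple_zeros:
  assumes "open A" and holf: "f holomorphic_on A" and holg: "g holomorphic_on A"
    and zeros: "\<And>z. z \<in> A \<Longrightarrow> g z = 0 \<Longrightarrow> f z = 0 \<and> simple_zero g z"
  shows "\<exists>h. h holomorphic_on A \<and> (\<forall>z\<in>A. f z = g z * h z)"
proof -
  define h where "h = (\<lambda>z. if g z = 0 then deriv f z / deriv g z else f z / g z)"
  have hol: "\<exists>d>0. h holomorphic_on ball z0 d" if z0: "z0 \<in> A" for z0
  proof (cases "g z0 = 0")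
    case False
    have "isCont g z0"
      using holg z0 \<open>open A\<close> holomorphic_on_imp_continuous_on continuous_on_eq_continuous_at by blast
    then have "\<forall>\<^sub>F z in nhds z0. g z \<noteq> 0"
      using False isCont_def tendsto_imp_eventually_ne
      by (metis (mono_tags, lifting) continuous_at t1_space_nhds eventually_mono tendsto_at_iff_tendsto_nhds tendsto_imp_eventually_ne)
    moreover have "\<forall>\<^sub>F z in nhds z0. z \<in> A"
      using z0 \<open>open A\<close> by (rule eventually_nhds_in_open[rotated])
    ultimately have "\<forall>\<^sub>F z in nhds z0. g z \<noteq> 0 \<and> z \<in> A" by eventually_elim simp
    then obtain d where d: "d > 0" "\<And>z. dist z z0 < d \<Longrightarrow> g z \<noteq> 0 \<and> z \<in> A"
      unfolding eventually_nhds_metric by blast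
    have "(\<lambda>z. f z / g z) holomorphic_on ball z0 d"
      using d by (intro holomorphic_intros holomorphic_on_subset[OF holf] holomorphic_on_subset[OF holg])
        (auto simp: dist_commute)
    moreover have "(\<lambda>z. f z / g z) holomorphic_on ball z0 d \<longleftrightarrow> h holomorphic_on ball z0 d"
      using d by (intro holomorphic_cong) (auto simp: h_def dist_commute)
    ultimately show ?thesis using d(1) by blast
  next
    case True
    then have f0: "f z0 = 0" and "simple_zero g z0" using zeros z0 by auto
    then obtain D where D: "D \<noteq> 0" "(g has_field_derivative D) (at z0)" by (auto simp: simple_zero_def)
    define E where "E = deriv f z0"
    have E: "(f has_field_derivative E) (at z0)"
      unfolding E_def using holf z0 \<open>open A\<close> holomorphic_derivI by blast
    have limg: "((\<lambda>z. g z / (z - z0)) \<longlongrightarrow> D) (at z0)"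
      using D(2) True by (simp add: has_field_derivative_iff)
    have limf: "((\<lambda>z. f z / (z - z0)) \<longlongrightarrow> E) (at z0)"
      using E f0 by (simp add: has_field_derivative_iff)
    have evnz: "\<forall>\<^sub>F z in at z0. g z / (z - z0) \<noteq> 0"
      by (rule tendsto_imp_eventually_ne[OF limg D(1)])
    moreover have "\<forall>\<^sub>F z in at z0. z \<in> A"
      using z0 \<open>open A\<close> by (simp add: eventually_at_in_open')
    ultimately have "\<forall>\<^sub>F z in at z0. g z \<noteq> 0 \<and> z \<in> A" by eventually_elim auto
    then obtain d where d: "d > 0" "\<And>z. z \<noteq> z0 \<Longrightarrow> dist z z0 < d \<Longrightarrow> g z \<noteq> 0 \<and> z \<in> A"
      unfolding eventually_at by auto
    have h0: "h z0 = E / D"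
      using True DERIV_imp_deriv[OF D(2)] by (simp add: h_def E_def)
    have "((\<lambda>z. (f z / (z - z0)) / (g z / (z - z0))) \<longlongrightarrow> E / D) (at z0)"
      by (intro tendsto_divide limf limg D)
    moreover have "\<forall>\<^sub>F z in at z0. (f z / (z - z0)) / (g z / (z - z0)) = h z"
      using evnz by eventually_elim (auto simp: h_def)
    ultimately have lim: "(h \<longlongrightarrow> h z0) (at z0)"
      unfolding h0 by (rule Lim_transform_eventually)
    have gA: "g z \<noteq> 0 \<and> z \<in> A" if "z \<in> ball z0 d - {z0}" for z
      using d(2)[of z] that by (simp add: dist_commute)
    have sub: "ball z0 d - {z0} \<subseteq> A" using gA by blast
    have nz: "g z \<noteq> 0" if "z \<in> ball z0 d - {z0}" for z using gA[OF that] by blast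
    have "(\<lambda>z. f z / g z) holomorphic_on ball z0 d - {z0}"
      by (rule holomorphic_on_divide[OF holomorphic_on_subset[OF holf sub] holomorphic_on_subset[OF holg sub] nz])
    moreover have "(\<lambda>z. f z / g z) holomorphic_on ball z0 d - {z0} \<longleftrightarrow> h holomorphic_on ball z0 d - {z0}"
      using nz by (intro holomorphic_cong) (auto simp: h_def)
    ultimately have holh: "h holomorphic_on ball z0 d - {z0}" by simp
    have "h holomorphic_on ball z0 d"
    proof (rule no_isolated_singularity'[OF _ holh])
      show "(h \<longlongrightarrow> h z) (at z within ball z0 d)" if "z \<in> {z0}" for z
        using that tendsto_within_subset[OF lim subset_UNIV] by blast
    qed simp_all
    then show ?thesis using d(1) by blast
  qed
  have "h holomorphic_on A"
    unfolding holomorphic_on_def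
  proof
    fix z0 assume "z0 \<in> A"
    then obtain d where "d > 0" "h holomorphic_on ball z0 d" using hol by blast
    then have "h field_differentiable at z0"
      by (intro holomorphic_on_imp_differentiable_at[where s = "ball z0 d"]) auto
    then show "h field_differentiable at z0 within A" by (rule field_differentiable_at_within)
  qed
  moreover have "\<forall>z\<in>A. f z = g z * h z" using zeros by (auto simp: h_def)
  ultimately show ?thesis by blast
qed

text \<open>
  The circles accumulate at 0 and at infinity, so the maximum principle on the annuli between them extends the
  bound to the whole punctured plane. Then 0 is removable and Liouville's theorem applies. This is the only
  rigidity principle in the proof; it is used once in the variable of a theta function and once in the
  parameters.
\<close>

lemma bounded_on_circles_imp_constant:
  fixes h :: "complex \<Rightarrow> complex"
  assumes hol: "h holomorphic_on - {0}" and r: "0 < r" "r < 1" and "\<rho> > 0"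
    and bound: "\<And>z (n::int). norm z = \<rho> * r powi n \<Longrightarrow> norm (h z) \<le> K"
  shows "\<exists>c. \<forall>z. z \<noteq> 0 \<longrightarrow> h z = c"
proof -
  have le: "norm (h z) \<le> K" if "z \<noteq> 0" for z
  proof -
    have "(\<lambda>n. r ^ n) \<longlonglongrightarrow> 0" by (rule LIMSEQ_realpow_zero) (use r in auto)
    moreover have "min (norm z / \<rho>) (\<rho> / norm z) > 0" using that \<open>\<rho> > 0\<close> by auto
    ultimately have "\<forall>\<^sub>F n in sequentially. r ^ n < min (norm z / \<rho>) (\<rho> / norm z)"
      by (rule order_tendstoD(2))
    then obtain N where N: "r ^ N < min (norm z / \<rho>) (\<rho> / norm z)"
      by (auto simp: eventually_sequentially)
    define d where "d = \<rho> * r ^ N"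
    define R where "R = \<rho> / r ^ N"
    have d: "d > 0" "R > 0" using r \<open>\<rho> > 0\<close> by (auto simp: d_def R_def)
    have z: "d < norm z" "norm z < R"
      using N r \<open>\<rho> > 0\<close> that by (auto simp: d_def R_def field_simps)
    let ?S = "cball (0::complex) R - ball 0 d"
    show ?thesis
    proof (rule maximum_modulus_frontier[where S = ?S and f = h])
      show "h holomorphic_on interior ?S"
        using d by (intro holomorphic_on_subset[OF hol]) (use interior_subset in force)
      have "closed ?S" by (intro closed_Diff) auto
      moreover have "continuous_on ?S h"
        using d by (intro continuous_on_subset[OF holomorphic_on_imp_continuous_on[OF hol]]) auto
      ultimately show "continuous_on (closure ?S) h" by simp
      show "bounded ?S" using bounded_cball bounded_diff by blast
      show "z \<in> ?S" using z by auto
      fix w assume "w \<in> frontier ?S"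
      then have "w \<in> frontier (cball 0 R) \<union> frontier (ball 0 d)"
        using frontier_Int_subset[of "cball 0 R" "- ball 0 d"] by (auto simp: Diff_eq frontier_complement)
      then have "norm w = R \<or> norm w = d" using d by (auto simp: frontier_cball frontier_ball)
      moreover have "d = \<rho> * r powi int N" "R = \<rho> * r powi (- int N)"
        using r by (simp_all add: d_def R_def power_int_minus divide_inverse)
      ultimately show "norm (h w) \<le> K" using bound by blast
    qed
  qed
  have "\<exists>B. \<forall>\<^sub>F z in at 0. norm (h z) \<le> B"
    using le by (intro exI[of _ K]) (auto simp: eventually_at intro: exI[of _ 1])
  then obtain g where g: "g holomorphic_on UNIV" "\<And>z. z \<noteq> 0 \<Longrightarrow> g z = h z"
    using holomorphic_on_extend_bounded[of h UNIV 0] hol by (auto simp: Compl_eq_Diff_UNIV)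
  have "bounded (range g)"
  proof (rule boundedI)
    fix w assume "w \<in> range g"
    then obtain z where "w = g z" by blast
    then show "norm w \<le> max K (norm (g 0))"
      using le[of z] g(2)[of z] by (cases "z = 0") auto
  qed
  then obtain c where "\<And>z. g z = c"
    using Liouville_theorem[OF g(1)] by (auto simp: constant_on_def)
  then show ?thesis using g(2) by metis
qed

lemma bounded_on_circle:
  fixes f :: "complex \<Rightarrow> complex"
  assumes "f holomorphic_on - {0}" "r > 0"
  shows "\<exists>B>0. \<forall>s. norm s = r \<longrightarrow> norm (f s) \<le> B"
proof -
  have "compact (f ` sphere 0 r)"
    using assms by (intro compact_continuous_image continuous_on_subset[OF holomorphic_on_imp_continuous_on]) auto
  then obtain B where B: "\<And>s. norm s = r \<Longrightarrow> norm (f s) \<le> B"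
    using compact_imp_bounded bounded_iff by (metis image_eqI mem_sphere_0)
  show ?thesis
  proof (intro exI[of _ "max B 1"] conjI allI impI)
    show "norm (f s) \<le> max B 1" if "norm s = r" for s using B[OF that] by (simp add: le_max_iff_disj)
  qed simp
qed

text \<open>
  Only countably many radii are excluded. The lemma supplies circles on which a given product of theta functions
  has no zeros.
\<close>

lemma exists_radius_avoiding:
  fixes a :: "'i \<Rightarrow> real" and r :: real
  assumes "countable I" "\<And>i. i \<in> I \<Longrightarrow> a i > 0"
  shows "\<exists>\<rho>>0. \<forall>i\<in>I. \<forall>n::int. \<rho> * a i \<noteq> r powi n"
proof -
  have "countable (\<Union>i\<in>I. range (\<lambda>n::int. r powi n / a i))" (is "countable ?C")
    using assms(1) by (intro countable_UN) auto
  then have "\<not> {0<..<1::real} \<subseteq> ?C"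
    using countable_subset uncountable_open_interval[of 0 1] by (metis zero_less_one)
  then obtain \<rho> where "\<rho> \<in> {0<..<1}" and \<rho>C: "\<rho> \<notin> ?C" by (meson subsetI)
  then have \<rho>: "\<rho> > 0" by simp
  have "\<rho> * a i \<noteq> r powi n" if "i \<in> I" for i n
  proof
    assume "\<rho> * a i = r powi n"
    then have "\<rho> = r powi n / a i" using assms(2)[OF that] by (simp add: field_simps)
    then show False using \<rho>C that by blast
  qed
  then show ?thesis using \<rho> by blast
qed

section \<open>Odd theta functions of degree six\<close>

context q_base
begin

text \<open>
  These are the transformation laws of the series and, up to a factor \<open>x\<close>, of the theta combination in the
  theorem. Up to the same normalisation they say: theta function of degree six, odd under \<open>x \<mapsto> 1 / x\<close>.
\<close>

definition odd_theta :: "(complex \<Rightarrow> complex) \<Rightarrow> bool" where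
  "odd_theta f \<longleftrightarrow> (\<forall>x. x \<noteq> 0 \<longrightarrow> f (q * x) = f x / (x ^ 6 * q\<^sup>2) \<and> f (1 / x) = - f x / x\<^sup>2)"

lemma odd_theta_mult_q: "odd_theta f \<Longrightarrow> x \<noteq> 0 \<Longrightarrow> f (q * x) = f x / (x ^ 6 * q\<^sup>2)"
  and odd_theta_inverse: "odd_theta f \<Longrightarrow> x \<noteq> 0 \<Longrightarrow> f (1 / x) = - f x / x\<^sup>2"
  by (auto simp: odd_theta_def)

lemma odd_theta_eq_0_mult_power:
  assumes "odd_theta f" "x \<noteq> 0"
  shows "f (q ^ n * x) = 0 \<longleftrightarrow> f x = 0"
proof (induction n)
  case (Suc n)
  have "f (q * (q ^ n * x)) = 0 \<longleftrightarrow> f (q ^ n * x) = 0"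
    using assms q_nz by (subst odd_theta_mult_q[OF assms(1)]) auto
  then show ?case using Suc by (simp add: mult.assoc)
qed simp

lemma odd_theta_eq_0_mult_qpowers:
  assumes "odd_theta f" "x \<noteq> 0" "u \<in> qpowers q" "f x = 0"
  shows "f (u * x) = 0"
proof -
  obtain n :: int where n: "u = q powi n" using assms(3) by (auto simp: qpowers_def)
  show ?thesis
  proof (cases "n \<ge> 0")
    case True
    then show ?thesis
      using n odd_theta_eq_0_mult_power[OF assms(1,2), of "nat n"] assms(4) by (simp add: power_int_def)
  next
    case False
    have "u * x \<noteq> 0" using n assms(2) q_nz by simp
    moreover have "q ^ nat (- n) * (u * x) = x"
      using n False q_nz by (simp add: power_int_def field_simps)
    ultimately show ?thesis
      using odd_theta_eq_0_mult_power[OF assms(1), of "u * x" "nat (- n)"] assms(4) by metis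
  qed
qed

text \<open>
  The points with \<open>x\<^sup>2 \<in> q^\<int>\<close> are, modulo \<open>q^\<int>\<close>, the fixed points of the inversion. Modulo \<open>q^\<int>\<close> such a
  point \<open>y\<close> satisfies \<open>y\<^sup>2 = 1\<close> or \<open>y\<^sup>2 = q\<close>, and in both cases the two laws combine to \<open>f y = - f y\<close>.
\<close>

lemma odd_theta_eq_0_if_square:
  assumes f: "odd_theta f" and sq: "x\<^sup>2 \<in> qpowers q"
  shows "f x = 0"
proof -
  have x: "x \<noteq> 0" using qpowers_nz[OF sq] by auto
  obtain n :: int where n: "x\<^sup>2 = q powi n" using sq by (auto simp: qpowers_def)
  \<comment> \<open>Dividing by \<open>q powi (n div 2)\<close> reduces to \<open>n\<close> equal to 0 or 1.\<close>
  define k where "k = n div 2"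
  define y where "y = x / q powi k"
  have y: "y \<noteq> 0" "x = q powi k * y" using x q_nz by (simp_all add: y_def)
  have n2: "n = k + k + n mod 2" by (simp add: k_def)
  have "q powi n = (q powi k)\<^sup>2 * q powi (n mod 2)"
    by (subst n2) (simp only: power_int_add[OF disjI1[OF q_nz]] power2_eq_square)
  then have y2: "y\<^sup>2 = q powi (n mod 2)"
    using n q_nz by (simp add: y_def power_divide)
  have inv: "f (1 / y) = - f y / y\<^sup>2" by (rule odd_theta_inverse[OF f y(1)])
  have "f y = 0"
  proof (cases "n mod 2 = 0")
    case True
    then have "y * y = 1" using y2 by (simp add: power2_eq_square)
    then have "1 / y = y" using y(1) by (simp add: field_simps)
    then have "f y = - f y" using inv y2 True by simp
    then show ?thesis by simp
  next
    case False
    then have "n mod 2 = 1" by presburger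
    then have yq: "y\<^sup>2 = q" using y2 by simp
    then have "q * (1 / y) = y" using y(1) by (simp add: power2_eq_square field_simps)
    then have "f y = f (1 / y) / ((1 / y) ^ 6 * q\<^sup>2)"
      using odd_theta_mult_q[OF f, of "1 / y"] y(1) by simp
    moreover have "y ^ 6 = q ^ 3" using yq power_mult[of y 2 3] by simp
    ultimately have "f y = f (1 / y) * q"
      using q_nz by (simp add: power_divide power2_eq_square power3_eq_cube)
    also have "f (1 / y) = - f y / q" using inv yq by simp
    finally have "f y = - f y" using q_nz by simp
    then show ?thesis by simp
  qed
  moreover have "q powi k \<in> qpowers q" by (auto simp: qpowers_def)
  ultimately show ?thesis using odd_theta_eq_0_mult_qpowers[OF f y(1)] y(2) by simp
qed

text \<open>
  It spans the odd theta functions vanishing at \<open>m\<close>, as shown below for \<open>m\<^sup>2 \<notin> q^\<int>\<close>.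
\<close>

definition odd_theta_basis :: "complex \<Rightarrow> complex \<Rightarrow> complex" where
  "odd_theta_basis m x = theta q (x\<^sup>2) * theta q (x * m) * theta q (m / x)"

lemma odd_theta_basis_mult_q:
  assumes "m \<noteq> 0" "x \<noteq> 0"
  shows "odd_theta_basis m (q * x) = odd_theta_basis m x / (x ^ 6 * q\<^sup>2)"
proof -
  have "(q * x)\<^sup>2 = q * (q * x\<^sup>2)" by (simp add: power2_eq_square)
  moreover have "theta q (q * (q * x\<^sup>2)) = theta q (x\<^sup>2) / (x\<^sup>2 * (q * x\<^sup>2))"
    using theta_mult_q[of "q * x\<^sup>2"] theta_mult_q[of "x\<^sup>2"] assms q_nz by simp
  ultimately have 1: "theta q ((q * x)\<^sup>2) = theta q (x\<^sup>2) / (x\<^sup>2 * (q * x\<^sup>2))"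
    by simp
  have 2: "theta q (q * x * m) = - theta q (x * m) / (x * m)"
    using assms theta_mult_q[of "x * m"] by (simp add: mult.assoc)
  have 3: "theta q (m / (q * x)) = - (m / x / q) * theta q (m / x)"
    using assms theta_divide_q[of "m / x"] by (simp add: mult.commute)
  show ?thesis unfolding odd_theta_basis_def 1 2 3
    using assms q_nz by (simp add: field_simps power2_eq_square power4_eq_xxxx power_numeral_reduce)
qed

lemma odd_theta_basis_eq_0_iff:
  assumes "m \<noteq> 0" "x \<noteq> 0"
  shows "odd_theta_basis m x = 0 \<longleftrightarrow> x\<^sup>2 \<in> qpowers q \<or> x * m \<in> qpowers q \<or> m / x \<in> qpowers q"
  using assms by (simp add: odd_theta_basis_def theta_eq_0_iff)

lemma holomorphic_odd_theta_basis:
  "m \<noteq> 0 \<Longrightarrow> odd_theta_basis m holomorphic_on - {0}"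
  unfolding odd_theta_basis_def by (intro holomorphic_intros) auto

text \<open>
  If two of the three theta factors vanished at \<open>x\<close>, then \<open>m\<^sup>2\<close> would be a power of \<open>q\<close>.
\<close>

lemma simple_zero_odd_theta_basis:
  assumes "m \<noteq> 0" "x \<noteq> 0" "m\<^sup>2 \<notin> qpowers q" "odd_theta_basis m x = 0"
  shows "simple_zero (odd_theta_basis m) x"
proof -
  have diff: "f field_differentiable at x" if "f holomorphic_on - {0}" for f
    using that assms(2) by (intro holomorphic_on_imp_differentiable_at[where s = "- {0}"]) auto
  define A where "A = (\<lambda>x. theta q (x\<^sup>2))"
  define B where "B = (\<lambda>x. theta q (x * m))"
  define C where "C = (\<lambda>x. theta q (m / x))"
  have hA: "A holomorphic_on - {0}" and hB: "B holomorphic_on - {0}" and hC: "C holomorphic_on - {0}"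
    unfolding A_def B_def C_def using assms(1) by (auto intro!: holomorphic_intros)
  have eq: "odd_theta_basis m = (\<lambda>x. A x * (B x * C x))"
    by (simp add: odd_theta_basis_def A_def B_def C_def fun_eq_iff)
  have dA: "A x = 0 \<longleftrightarrow> x\<^sup>2 \<in> qpowers q" and dB: "B x = 0 \<longleftrightarrow> x * m \<in> qpowers q"
    and dC: "C x = 0 \<longleftrightarrow> m / x \<in> qpowers q"
    using assms(1,2) by (simp_all add: A_def B_def C_def theta_eq_0_iff)
  have "m\<^sup>2 = (x * m) * (m / x)" using assms(2) by (simp add: power2_eq_square)
  then have nBC: "\<not> (B x = 0 \<and> C x = 0)" using assms(3) qpowers_mult dB dC by metis
  have "m\<^sup>2 = (x * m) * (x * m) / x\<^sup>2" using assms(2) by (simp add: power2_eq_square)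
  then have nAB: "\<not> (A x = 0 \<and> B x = 0)"
    using assms(3) qpowers_mult qpowers_divide dA dB by metis
  have "m\<^sup>2 = (m / x) * (m / x) * x\<^sup>2" using assms(2) by (simp add: power2_eq_square)
  then have nAC: "\<not> (A x = 0 \<and> C x = 0)"
    using assms(3) qpowers_mult dA dC by metis
  consider "A x = 0" | "B x = 0" | "C x = 0" using assms(4) eq by auto
  then show ?thesis
  proof cases
    case 1
    have "simple_zero (theta q) (x\<^sup>2)" using 1 assms(2) by (intro simple_zero_theta) (auto simp: A_def)
    then have "simple_zero A x" unfolding A_def
      by (rule simple_zero_compose[where f = "theta q" and h = "\<lambda>x. x\<^sup>2" and D = "2 * x"])
        (use assms(2) in \<open>auto intro!: derivative_eq_intros\<close>)
    then show ?thesis unfolding eq using nAB nAC 1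
      by (intro simple_zero_mult_left diff holomorphic_intros hB hC) auto
  next
    case 2
    have "simple_zero (theta q) (x * m)" using 2 assms(1,2) by (intro simple_zero_theta) (auto simp: B_def)
    then have "simple_zero B x" unfolding B_def
      by (rule simple_zero_compose[where f = "theta q" and h = "\<lambda>x. x * m" and D = m])
        (use assms(1) in \<open>auto intro!: derivative_eq_intros\<close>)
    then show ?thesis unfolding eq using nAB nBC 2
      by (intro simple_zero_mult_right simple_zero_mult_left diff holomorphic_intros hA hC) auto
  next
    case 3
    have "simple_zero (theta q) (m / x)" using 3 assms(1,2) by (intro simple_zero_theta) (auto simp: C_def)
    then have "simple_zero C x" unfolding C_def
      by (rule simple_zero_compose[where f = "theta q" and h = "\<lambda>x. m / x" and D = "- (m / x\<^sup>2)"])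
        (use assms(1,2) in \<open>auto intro!: derivative_eq_intros simp: power2_eq_square\<close>)
    then show ?thesis unfolding eq using nAC nBC 3
      by (intro simple_zero_mult_right diff holomorphic_intros hA hB) auto
  qed
qed

text \<open>
  The function \<open>f\<close> vanishes at \<open>m\<close>, at \<open>1 / m\<close> by oddness and at the fixed points of the inversion, hence at all
  zeros of \<open>odd_theta_basis m\<close>, which are simple. The quotient is holomorphic and invariant under multiplication
  by \<open>q\<close>, so it is bounded on the translates of one circle and therefore constant.
\<close>

lemma odd_theta_eq_basis:
  assumes f: "odd_theta f" "f holomorphic_on - {0}" and "f m = 0" and m: "m \<noteq> 0" "m\<^sup>2 \<notin> qpowers q"
  shows "\<exists>c. \<forall>x. x \<noteq> 0 \<longrightarrow> f x = c * odd_theta_basis m x"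
proof -
  have "f x = 0 \<and> simple_zero (odd_theta_basis m) x" if "x \<in> - {0}" "odd_theta_basis m x = 0" for x
  proof -
    have x: "x \<noteq> 0" and x0: "odd_theta_basis m x = 0" using that by auto
    consider "x\<^sup>2 \<in> qpowers q" | "x * m \<in> qpowers q" | "m / x \<in> qpowers q"
      using x0 unfolding odd_theta_basis_eq_0_iff[OF m(1) x] by blast
    then have "f x = 0"
    proof cases
      case 1
      then show ?thesis by (rule odd_theta_eq_0_if_square[OF f(1)])
    next
      case 2
      have "f (1 / m) = 0" using odd_theta_inverse[OF f(1) m(1)] \<open>f m = 0\<close> by simp
      then have "f (x * m * (1 / m)) = 0"
        using m by (intro odd_theta_eq_0_mult_qpowers[OF f(1) _ 2]) auto
      then show ?thesis using m by simp
    next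
      case 3
      have "f (inverse (m / x) * m) = 0"
        using m qpowers_inverse[OF 3] \<open>f m = 0\<close> by (intro odd_theta_eq_0_mult_qpowers[OF f(1)]) auto
      then show ?thesis using m x by (simp add: field_simps)
    qed
    then show ?thesis using simple_zero_odd_theta_basis[OF m(1) x m(2) that(2)] by simp
  qed
  then obtain h where h: "h holomorphic_on - {0}" "\<And>x. x \<noteq> 0 \<Longrightarrow> f x = odd_theta_basis m x * h x"
    using holomorphic_divide_simple_zeros[OF _ f(2) holomorphic_odd_theta_basis[OF m(1)]] by auto
  \<comment> \<open>The square root of \<open>norm q\<close> accounts for the zeros with \<open>x\<^sup>2\<close> a power of \<open>q\<close>.\<close>
  define a :: "nat \<Rightarrow> real" where "a = (\<lambda>i. if i = 0 then 1 else if i = 1 then norm m else 1 / norm m)"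
  have "a i > 0" for i using m(1) by (simp add: a_def)
  then obtain \<rho> where \<rho>: "\<rho> > 0" "\<And>i n. \<rho> * a i \<noteq> sqrt (norm q) powi n"
    using exists_radius_avoiding[of "UNIV :: nat set" a "sqrt (norm q)"] by auto
  have powi': "norm u = (sqrt (norm q) powi n)\<^sup>2" if "u = q powi n" for u and n :: int
    using that norm_q_pos by (simp add: norm_power_int power2_eq_square flip: power_int_mult_distrib)
  have powi: "norm u = sqrt (norm q) powi (n + n)" if "u = q powi n" for u and n :: int
    unfolding powi'[OF that] power2_eq_square using norm_q_pos by (subst power_int_add) auto
  have nz: "odd_theta_basis m x \<noteq> 0" if "norm x = \<rho>" for x
  proof
    assume 0: "odd_theta_basis m x = 0"
    have x: "x \<noteq> 0" using that \<rho>(1) by auto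
    consider n :: int where "x\<^sup>2 = q powi n" | n :: int where "x * m = q powi n" | n :: int where "m / x = q powi n"
      using 0 unfolding odd_theta_basis_eq_0_iff[OF m(1) x] qpowers_def by blast
    then show False
    proof cases
      case 1
      have "(norm x)\<^sup>2 = (sqrt (norm q) powi n)\<^sup>2"
        using powi'[OF 1] by (simp add: norm_power)
      then have "norm x = sqrt (norm q) powi n"
        by (rule power2_eq_imp_eq) (use norm_q_pos in simp_all)
      then show False using \<rho>(2)[of 0 n] that by (simp add: a_def)
    next
      case 2
      have "norm x * norm m = sqrt (norm q) powi (n + n)" using powi[OF 2] by (simp only: norm_mult)
      then show False using \<rho>(2)[of 1 "n + n"] that by (simp add: a_def)
    next
      case 3
      have "norm x / norm m = sqrt (norm q) powi (- n + - n)"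
      proof -
        have "x / m = q powi (- n)" using arg_cong[OF 3, of inverse] by (simp add: power_int_minus)
        then show ?thesis by (rule powi[of "x / m" "- n", unfolded norm_divide])
      qed
      then show False using \<rho>(2)[of 2 "- n + - n"] that by (simp add: a_def)
    qed
  qed
  have per: "h (q * x) = h x" if "odd_theta_basis m x \<noteq> 0" "x \<noteq> 0" for x
  proof -
    have "odd_theta_basis m (q * x) * h (q * x) = odd_theta_basis m x * h x / (x ^ 6 * q\<^sup>2)"
      using h(2)[of x] h(2)[of "q * x"] that odd_theta_mult_q[OF f(1), of x] q_nz by simp
    then show ?thesis
      using that q_nz m(1) by (simp add: odd_theta_basis_mult_q)
  qed
  have nzq: "odd_theta_basis m (u * x) \<noteq> 0" if "odd_theta_basis m x \<noteq> 0" "x \<noteq> 0" "u \<in> qpowers q" for u x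
  proof
    assume 0: "odd_theta_basis m (u * x) = 0"
    have u: "u \<noteq> 0" using that(3) qpowers_nz by blast
    have "x\<^sup>2 = (u * x)\<^sup>2 / (u * u)" "x * m = (u * x * m) / u" "m / x = (m / (u * x)) * u"
      using u by (simp_all add: power2_eq_square)
    moreover have "(u * x)\<^sup>2 \<in> qpowers q \<or> u * x * m \<in> qpowers q \<or> m / (u * x) \<in> qpowers q"
      using 0 odd_theta_basis_eq_0_iff[OF m(1), of "u * x"] u that(2) by simp
    ultimately have "x\<^sup>2 \<in> qpowers q \<or> x * m \<in> qpowers q \<or> m / x \<in> qpowers q"
      using qpowers_mult[OF that(3) that(3)] qpowers_divide qpowers_mult[OF _ that(3)] that(3) by metis
    then show False using that(1) odd_theta_basis_eq_0_iff[OF m(1) that(2)] by blast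
  qed
  have per_pow: "h (q ^ n * x) = h x" if "odd_theta_basis m x \<noteq> 0" "x \<noteq> 0" for x n
  proof (induction n)
    case (Suc n)
    have "h (q * (q ^ n * x)) = h (q ^ n * x)"
      using that nzq[OF that qpowers_power] q_nz by (intro per) auto
    then show ?case using Suc by (simp add: mult.assoc)
  qed simp
  have per_int: "h (q powi n * x) = h x" if "odd_theta_basis m x \<noteq> 0" "x \<noteq> 0" for x and n :: int
  proof (cases "n \<ge> 0")
    case True
    then show ?thesis using per_pow[OF that, of "nat n"] by (simp add: power_int_def)
  next
    case False
    have "q powi n \<in> qpowers q" by (auto simp: qpowers_def)
    then have "odd_theta_basis m (q powi n * x) \<noteq> 0" using nzq that by blast
    then have "h (q ^ nat (- n) * (q powi n * x)) = h (q powi n * x)"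
      using that q_nz by (intro per_pow) auto
    moreover have "q ^ nat (- n) * (q powi n * x) = x"
      using False q_nz by (simp add: power_int_def field_simps)
    ultimately show ?thesis by simp
  qed
  have "compact (h ` sphere 0 \<rho>)"
    using \<rho>(1) by (intro compact_continuous_image continuous_on_subset[OF holomorphic_on_imp_continuous_on[OF h(1)]]) auto
  then obtain K where K: "\<And>x. norm x = \<rho> \<Longrightarrow> norm (h x) \<le> K"
    using compact_imp_bounded bounded_iff by (metis image_eqI mem_sphere_0)
  have "\<exists>c. \<forall>z. z \<noteq> 0 \<longrightarrow> h z = c"
  proof (rule bounded_on_circles_imp_constant[OF h(1) norm_q_pos q_lt \<rho>(1)])
    fix z :: complex and n :: int
    assume z: "norm z = \<rho> * norm q powi n"
    define x where "x = z / q powi n"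
    have "norm x = \<rho>" using z q_nz by (simp add: x_def norm_divide norm_power_int)
    moreover have "x \<noteq> 0" using \<open>norm x = \<rho>\<close> \<rho>(1) by auto
    moreover have "z = q powi n * x" using q_nz by (simp add: x_def)
    ultimately show "norm (h z) \<le> K" using K per_int nz by metis
  qed
  then obtain c where "\<And>z. z \<noteq> 0 \<Longrightarrow> h z = c" by blast
  then show ?thesis using h(2) by (auto simp: mult.commute)
qed

end

section \<open>The bilateral series as an odd theta function\<close>

text \<open>
  The term of index \<open>k \<ge> 0\<close> of the very-well-poised series, multiplied by the prefactor of the series in the
  theorem. The infinite products in the prefactor cancel the denominators of the term, so that the result is
  holomorphic in \<open>x\<close> and in the parameters away from 0.
\<close>

definition bil_term :: "complex \<Rightarrow> (nat \<Rightarrow> complex) \<Rightarrow> complex \<Rightarrow> nat \<Rightarrow> complex" where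
  "bil_term q b x k = q ^ k * (1 - x\<^sup>2 * q ^ (2 * k)) *
     (\<Prod>j=1..6. fpoch q (x * b j) k * qpoch_inf q (q / (x * b j)) * qpoch_inf q (q ^ Suc k * x / b j))"

text \<open>
  The terms of negative index are obtained from those of positive index by \<open>x \<mapsto> 1 / x\<close>, up to the factor \<open>- x\<^sup>2\<close>.
  The bilateral series is therefore written with two sums over the natural numbers.
\<close>

definition bil_sum :: "complex \<Rightarrow> (nat \<Rightarrow> complex) \<Rightarrow> complex \<Rightarrow> complex" where
  "bil_sum q b x = (\<Sum>k. bil_term q b x k) - x\<^sup>2 * (\<Sum>k. bil_term q b (1 / x) (Suc k))"

definition theta_comb :: "complex \<Rightarrow> (nat \<Rightarrow> complex) \<Rightarrow> complex \<Rightarrow> complex" where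
  "theta_comb q b x = (\<Prod>j=1..6. theta q (x * b j)) - q / x\<^sup>2 * (\<Prod>j=1..6. theta q (x / b j))"

text \<open>
  The left-hand side of the theorem times \<open>theta q (m / x)\<close>. It is a two by two determinant formed from the
  series and the theta combination, evaluated at \<open>x\<close> and \<open>m\<close>.
\<close>

definition det_fun :: "complex \<Rightarrow> (nat \<Rightarrow> complex) \<Rightarrow> complex \<Rightarrow> complex \<Rightarrow> complex" where
  "det_fun q b x m = bil_sum q b x * theta_comb q b m - m / x * bil_sum q b m * theta_comb q b x"

context q_base
begin

lemma norm_bil_factor_le:
  assumes R: "norm x \<le> R" "norm (1 / x) \<le> R" "norm c \<le> R" "norm (1 / c) \<le> R"
  shows "norm (fpoch q (x * c) k * qpoch_inf q (q / (x * c)) * qpoch_inf q (q ^ Suc k * x / c))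
    \<le> exp (R\<^sup>2 / (1 - norm q)) ^ 3"
proof -
  let ?E = "exp (R\<^sup>2 / (1 - norm q))"
  have R0: "R \<ge> 0" using R(1) norm_ge_zero order_trans by blast
  have q1: "norm q ^ n \<le> 1" for n using q_lt by (simp add: power_le_one)
  have n1: "norm (x * c) \<le> R\<^sup>2"
    using R(1,3) R0 by (simp add: norm_mult power2_eq_square mult_mono)
  have "norm (1 / x) * norm (1 / c) \<le> R\<^sup>2"
    unfolding power2_eq_square using R(2,4) R0 by (intro mult_mono) auto
  then have "norm q ^ 1 * (norm (1 / x) * norm (1 / c)) \<le> 1 * R\<^sup>2"
    using q1[of 1] by (intro mult_mono) auto
  then have n2: "norm (q / (x * c)) \<le> R\<^sup>2" by (simp add: norm_divide norm_mult)
  have "norm x * norm (1 / c) \<le> R\<^sup>2"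
    unfolding power2_eq_square using R(1,4) R0 by (intro mult_mono) auto
  then have "norm q ^ Suc k * (norm x * norm (1 / c)) \<le> 1 * R\<^sup>2"
    using q1[of "Suc k"] by (intro mult_mono) auto
  then have n3: "norm (q ^ Suc k * x / c) \<le> R\<^sup>2" by (simp add: norm_divide norm_mult norm_power mult_ac)
  have "norm (fpoch q (x * c) k * qpoch_inf q (q / (x * c)) * qpoch_inf q (q ^ Suc k * x / c))
     \<le> ?E * ?E * ?E"
    unfolding norm_mult using norm_fpoch_le'[OF n1] norm_qinf_le'[OF n2] norm_qinf_le'[OF n3]
    by (intro mult_mono) auto
  then show ?thesis by (simp add: power3_eq_cube)
qed

lemma norm_well_poised_factor_le:
  assumes "norm x \<le> R"
  shows "norm (1 - x\<^sup>2 * q ^ (2 * k)) \<le> 1 + R\<^sup>2"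
proof -
  have "norm (1 - x\<^sup>2 * q ^ (2 * k)) \<le> norm (1::complex) + norm (x\<^sup>2 * q ^ (2 * k))"
    by (rule norm_triangle_ineq4)
  also have "norm (x\<^sup>2 * q ^ (2 * k)) \<le> R\<^sup>2 * 1"
    unfolding norm_mult norm_power using assms q_lt by (intro mult_mono power_mono power_le_one) auto
  finally show ?thesis by simp
qed

text \<open>
  A geometric majorant that depends only on bounds for the variable, the parameters and their reciprocals. It
  gives both convergence and locally uniform convergence.
\<close>

lemma norm_bil_term_le:
  assumes R: "norm x \<le> R" "norm (1 / x) \<le> R"
    "\<And>j. j \<in> {1..6} \<Longrightarrow> norm (b j) \<le> R" "\<And>j. j \<in> {1..6} \<Longrightarrow> norm (1 / b j) \<le> R"
  shows "norm (bil_term q b x k) \<le> (1 + R\<^sup>2) * (exp (R\<^sup>2 / (1 - norm q)) ^ 3) ^ 6 * norm q ^ k"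
proof -
  let ?E = "exp (R\<^sup>2 / (1 - norm q))"
  have "norm (\<Prod>j=1..6. fpoch q (x * b j) k * qpoch_inf q (q / (x * b j)) * qpoch_inf q (q ^ Suc k * x / b j))
      \<le> (\<Prod>j::nat=1..6. ?E ^ 3)"
    unfolding prod_norm[symmetric] by (intro prod_mono conjI norm_bil_factor_le R norm_ge_zero)
  moreover have "norm (1 - x\<^sup>2 * q ^ (2 * k)) \<le> 1 + R\<^sup>2"
    using R(1) by (rule norm_well_poised_factor_le)
  ultimately have "norm (bil_term q b x k) \<le> norm q ^ k * (1 + R\<^sup>2) * (\<Prod>j::nat=1..6. ?E ^ 3)"
    unfolding bil_term_def norm_mult norm_power by (intro mult_mono mult_nonneg_nonneg) auto
  then show ?thesis by (simp add: mult_ac)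
qed

end

locale six_params = q_base +
  fixes b :: "nat \<Rightarrow> complex"
  assumes b_nz: "\<And>j. j \<in> {1..6} \<Longrightarrow> b j \<noteq> 0"
    and b_prod: "(\<Prod>j=1..6. b j) = q"
begin

lemma summable_norm_bil_term: "summable (\<lambda>k. norm (bil_term q b x k))"
proof -
  define R where "R = norm x + norm (1 / x) + (\<Sum>j=1..6. norm (b j)) + (\<Sum>j=1..6. norm (1 / b j))"
  have pos: "(\<Sum>j::nat=1..6. norm (b j)) \<ge> 0" "(\<Sum>j::nat=1..6. norm (1 / b j)) \<ge> 0"
    by (intro sum_nonneg; simp)+
  have b: "norm (b j) \<le> (\<Sum>j=1..6. norm (b j))" "norm (1 / b j) \<le> (\<Sum>j=1..6. norm (1 / b j))"
    if "j \<in> {1..6}" for j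
    using that by (intro member_le_sum; simp)+
  have R: "norm x \<le> R" "norm (1 / x) \<le> R"
    "\<And>j. j \<in> {1..6} \<Longrightarrow> norm (b j) \<le> R" "\<And>j. j \<in> {1..6} \<Longrightarrow> norm (1 / b j) \<le> R"
    unfolding R_def using pos b norm_ge_zero[of x] norm_ge_zero[of "1 / x"] by (smt (verit))+
  show ?thesis
  proof (rule summable_comparison_test')
    show "norm (norm (bil_term q b x k)) \<le> (1 + R\<^sup>2) * (exp (R\<^sup>2 / (1 - norm q)) ^ 3) ^ 6 * norm q ^ k" for k
      using norm_bil_term_le[OF R] by simp
  qed (use q_lt in \<open>auto intro!: summable_mult summable_geometric\<close>)
qed

lemma summable_bil_term: "summable (bil_term q b x)"
  by (rule summable_norm_cancel[OF summable_norm_bil_term])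

text \<open>
  Multiplication of \<open>x\<close> by \<open>q\<close> moves one factor between the finite and the infinite product for each \<open>j\<close>; the
  condition on the product of the parameters makes the collected monomial independent of \<open>b\<close>. Thus the shift of
  the variable is a shift of the summation index.
\<close>

lemma bil_term_mult_q:
  assumes "x \<noteq> 0"
  shows "bil_term q b (q * x) k = bil_term q b x (Suc k) / (x ^ 6 * q\<^sup>2)"
proof -
  let ?g = "\<lambda>x k j. fpoch q (x * b j) k * qpoch_inf q (q / (x * b j)) * qpoch_inf q (q ^ Suc k * x / b j)"
  have "(\<Prod>j=1..6. ?g (q * x) k j) = (\<Prod>j=1..6. (- 1 / (x * b j)) * ?g x (Suc k) j)"
  proof (rule prod.cong[OF refl])
    fix j :: nat assume j: "j \<in> {1..6}"
    have xb: "x * b j \<noteq> 0" using assms b_nz[OF j] by simp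
    have 1: "fpoch q (x * b j) (Suc k) = (1 - x * b j) * fpoch q (q * x * b j) k"
      by (simp add: fpoch_Suc_left mult_ac)
    have "q / (q * x * b j) = 1 / (x * b j)" using q_nz by simp
    then have 2: "qpoch_inf q (q / (q * x * b j)) = (1 - 1 / (x * b j)) * qpoch_inf q (q / (x * b j))"
      using qinf_Suc[of "1 / (x * b j)"] by simp
    have 3: "q ^ Suc k * (q * x) / b j = q ^ Suc (Suc k) * x / b j" by simp
    have 4: "1 - 1 / (x * b j) = (- 1 / (x * b j)) * (1 - x * b j)"
      using xb by (simp add: field_simps)
    show "?g (q * x) k j = (- 1 / (x * b j)) * ?g x (Suc k) j"
      unfolding 1 2 3 4 by (simp only: mult_ac)
  qed
  also have "\<dots> = (\<Prod>j=1..6. - 1 / (x * b j)) * (\<Prod>j=1..6. ?g x (Suc k) j)"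
    by (simp only: prod.distrib)
  also have "(\<Prod>j=1..6. - 1 / (x * b j)) = 1 / (x ^ 6 * q)"
    unfolding prod_dividef prod.distrib b_prod by simp
  finally have eq: "(\<Prod>j=1..6. ?g (q * x) k j) = 1 / (x ^ 6 * q) * (\<Prod>j=1..6. ?g x (Suc k) j)" .
  have eq2: "(q * x)\<^sup>2 * q ^ (2 * k) = x\<^sup>2 * q ^ (2 * Suc k)"
    by (simp add: power2_eq_square)
  show ?thesis unfolding bil_term_def eq eq2
    using q_nz assms by (simp add: power2_eq_square)
qed

lemma bil_term_0_inverse:
  assumes "x \<noteq> 0"
  shows "bil_term q b (1 / x) 0 = - bil_term q b x 0 / x\<^sup>2"
proof -
  have "(\<Prod>j=1..6. fpoch q (1 / x * b j) 0 * qpoch_inf q (q / (1 / x * b j)) * qpoch_inf q (q ^ Suc 0 * (1 / x) / b j))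
      = (\<Prod>j=1..6. fpoch q (x * b j) 0 * qpoch_inf q (q / (x * b j)) * qpoch_inf q (q ^ Suc 0 * x / b j))"
    by (intro prod.cong refl) (simp add: mult_ac)
  moreover have "1 - (1 / x)\<^sup>2 * q ^ (2 * 0) = - (1 - x\<^sup>2 * q ^ (2 * 0)) / x\<^sup>2"
    using assms by (simp add: power_divide field_simps)
  ultimately show ?thesis unfolding bil_term_def by (simp del: minus_diff_eq)
qed

lemma bil_sum_head: "(\<Sum>k. bil_term q b x k) = bil_term q b x 0 + (\<Sum>k. bil_term q b x (Suc k))"
  using suminf_split_head[OF summable_bil_term[of x]] by simp

text \<open>
  A bilateral series does not change when its index is shifted. In terms of the two one-sided sums, the term of
  index 0 passes from one to the other by \<open>bil_term_0_inverse\<close>.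
\<close>

lemma odd_theta_bil_sum: "odd_theta (bil_sum q b)"
  unfolding odd_theta_def
proof (intro allI impI conjI)
  fix x :: complex assume x: "x \<noteq> 0"
  have summ: "summable (\<lambda>k. bil_term q b y (Suc k))" for y
    using summable_bil_term[of y] by (subst summable_Suc_iff)
  have "bil_term q b (1 / (q * x)) (Suc k) = bil_term q b (1 / x) k / (x ^ 6 * q ^ 4)" for k
  proof -
    have "bil_term q b (q * (1 / (q * x))) k = bil_term q b (1 / (q * x)) (Suc k) / ((1 / (q * x)) ^ 6 * q\<^sup>2)"
      using x q_nz by (intro bil_term_mult_q) auto
    moreover have "q * (1 / (q * x)) = 1 / x" using q_nz by simp
    ultimately have "bil_term q b (1 / x) k = bil_term q b (1 / (q * x)) (Suc k) / ((1 / (q * x)) ^ 6 * q\<^sup>2)"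
      by simp
    also have "(1 / (q * x)) ^ 6 * q\<^sup>2 = 1 / (x ^ 6 * q ^ 4)"
      using q_nz x by (simp add: power_divide power_mult_distrib power_numeral_reduce)
    finally show ?thesis using x q_nz by simp
  qed
  then have neg: "(\<Sum>k. bil_term q b (1 / (q * x)) (Suc k)) = (\<Sum>k. bil_term q b (1 / x) k) / (x ^ 6 * q ^ 4)"
    by (simp add: suminf_divide summable_bil_term)
  have pos: "(\<Sum>k. bil_term q b (q * x) k) = (\<Sum>k. bil_term q b x (Suc k)) / (x ^ 6 * q\<^sup>2)"
    by (simp add: bil_term_mult_q[OF x] suminf_divide summ)
  \<comment> \<open>The other way of distributing the term of index 0 over the two sums.\<close>
  have sym: "(\<Sum>k. bil_term q b x (Suc k)) - x\<^sup>2 * (\<Sum>k. bil_term q b (1 / x) k) = bil_sum q b x"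
    unfolding bil_sum_def bil_sum_head[of x] bil_sum_head[of "1 / x"] bil_term_0_inverse[OF x]
    using x by (simp add: algebra_simps)
  show "bil_sum q b (q * x) = bil_sum q b x / (x ^ 6 * q\<^sup>2)"
  proof -
    have "bil_sum q b (q * x) = (\<Sum>k. bil_term q b x (Suc k)) / (x ^ 6 * q\<^sup>2)
        - (q * x)\<^sup>2 * ((\<Sum>k. bil_term q b (1 / x) k) / (x ^ 6 * q ^ 4))"
      unfolding bil_sum_def pos neg ..
    also have "\<dots> = ((\<Sum>k. bil_term q b x (Suc k)) - x\<^sup>2 * (\<Sum>k. bil_term q b (1 / x) k)) / (x ^ 6 * q\<^sup>2)"
      using x q_nz by (simp add: field_simps power_numeral_reduce)
    finally show ?thesis by (simp add: sym)
  qed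
  show "bil_sum q b (1 / x) = - bil_sum q b x / x\<^sup>2"
    unfolding sym[symmetric] unfolding bil_sum_def using x by (simp add: power_divide field_simps)
qed

lemma theta_comb_mult_q:
  assumes "x \<noteq> 0"
  shows "theta_comb q b (q * x) = theta_comb q b x / (x ^ 6 * q)"
proof -
  have "(\<Prod>j=1..6. theta q (q * x * b j)) = (\<Prod>j=1..6. (- 1 / (x * b j)) * theta q (x * b j))"
    using assms b_nz by (intro prod.cong refl) (simp add: theta_mult_q mult.assoc)
  also have "\<dots> = (\<Prod>j=1..6. - 1 / (x * b j)) * (\<Prod>j=1..6. theta q (x * b j))"
    by (simp only: prod.distrib)
  also have "(\<Prod>j=1..6. - 1 / (x * b j)) = 1 / (x ^ 6 * q)"
    unfolding prod_dividef prod.distrib b_prod by simp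
  finally have 1: "(\<Prod>j=1..6. theta q (q * x * b j)) = 1 / (x ^ 6 * q) * (\<Prod>j=1..6. theta q (x * b j))" .
  have "(\<Prod>j=1..6. theta q (q * x / b j)) = (\<Prod>j=1..6. (- 1 * b j / x) * theta q (x / b j))"
  proof (intro prod.cong refl)
    fix j :: nat assume "j \<in> {1..6}"
    then show "theta q (q * x / b j) = (- 1 * b j / x) * theta q (x / b j)"
      using theta_mult_q[of "x / b j"] assms b_nz[of j] by simp
  qed
  also have "\<dots> = (\<Prod>j=1..6. - 1 * b j / x) * (\<Prod>j=1..6. theta q (x / b j))"
    by (simp only: prod.distrib)
  also have "(\<Prod>j=1..6. - 1 * b j / x) = q / x ^ 6"
    unfolding prod_dividef prod.distrib b_prod by simp
  finally have 2: "(\<Prod>j=1..6. theta q (q * x / b j)) = q / x ^ 6 * (\<Prod>j=1..6. theta q (x / b j))" .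
  show ?thesis unfolding theta_comb_def 1 2 using assms q_nz by (simp add: field_simps power2_eq_square)
qed

lemma theta_comb_inverse:
  assumes "x \<noteq> 0"
  shows "theta_comb q b (1 / x) = - theta_comb q b x / x ^ 4"
proof -
  have "(\<Prod>j=1..6. theta q (1 / x / b j)) = (\<Prod>j=1..6. (- 1 / (x * b j)) * theta q (x * b j))"
  proof (intro prod.cong refl)
    fix j :: nat assume "j \<in> {1..6}"
    then show "theta q (1 / x / b j) = (- 1 / (x * b j)) * theta q (x * b j)"
      using theta_inverse[of "x * b j"] assms b_nz[of j] by simp
  qed
  also have "\<dots> = (\<Prod>j=1..6. - 1 / (x * b j)) * (\<Prod>j=1..6. theta q (x * b j))"
    by (simp only: prod.distrib)
  also have "(\<Prod>j=1..6. - 1 / (x * b j)) = 1 / (x ^ 6 * q)"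
    unfolding prod_dividef prod.distrib b_prod by simp
  finally have 1: "(\<Prod>j=1..6. theta q (1 / x / b j)) = 1 / (x ^ 6 * q) * (\<Prod>j=1..6. theta q (x * b j))" .
  have "(\<Prod>j=1..6. theta q (1 / x * b j)) = (\<Prod>j=1..6. (- 1 * b j / x) * theta q (x / b j))"
  proof (intro prod.cong refl)
    fix j :: nat assume "j \<in> {1..6}"
    then show "theta q (1 / x * b j) = (- 1 * b j / x) * theta q (x / b j)"
      using theta_inverse[of "x / b j"] assms b_nz[of j] by simp
  qed
  also have "\<dots> = (\<Prod>j=1..6. - 1 * b j / x) * (\<Prod>j=1..6. theta q (x / b j))"
    by (simp only: prod.distrib)
  also have "(\<Prod>j=1..6. - 1 * b j / x) = q / x ^ 6"
    unfolding prod_dividef prod.distrib b_prod by simp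
  finally have 2: "(\<Prod>j=1..6. theta q (1 / x * b j)) = q / x ^ 6 * (\<Prod>j=1..6. theta q (x / b j))" .
  show ?thesis unfolding theta_comb_def 1 2 using assms q_nz
    by (simp add: field_simps power_numeral_reduce)
qed

lemma odd_theta_theta_comb: "odd_theta (\<lambda>x. theta_comb q b x / x)"
  unfolding odd_theta_def
proof (intro allI impI conjI)
  fix x :: complex assume x: "x \<noteq> 0"
  show "theta_comb q b (q * x) / (q * x) = theta_comb q b x / x / (x ^ 6 * q\<^sup>2)"
    unfolding theta_comb_mult_q[OF x] using x q_nz by (simp add: power2_eq_square)
  show "theta_comb q b (1 / x) / (1 / x) = - (theta_comb q b x / x) / x\<^sup>2"
    unfolding theta_comb_inverse[OF x] using x by (simp add: power2_eq_square power4_eq_xxxx)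
qed

lemma odd_theta_lincomb:
  assumes "odd_theta f" "odd_theta g"
  shows "odd_theta (\<lambda>x. f x * a - c * g x)"
  unfolding odd_theta_def
proof (intro allI impI conjI)
  fix x :: complex assume x: "x \<noteq> 0"
  show "f (q * x) * a - c * g (q * x) = (f x * a - c * g x) / (x ^ 6 * q\<^sup>2)"
    unfolding odd_theta_mult_q[OF assms(1) x] odd_theta_mult_q[OF assms(2) x] by (simp add: diff_divide_distrib)
  show "f (1 / x) * a - c * g (1 / x) = - (f x * a - c * g x) / x\<^sup>2"
    unfolding odd_theta_inverse[OF assms(1) x] odd_theta_inverse[OF assms(2) x] by (simp add: diff_divide_distrib)
qed

lemma odd_theta_det_fun: "odd_theta (\<lambda>x. det_fun q b x m)"
proof -
  have eq: "det_fun q b x m = bil_sum q b x * theta_comb q b m - m * bil_sum q b m * (theta_comb q b x / x)" for x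
    by (simp add: det_fun_def)
  show ?thesis
    unfolding eq by (rule odd_theta_lincomb[OF odd_theta_bil_sum odd_theta_theta_comb])
qed

end

lemma det_fun_swap:
  assumes "x \<noteq> 0" "m \<noteq> 0"
  shows "det_fun q b x m = - (m / x) * det_fun q b m x"
  unfolding det_fun_def using assms by (simp add: field_simps)

lemma det_fun_diag: "m \<noteq> 0 \<Longrightarrow> det_fun q b m m = 0"
  by (simp add: det_fun_def)

text \<open>
  Stated for a holomorphic family of variables and parameters, because it is applied in the variable \<open>x\<close>, along
  the one-parameter family \<open>b 1 = s\<close>, \<open>b 2 = p / s\<close>, and along a perturbation of all parameters.
\<close>

lemma (in q_base) holomorphic_bil_series:
  assumes "open A" and x: "x holomorphic_on A" "\<And>z. z \<in> A \<Longrightarrow> x z \<noteq> 0"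
    and b: "\<And>j. j \<in> {1..6} \<Longrightarrow> (\<lambda>z. b z j) holomorphic_on A" "\<And>j z. j \<in> {1..6} \<Longrightarrow> z \<in> A \<Longrightarrow> b z j \<noteq> 0"
  shows "(\<lambda>z. \<Sum>k. bil_term q (b z) (x z) (k + n)) holomorphic_on A"
proof (rule holomorphic_uniform_sequence[OF \<open>open A\<close>, where f = "\<lambda>N z. \<Sum>k<N. bil_term q (b z) (x z) (k + n)"])
  show "(\<lambda>z. \<Sum>k<N. bil_term q (b z) (x z) (k + n)) holomorphic_on A" for N
    unfolding bil_term_def using x b by (intro holomorphic_intros) auto
next
  fix z0 assume "z0 \<in> A"
  then obtain d where d: "d > 0" "cball z0 d \<subseteq> A" using \<open>open A\<close> open_contains_cball by blast
  let ?X = "cball z0 d"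
  have ex: "\<exists>R. \<forall>z\<in>?X. norm (f z) \<le> R" if "f holomorphic_on A" for f :: "complex \<Rightarrow> complex"
  proof -
    have "compact (f ` ?X)"
      using d(2) by (intro compact_continuous_image holomorphic_on_imp_continuous_on holomorphic_on_subset[OF that]) auto
    then show ?thesis using compact_imp_bounded bounded_iff by (metis image_eqI)
  qed
  have "\<exists>R. \<forall>z\<in>?X. norm (x z) \<le> R" using ex x by blast
  then obtain R1 where R1: "\<forall>z\<in>?X. norm (x z) \<le> R1" by blast
  have "(\<lambda>z. 1 / x z) holomorphic_on A" using x by (intro holomorphic_intros) auto
  then obtain R2 where R2: "\<forall>z\<in>?X. norm (1 / x z) \<le> R2" using ex by blast
  have "\<exists>R. \<forall>z\<in>?X. norm (b z j) \<le> R" if "j \<in> {1..6}" for j using ex b(1) that by blast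
  then obtain R3 where R3: "\<And>j z. j \<in> {1..6} \<Longrightarrow> z \<in> ?X \<Longrightarrow> norm (b z j) \<le> R3 j" by metis
  have "\<exists>R. \<forall>z\<in>?X. norm (1 / b z j) \<le> R" if "j \<in> {1..6}" for j
    using b that by (intro ex holomorphic_intros) auto
  then obtain R4 where R4: "\<And>j z. j \<in> {1..6} \<Longrightarrow> z \<in> ?X \<Longrightarrow> norm (1 / b z j) \<le> R4 j" by metis
  define R where "R = \<bar>R1\<bar> + \<bar>R2\<bar> + (\<Sum>j=1..6. \<bar>R3 j\<bar>) + (\<Sum>j=1..6. \<bar>R4 j\<bar>)"
  have pos: "(\<Sum>j::nat=1..6. \<bar>R3 j\<bar>) \<ge> 0" "(\<Sum>j::nat=1..6. \<bar>R4 j\<bar>) \<ge> 0"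
    by (intro sum_nonneg; simp)+
  have mem: "\<bar>R3 j\<bar> \<le> (\<Sum>j=1..6. \<bar>R3 j\<bar>)" "\<bar>R4 j\<bar> \<le> (\<Sum>j=1..6. \<bar>R4 j\<bar>)" if "j \<in> {1..6}" for j
    using that by (intro member_le_sum; simp)+
  have RR: "\<bar>R1\<bar> \<le> R" "\<bar>R2\<bar> \<le> R" "\<And>j. j \<in> {1..6} \<Longrightarrow> \<bar>R3 j\<bar> \<le> R" "\<And>j. j \<in> {1..6} \<Longrightarrow> \<bar>R4 j\<bar> \<le> R"
    unfolding R_def using pos mem by (smt (verit))+
  let ?M = "\<lambda>k. (1 + R\<^sup>2) * (exp (R\<^sup>2 / (1 - norm q)) ^ 3) ^ 6 * norm q ^ (k + n)"
  have "uniform_limit ?X (\<lambda>N z. \<Sum>k<N. bil_term q (b z) (x z) (k + n)) (\<lambda>z. \<Sum>k. bil_term q (b z) (x z) (k + n)) sequentially"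
  proof (rule Weierstrass_m_test[where M = ?M])
    fix k z assume z: "z \<in> ?X"
    have "norm (x z) \<le> R" using R1 z RR(1) by fastforce
    moreover have "norm (1 / x z) \<le> R" using R2 z RR(2) by fastforce
    moreover have "norm (b z j) \<le> R" if "j \<in> {1..6}" for j using R3[OF that z] RR(3)[OF that] by linarith
    moreover have "norm (1 / b z j) \<le> R" if "j \<in> {1..6}" for j using R4[OF that z] RR(4)[OF that] by linarith
    ultimately show "norm (bil_term q (b z) (x z) (k + n)) \<le> ?M k" by (rule norm_bil_term_le)
  next
    have "summable (\<lambda>k. norm q ^ (k + n))" using q_lt by (simp add: power_add summable_mult2 summable_geometric)
    then show "summable ?M" by (intro summable_mult)
  qed
  then show "\<exists>d>0. cball z0 d \<subseteq> A \<and>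
      uniform_limit (cball z0 d) (\<lambda>N z. \<Sum>k<N. bil_term q (b z) (x z) (k + n))
        (\<lambda>z. \<Sum>k. bil_term q (b z) (x z) (k + n)) sequentially"
    using d by blast
qed

lemma (in q_base) holomorphic_bil_sum:
  assumes "open A" and x: "x holomorphic_on A" "\<And>z. z \<in> A \<Longrightarrow> x z \<noteq> 0"
    and b: "\<And>j. j \<in> {1..6} \<Longrightarrow> (\<lambda>z. b z j) holomorphic_on A" "\<And>j z. j \<in> {1..6} \<Longrightarrow> z \<in> A \<Longrightarrow> b z j \<noteq> 0"
  shows "(\<lambda>z. bil_sum q (b z) (x z)) holomorphic_on A"
proof -
  have x': "(\<lambda>z. 1 / x z) holomorphic_on A" "\<And>z. z \<in> A \<Longrightarrow> 1 / x z \<noteq> 0"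
    using x by (auto intro!: holomorphic_intros)
  have "(\<lambda>z. \<Sum>k. bil_term q (b z) (x z) (k + 0)) holomorphic_on A"
    using assms by (rule holomorphic_bil_series)
  moreover have "(\<lambda>z. \<Sum>k. bil_term q (b z) (1 / x z) (k + 1)) holomorphic_on A"
    using \<open>open A\<close> x' b by (rule holomorphic_bil_series)
  ultimately show ?thesis
    unfolding bil_sum_def using x(1) by (intro holomorphic_intros) simp_all
qed

lemma (in q_base) holomorphic_det_fun:
  assumes "open A" and x: "x holomorphic_on A" "\<And>z. z \<in> A \<Longrightarrow> x z \<noteq> 0" and m: "m \<noteq> 0"
    and b: "\<And>j. j \<in> {1..6} \<Longrightarrow> (\<lambda>z. b z j) holomorphic_on A" "\<And>j z. j \<in> {1..6} \<Longrightarrow> z \<in> A \<Longrightarrow> b z j \<noteq> 0"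
  shows "(\<lambda>z. det_fun q (b z) (x z) m) holomorphic_on A"
proof -
  have "(\<lambda>z. bil_sum q (b z) (x z)) holomorphic_on A"
    using assms by (intro holomorphic_bil_sum) auto
  moreover have "(\<lambda>z. bil_sum q (b z) m) holomorphic_on A"
    using assms by (intro holomorphic_bil_sum) auto
  moreover have "(\<lambda>z. theta_comb q (b z) (x z)) holomorphic_on A" "(\<lambda>z. theta_comb q (b z) m) holomorphic_on A"
    unfolding theta_comb_def using x b m by (auto intro!: holomorphic_intros)
  ultimately show ?thesis
    unfolding det_fun_def using x by (intro holomorphic_intros) auto
qed

text \<open>
  The determinant is an odd theta function of \<open>x\<close> with a zero at \<open>x = m\<close>. This settles the dependence on \<open>x\<close>;
  what remains is to find the constant.
\<close>

lemma (in six_params) det_fun_eq_basis: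
  assumes m: "m \<noteq> 0" "m\<^sup>2 \<notin> qpowers q"
  shows "\<exists>c. \<forall>x. x \<noteq> 0 \<longrightarrow> det_fun q b x m = c * odd_theta_basis m x"
proof (rule odd_theta_eq_basis[OF odd_theta_det_fun _ _ m])
  show "(\<lambda>x. det_fun q b x m) holomorphic_on - {0}"
    using m b_nz by (intro holomorphic_det_fun) auto
qed (use m det_fun_diag in simp)

lemma (in six_params) det_fun_eq_0_if_square:
  assumes "x \<noteq> 0" "m \<noteq> 0" "x\<^sup>2 \<in> qpowers q \<or> m\<^sup>2 \<in> qpowers q"
  shows "det_fun q b x m = 0"
  using assms odd_theta_eq_0_if_square[OF odd_theta_det_fun] det_fun_swap[of x m] by fastforce

section \<open>Special values\<close>

definition pair_prod :: "complex \<Rightarrow> (nat \<Rightarrow> complex) \<Rightarrow> complex" where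
  "pair_prod q b = (\<Prod>(i, j) \<in> {(i, j). 1 \<le> i \<and> i < j \<and> j \<le> 6}. qpoch_inf q (q / (b i * b j)))"

lemma prod_1_6: "(\<Prod>j=1..6. f j) = f 1 * f 2 * f 3 * f 4 * f 5 * f (6::nat)"
  by (simp add: numeral_eq_Suc prod.atLeast_Suc_atMost mult.assoc)

lemma pair_prod_eq:
  "pair_prod q b =
     (let e = (\<lambda>i j. qpoch_inf q (q / (b i * b j))) in
      e 1 2 * e 1 3 * e 1 4 * e 1 5 * e 1 6 * e 2 3 * e 2 4 * e 2 5 * e 2 6 *
      e 3 4 * e 3 5 * e 3 6 * e 4 5 * e 4 6 * e 5 6)"
proof -
  have "{(i, j). 1 \<le> i \<and> i < j \<and> j \<le> (6::nat)} =
    {(1,2),(1,3),(1,4),(1,5),(1,6),(2,3),(2,4),(2,5),(2,6),(3,4),(3,5),(3,6),(4,5),(4,6),(5,6)}"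
    (is "?L = ?R")
  proof (rule set_eqI)
    fix p :: "nat \<times> nat"
    obtain i j where p: "p = (i, j)" by (cases p)
    have "1 \<le> i \<and> i < j \<and> j \<le> 6 \<longleftrightarrow> (i = 1 \<and> j = 2) \<or> (i = 1 \<and> j = 3) \<or> (i = 1 \<and> j = 4)
       \<or> (i = 1 \<and> j = 5) \<or> (i = 1 \<and> j = 6) \<or> (i = 2 \<and> j = 3) \<or> (i = 2 \<and> j = 4) \<or> (i = 2 \<and> j = 5)
       \<or> (i = 2 \<and> j = 6) \<or> (i = 3 \<and> j = 4) \<or> (i = 3 \<and> j = 5) \<or> (i = 3 \<and> j = 6) \<or> (i = 4 \<and> j = 5)
       \<or> (i = 4 \<and> j = 6) \<or> (i = 5 \<and> j = 6)"
      by presburger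
    then show "p \<in> ?L \<longleftrightarrow> p \<in> ?R" by (simp add: p)
  qed
  then show ?thesis unfolding pair_prod_def by (simp add: Let_def mult.assoc)
qed

lemma bil_term_eq_0:
  assumes "j \<in> {1..6}" "fpoch q (x * b j) k = 0 \<or> qpoch_inf q (q / (x * b j)) = 0"
  shows "bil_term q b x k = 0"
proof -
  have "(\<Prod>j=1..6. fpoch q (x * b j) k * qpoch_inf q (q / (x * b j)) * qpoch_inf q (q ^ Suc k * x / b j)) = 0"
    by (rule prod_zero[OF _ bexI[OF _ assms(1)]]) (use assms(2) in auto)
  then show ?thesis unfolding bil_term_def by (simp only: mult_zero_right)
qed

context six_params
begin

text \<open>
  At \<open>x = b i\<close> the factor \<open>fpoch q 1\<close> occurs in all terms of negative index.
\<close>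

lemma bil_sum_at_param:
  assumes "i \<in> {1..6}"
  shows "bil_sum q b (b i) = (\<Sum>k. bil_term q b (b i) k)"
proof -
  have "fpoch q (1 / b i * b i) (Suc k) = 0" for k using b_nz[OF assms] by simp
  then have "bil_term q b (1 / b i) (Suc k) = 0" for k
    using assms by (intro bil_term_eq_0[of i]) auto
  then show ?thesis by (simp add: bil_sum_def)
qed

lemma theta_comb_at_param:
  assumes "i \<in> {1..6}"
  shows "theta_comb q b (b i) = (\<Prod>j=1..6. theta q (b i * b j))"
proof -
  have "theta q (b i / b i) = 0"
    using b_nz[OF assms] one_in_qpowers by (simp add: theta_eq_0_iff)
  then have "(\<Prod>j=1..6. theta q (b i / b j)) = 0"
    using assms by (intro prod_zero bexI[of _ i]) auto
  then show ?thesis by (simp add: theta_comb_def)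
qed

lemma theta_comb_at_param_eq_0:
  assumes "i \<in> {1..6}" "j \<in> {1..6}" "b i * b j \<in> qpowers q"
  shows "theta_comb q b (b i) = 0"
  unfolding theta_comb_at_param[OF assms(1)]
  using assms b_nz by (intro prod_zero bexI[of _ j]) (auto simp: theta_eq_0_iff)

text \<open>
  At \<open>x = b i\<close> the terms of negative index vanish as always, and now each remaining term contains the
  factor \<open>qpoch_inf q (q / (b i * b j))\<close>, which is zero. The theta combination vanishes there too. So the
  determinant is zero at \<open>x = b i\<close>, where \<open>odd_theta_basis m\<close> is not, and the constant in
  \<open>det_fun_eq_basis\<close> is zero.
\<close>

lemma det_fun_eq_0_if_pair:
  assumes "i \<in> {1..6}" "j \<in> {1..6}" "b i * b j = q ^ Suc n"
    and m: "m \<noteq> 0" "m\<^sup>2 \<notin> qpowers q" "odd_theta_basis m (b i) \<noteq> 0" and "x \<noteq> 0"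
  shows "det_fun q b x m = 0"
proof -
  have "qpoch_inf q (q / (b i * b j)) = 0"
    unfolding qinf_eq_0_iff using q_nz by (intro exI[of _ n]) (simp add: assms(3))
  then have "bil_term q b (b i) k = 0" for k
    using assms(2) by (intro bil_term_eq_0[of j]) auto
  then have "bil_sum q b (b i) = 0" by (simp add: bil_sum_at_param[OF assms(1)])
  moreover have "theta_comb q b (b i) = 0"
    using theta_comb_at_param_eq_0[OF assms(1,2)] qpowers_power by (simp only: assms(3))
  ultimately have "det_fun q b (b i) m = 0" by (simp add: det_fun_def)
  moreover obtain c where c: "\<And>x. x \<noteq> 0 \<Longrightarrow> det_fun q b x m = c * odd_theta_basis m x"
    using det_fun_eq_basis[OF m(1,2)] by blast
  ultimately have "c = 0" using m(3) b_nz[OF assms(1)] by auto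
  then show ?thesis using c[OF \<open>x \<noteq> 0\<close>] by simp
qed

text \<open>
  For \<open>b 1 * b 3 = 1\<close> the series at \<open>b 1\<close> reduces to its term of index 0, and the theta combination at \<open>b 1\<close>
  vanishes. Hence the determinant at \<open>x = b 1\<close> is the product of that term with the theta combination at \<open>m\<close>.
  The latter is evaluated by using \<open>det_fun_eq_basis\<close> in the second variable and comparing at \<open>m = b 4\<close>, where the
  theta combination is a single product of theta functions.
\<close>

lemma det_fun_at_terminating:
  assumes b13: "b 1 * b 3 = 1"
    and gen: "(b 1)\<^sup>2 \<notin> qpowers q" "(b 4)\<^sup>2 \<notin> qpowers q" "b 4 * b 1 \<notin> qpowers q" "b 4 / b 1 \<notin> qpowers q"
    and m: "m \<noteq> 0" "m\<^sup>2 \<notin> qpowers q" "b 1 * m \<notin> qpowers q" "m / b 1 \<notin> qpowers q"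
    and x: "x \<noteq> 0"
  shows "det_fun q b x m = qpoch_inf q q * pair_prod q b * theta q (m\<^sup>2) * odd_theta_basis m x"
proof -
  note One_nat_def [simp del]
  have nz: "b 1 \<noteq> 0" "b 2 \<noteq> 0" "b 3 \<noteq> 0" "b 4 \<noteq> 0" "b 5 \<noteq> 0" "b 6 \<noteq> 0" by (simp_all add: b_nz)
  have b3: "b 3 = 1 / b 1" using b13 nz by (simp add: field_simps)
  have b2456: "b 2 * b 4 * b 5 * b 6 = q"
  proof -
    have "(b 1 * b 3) * (b 2 * b 4 * b 5 * b 6) = q"
      using b_prod unfolding prod_1_6 by (simp only: mult_ac)
    then show ?thesis by (simp only: b13 mult_1)
  qed
  obtain c where c: "\<And>x. x \<noteq> 0 \<Longrightarrow> det_fun q b x m = c * odd_theta_basis m x"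
    using det_fun_eq_basis[OF m(1,2)] by blast
  obtain c1 where c1: "\<And>y. y \<noteq> 0 \<Longrightarrow> det_fun q b y (b 1) = c1 * odd_theta_basis (b 1) y"
    using det_fun_eq_basis[OF nz(1) gen(1)] by blast
  have c1': "det_fun q b (b 1) y = c1 * (theta q (y\<^sup>2) * theta q (y * b 1) * theta q (y / b 1))"
    if "y \<noteq> 0" for y
  proof -
    have "theta q (b 1 / y) = - theta q (y / b 1) / (y / b 1)"
      using theta_inverse[of "y / b 1"] that nz by simp
    then show ?thesis
      using det_fun_swap[OF nz(1) that, of q b] c1[OF that] that nz
      by (simp add: odd_theta_basis_def)
  qed
  have "fpoch q (b 1 * b 3) (Suc k) = 0" for k by (simp only: b13 fpoch_1_Suc)
  then have "bil_term q b (b 1) (Suc k) = 0" for k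
    by (intro bil_term_eq_0[of 3]) auto
  then have S: "bil_sum q b (b 1) = bil_term q b (b 1) 0"
    using bil_sum_at_param[of 1] bil_sum_head[of "b 1"] by simp
  have "theta_comb q b (b 1) = 0"
    by (rule theta_comb_at_param_eq_0[of 1 3]) (simp_all add: b13 one_in_qpowers)
  then have det1: "det_fun q b (b 1) y = bil_term q b (b 1) 0 * theta_comb q b y" for y
    by (simp add: det_fun_def S)
  define V where "V = qpoch_inf q q * pair_prod q b"
  define W where "W = qpoch_inf q (q / (b 1 * b 2)) * qpoch_inf q (q * b 1 / b 2)
     * (qpoch_inf q (q / (b 1 * b 4)) * qpoch_inf q (q * b 1 / b 4))
     * (qpoch_inf q (q / (b 1 * b 5)) * qpoch_inf q (q * b 1 / b 5))
     * (qpoch_inf q (q / (b 1 * b 6)) * qpoch_inf q (q * b 1 / b 6))"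
  have t0: "bil_term q b (b 1) 0 = theta q ((b 1)\<^sup>2) * (qpoch_inf q q)\<^sup>2 * W"
  proof -
    have "qpoch_inf q ((b 1)\<^sup>2) = (1 - (b 1)\<^sup>2) * qpoch_inf q (q * (b 1)\<^sup>2)"
      using qinf_Suc[of "(b 1)\<^sup>2"] by (simp add: mult.commute)
    then show ?thesis
      unfolding bil_term_def prod_1_6 W_def theta_def using nz
      by (simp add: b3 power2_eq_square mult_ac)
  qed
  have thetas: "theta q (b 4 * b 2) = qpoch_inf q (q / (b 2 * b 4)) * qpoch_inf q (q / (b 5 * b 6))"
    "theta q (b 4 * b 5) = qpoch_inf q (q / (b 4 * b 5)) * qpoch_inf q (q / (b 2 * b 6))"
    "theta q (b 4 * b 6) = qpoch_inf q (q / (b 4 * b 6)) * qpoch_inf q (q / (b 2 * b 5))"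
  proof -
    have "b 4 * b 2 = q / (b 5 * b 6)" "b 4 * b 5 = q / (b 2 * b 6)" "b 4 * b 6 = q / (b 2 * b 5)"
      using nz b2456 by (simp_all add: field_simps)
    then show "theta q (b 4 * b 2) = qpoch_inf q (q / (b 2 * b 4)) * qpoch_inf q (q / (b 5 * b 6))"
      "theta q (b 4 * b 5) = qpoch_inf q (q / (b 4 * b 5)) * qpoch_inf q (q / (b 2 * b 6))"
      "theta q (b 4 * b 6) = qpoch_inf q (q / (b 4 * b 6)) * qpoch_inf q (q / (b 2 * b 5))"
      by (simp_all only: theta_def mult.commute)
  qed
  have VW: "V = (qpoch_inf q q)\<^sup>2 * W * (theta q (b 4 * b 2) * theta q (b 4 * b 5) * theta q (b 4 * b 6))"
    unfolding V_def W_def pair_prod_eq Let_def thetas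
    by (simp add: b3 nz power2_eq_square mult_ac)
  have tc: "theta_comb q b (b 4) = theta q (b 4 * b 1) * theta q (b 4 * b 2) * theta q (b 4 / b 1)
        * theta q ((b 4)\<^sup>2) * theta q (b 4 * b 5) * theta q (b 4 * b 6)"
    using theta_comb_at_param[of 4] unfolding prod_1_6 by (simp add: b3 power2_eq_square)
  have "c1 * (theta q ((b 4)\<^sup>2) * theta q (b 4 * b 1) * theta q (b 4 / b 1))
      = bil_term q b (b 1) 0 * (theta q (b 4 * b 1) * theta q (b 4 * b 2) * theta q (b 4 / b 1)
        * theta q ((b 4)\<^sup>2) * theta q (b 4 * b 5) * theta q (b 4 * b 6))"
    using c1'[OF nz(4)] det1[of "b 4"] unfolding tc by (simp only:)
  also have "\<dots> = theta q ((b 1)\<^sup>2) * V * (theta q ((b 4)\<^sup>2) * theta q (b 4 * b 1) * theta q (b 4 / b 1))"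
    unfolding VW t0 by (simp only: mult_ac)
  finally have c1V: "c1 = theta q ((b 1)\<^sup>2) * V"
    using gen nz by (simp add: theta_eq_0_iff)
  have "c * odd_theta_basis m (b 1) = c1 * (theta q (m\<^sup>2) * theta q (m * b 1) * theta q (m / b 1))"
    using c[OF nz(1)] c1'[OF m(1)] by simp
  then have "c * (theta q ((b 1)\<^sup>2) * theta q (b 1 * m) * theta q (m / b 1))
     = V * theta q (m\<^sup>2) * (theta q ((b 1)\<^sup>2) * theta q (b 1 * m) * theta q (m / b 1))"
    unfolding c1V odd_theta_basis_def by (simp only: mult_ac)
  then have "c = V * theta q (m\<^sup>2)"
    using gen m nz by (simp add: theta_eq_0_iff)
  then show ?thesis using c[OF x] by (simp add: V_def)
qed

end

section \<open>Growth along a geometric family of parameters\<close>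

lemma norm_mult_le:
  fixes a c :: complex
  shows "norm a \<le> A \<Longrightarrow> norm c \<le> C \<Longrightarrow> norm (a * c) \<le> A * C"
  unfolding norm_mult by (intro mult_mono) (auto intro: order_trans[OF norm_ge_zero])

context q_base
begin

text \<open>
  The part of a shifted term that is not bounded by the product estimates: both finite products have large
  arguments, and the prefactor compensates their growth.
\<close>

definition cross_factor :: "nat \<Rightarrow> nat \<Rightarrow> complex \<Rightarrow> complex \<Rightarrow> complex" where
  "cross_factor k N u v = q ^ (k * N) * fpoch q (u / q ^ k) N * fpoch q (v / q ^ N) k"

lemma cross_factor_commute: "cross_factor k N u v = cross_factor N k v u"
  by (simp add: cross_factor_def mult_ac)

lemma gauss_sum_atMost: "\<Sum>{..n} + \<Sum>{..n} = n * n + (n::nat)"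
  by (induction n) auto

text \<open>
  For \<open>N \<le> k\<close> both products contain \<open>N\<close> large factors. Reflecting them produces a power of \<open>q\<close> that cancels
  \<open>q^(k * N)\<close> up to \<open>(u * v / q)^N\<close>.
\<close>

lemma norm_cross_factor_le_aux:
  assumes "u \<noteq> 0" "v \<noteq> 0" "N \<le> k"
    and R: "norm (q / u) \<le> R" "norm v \<le> R" "norm (q / v) \<le> R"
  shows "norm (cross_factor k N u v) \<le> (norm (u * v) / norm q) ^ N * exp (R / (1 - norm q)) ^ 3"
proof -
  obtain d where k: "k = N + d" using \<open>N \<le> k\<close> le_iff_add by blast
  let ?E = "exp (R / (1 - norm q))"
  have v: "fpoch q (v / q ^ N) k = (- v) ^ N / q ^ (\<Sum>{..N}) * fpoch q (q / v) N * fpoch q v d"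
    unfolding k fpoch_split fpoch_reflect[OF \<open>v \<noteq> 0\<close>] using q_nz by simp
  have "u / q ^ k = (u / q ^ d) / q ^ N" by (simp add: k power_add)
  then have u: "fpoch q (u / q ^ k) N = (- (u / q ^ d)) ^ N / q ^ (\<Sum>{..N}) * fpoch q (q ^ d * (q / u)) N"
    using fpoch_reflect[of "u / q ^ d" N] assms(1) q_nz by (simp add: mult_ac)
  have "q ^ (k * N) * ((- (u / q ^ d)) ^ N / q ^ (\<Sum>{..N})) * ((- v) ^ N / q ^ (\<Sum>{..N})) = (u * v / q) ^ N"
  proof -
    have "q ^ (\<Sum>{..N}) * q ^ (\<Sum>{..N}) = q ^ (N * N) * q ^ N"
      by (simp add: gauss_sum_atMost flip: power_add)
    moreover have "q ^ (k * N) = q ^ (N * N) * (q ^ d) ^ N"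
      by (simp add: k power_mult distrib_right power_add)
    moreover have "(- (u / q ^ d)) ^ N * (- v) ^ N = (u * v) ^ N / (q ^ d) ^ N"
      by (simp add: power_divide flip: power_mult_distrib)
    ultimately show ?thesis using q_nz by (simp add: power_divide field_simps)
  qed
  moreover have "cross_factor k N u v = q ^ (k * N) * ((- (u / q ^ d)) ^ N / q ^ (\<Sum>{..N})) * ((- v) ^ N / q ^ (\<Sum>{..N})) *
      (fpoch q (q ^ d * (q / u)) N * fpoch q (q / v) N * fpoch q v d)"
    unfolding cross_factor_def u v by (simp only: mult_ac)
  ultimately have "cross_factor k N u v = (u * v / q) ^ N * (fpoch q (q ^ d * (q / u)) N * fpoch q (q / v) N * fpoch q v d)"
    by (simp only:)
  moreover have "norm (fpoch q (q ^ d * (q / u)) N * fpoch q (q / v) N * fpoch q v d) \<le> ?E * ?E * ?E"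
  proof -
    have "norm q ^ d * norm (q / u) \<le> 1 * R"
      using R q_lt by (intro mult_mono power_le_one) auto
    then have "norm (q ^ d * (q / u)) \<le> R" by (simp only: norm_mult norm_power mult_1)
    then show ?thesis by (intro norm_mult_le norm_fpoch_le' R)
  qed
  ultimately show ?thesis
    by (simp add: norm_mult norm_power norm_divide power3_eq_cube mult_left_mono)
qed

text \<open>
  The symmetry of \<open>cross_factor\<close> reduces the case \<open>k < N\<close> to the preceding lemma. The bound is geometric in \<open>k\<close>
  with a ratio that does not depend on \<open>N\<close>; the assumption on \<open>u * v\<close> will be met because the product of the two
  moving parameters has modulus less than 1.
\<close>

lemma norm_cross_factor_le:
  assumes "u \<noteq> 0" "v \<noteq> 0" "norm (u * v) \<le> \<rho>" "norm q \<le> \<rho>"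
    and R: "norm u \<le> R" "norm (q / u) \<le> R" "norm v \<le> R" "norm (q / v) \<le> R"
  shows "norm q ^ k * norm (cross_factor k N u v) \<le> \<rho> ^ k * exp (R / (1 - norm q)) ^ 3"
proof -
  let ?E = "exp (R / (1 - norm q)) ^ 3"
  define n where "n = min k N"
  have "norm (cross_factor k N u v) \<le> (norm (u * v) / norm q) ^ n * ?E"
  proof (cases "N \<le> k")
    case True
    then show ?thesis using norm_cross_factor_le_aux[OF assms(1,2) True R(2,3,4)] by (simp add: n_def)
  next
    case False
    then show ?thesis using norm_cross_factor_le_aux[OF assms(2,1) _ R(4,1,2), of k N]
      by (simp add: n_def cross_factor_commute[of k] mult.commute[of v])
  qed
  then have "norm q ^ k * norm (cross_factor k N u v) \<le> norm q ^ k * ((norm (u * v) / norm q) ^ n * ?E)"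
    by (intro mult_left_mono) auto
  also have "\<dots> = norm (u * v) ^ n * norm q ^ (k - n) * ?E"
  proof -
    have "norm q ^ k = norm q ^ n * norm q ^ (k - n)" by (simp add: n_def flip: power_add)
    then show ?thesis using q_nz by (simp add: power_divide)
  qed
  also have "\<dots> \<le> \<rho> ^ n * \<rho> ^ (k - n) * ?E"
    using assms(3,4) order_trans[OF norm_ge_zero assms(4)]
    by (intro mult_right_mono mult_mono power_mono zero_le_power) auto
  also have "\<rho> ^ n * \<rho> ^ (k - n) = \<rho> ^ k" by (simp add: n_def flip: power_add)
  finally show ?thesis .
qed

lemma qinf_divide_power:
  assumes "y \<noteq> 0"
  shows "qpoch_inf q (y / q ^ N) = (- y) ^ N / q ^ (\<Sum>{..N}) * fpoch q (q / y) N * qpoch_inf q y"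
  using qinf_split[of "y / q ^ N" N] fpoch_reflect[OF assms, of N] q_nz by simp

text \<open>
  The contribution of the first two parameters \<open>s * q^N\<close> and \<open>t / q^N\<close> to a term, as an explicit monomial times
  \<open>cross_factor\<close> times factors that are bounded uniformly in \<open>k\<close> and \<open>N\<close>.
\<close>

lemma shifted_factors_eq:
  fixes s t x :: complex
  assumes nz: "s \<noteq> 0" "t \<noteq> 0" "x \<noteq> 0"
  shows "(fpoch q (x * (s * q ^ N)) k * qpoch_inf q (q / (x * (s * q ^ N))) * qpoch_inf q (q ^ Suc k * x / (s * q ^ N))) *
    (fpoch q (x * (t / q ^ N)) k * qpoch_inf q (q / (x * (t / q ^ N))) * qpoch_inf q (q ^ Suc k * x / (t / q ^ N)))
    = q ^ N / (s ^ (2 * N) * q ^ (N * N)) * cross_factor k N (s / x) (x * t) *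
      (fpoch q (q ^ N * (x * s)) k * fpoch q (x * s) N * qpoch_inf q (q / (x * s)) * qpoch_inf q (q ^ Suc k * (x / s))
       * qpoch_inf q (q ^ Suc N * (1 / (x * t))) * qpoch_inf q (q ^ (Suc k + N) * (x / t)))"
proof -
  define y where "y = q / (x * s)"
  define w where "w = q ^ Suc k * (x / s)"
  have y: "y \<noteq> 0" and w: "w \<noteq> 0" using nz q_nz by (auto simp: y_def w_def)
  have 1: "qpoch_inf q (q / (x * (s * q ^ N))) = (- y) ^ N / q ^ (\<Sum>{..N}) * fpoch q (x * s) N * qpoch_inf q y"
    using qinf_divide_power[OF y, of N] nz q_nz by (simp add: y_def field_simps)
  have qw: "q / w = s / x / q ^ k" using nz q_nz by (simp add: w_def field_simps)
  have "q ^ Suc k * x / (s * q ^ N) = w / q ^ N" by (simp add: w_def)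
  then have 2: "qpoch_inf q (q ^ Suc k * x / (s * q ^ N)) = (- w) ^ N / q ^ (\<Sum>{..N}) * fpoch q (s / x / q ^ k) N * qpoch_inf q w"
    using qinf_divide_power[OF w, of N] by (simp only: qw)
  have 3: "qpoch_inf q (q / (x * (t / q ^ N))) = qpoch_inf q (q ^ Suc N * (1 / (x * t)))"
    "qpoch_inf q (q ^ Suc k * x / (t / q ^ N)) = qpoch_inf q (q ^ (Suc k + N) * (x / t))"
    by (simp_all add: power_add mult_ac)
  have 4: "fpoch q (x * (s * q ^ N)) k = fpoch q (q ^ N * (x * s)) k"
    "fpoch q (x * (t / q ^ N)) k = fpoch q (x * t / q ^ N) k" by (simp_all add: mult_ac)
  have 5: "(- y) ^ N / q ^ (\<Sum>{..N}) * ((- w) ^ N / q ^ (\<Sum>{..N})) = q ^ N / (s ^ (2 * N) * q ^ (N * N)) * q ^ (k * N)"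
  proof -
    have "q ^ (\<Sum>{..N}) * q ^ (\<Sum>{..N}) = q ^ (N * N) * q ^ N"
      by (simp add: gauss_sum_atMost flip: power_add)
    moreover have "(- y) ^ N * (- w) ^ N = (q ^ k * q * q / (s * s)) ^ N"
      using nz by (simp add: y_def w_def field_simps flip: power_mult_distrib)
    moreover have "(q ^ k * q * q / (s * s)) ^ N = q ^ (k * N) * (q ^ N * q ^ N) / s ^ (2 * N)"
      by (simp add: power_divide power_mult_distrib power_mult power2_eq_square)
    moreover have "(- y) ^ N / q ^ (\<Sum>{..N}) * ((- w) ^ N / q ^ (\<Sum>{..N}))
        = ((- y) ^ N * (- w) ^ N) / (q ^ (\<Sum>{..N}) * q ^ (\<Sum>{..N}))" by simp
    ultimately have "(- y) ^ N / q ^ (\<Sum>{..N}) * ((- w) ^ N / q ^ (\<Sum>{..N}))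
        = q ^ (k * N) * (q ^ N * q ^ N) / s ^ (2 * N) / (q ^ (N * N) * q ^ N)" by (simp only:)
    then show ?thesis using q_nz by simp
  qed
  have "(fpoch q (x * (s * q ^ N)) k * qpoch_inf q (q / (x * (s * q ^ N))) * qpoch_inf q (q ^ Suc k * x / (s * q ^ N))) *
    (fpoch q (x * (t / q ^ N)) k * qpoch_inf q (q / (x * (t / q ^ N))) * qpoch_inf q (q ^ Suc k * x / (t / q ^ N)))
    = ((- y) ^ N / q ^ (\<Sum>{..N}) * ((- w) ^ N / q ^ (\<Sum>{..N}))) *
      (fpoch q (s / x / q ^ k) N * fpoch q (x * t / q ^ N) k) *
      (fpoch q (q ^ N * (x * s)) k * fpoch q (x * s) N * qpoch_inf q y * qpoch_inf q w
       * qpoch_inf q (q ^ Suc N * (1 / (x * t))) * qpoch_inf q (q ^ (Suc k + N) * (x / t)))"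
    unfolding 1 2 unfolding 3 4 by (simp only: mult_ac)
  then show ?thesis unfolding 5 unfolding cross_factor_def y_def w_def by (simp only: mult_ac)
qed

lemma norm_bil_term_shift_le:
  assumes R: "norm x \<le> R" "norm (1 / x) \<le> R" "norm s \<le> R" "norm (1 / s) \<le> R" "norm t \<le> R" "norm (1 / t) \<le> R"
    "\<And>j. j \<in> {3..6} \<Longrightarrow> norm (b j) \<le> R" "\<And>j. j \<in> {3..6} \<Longrightarrow> norm (1 / b j) \<le> R"
    and nz: "s \<noteq> 0" "t \<noteq> 0" "x \<noteq> 0" and \<rho>: "norm (s * t) \<le> \<rho>" "norm q \<le> \<rho>"
  shows "norm (bil_term q (b(1 := s * q ^ N, 2 := t / q ^ N)) x k) \<le>
    (norm q ^ N / (norm s ^ (2 * N) * norm q ^ (N * N))) * ((1 + R\<^sup>2) * exp (R\<^sup>2 / (1 - norm q)) ^ 21) * \<rho> ^ k"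
proof -
  let ?E = "exp (R\<^sup>2 / (1 - norm q))"
  let ?F = "\<lambda>c. fpoch q (x * c) k * qpoch_inf q (q / (x * c)) * qpoch_inf q (q ^ Suc k * x / c)"
  let ?S = "norm q ^ N / (norm s ^ (2 * N) * norm q ^ (N * N))"
  define C where "C = cross_factor k N (s / x) (x * t)"
  define D where "D = fpoch q (q ^ N * (x * s)) k * fpoch q (x * s) N * qpoch_inf q (q / (x * s)) * qpoch_inf q (q ^ Suc k * (x / s))
       * qpoch_inf q (q ^ Suc N * (1 / (x * t))) * qpoch_inf q (q ^ (Suc k + N) * (x / t))"
  have R0: "R \<ge> 0" using R(1) norm_ge_zero order_trans by blast
  have sq: "norm (a * c) \<le> R\<^sup>2" if "norm a \<le> R" "norm c \<le> R" for a c :: complex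
    unfolding norm_mult power2_eq_square using that R0 by (intro mult_mono) auto
  have sqq: "norm (q ^ n * (a * c)) \<le> R\<^sup>2" if "norm a \<le> R" "norm c \<le> R" for a c :: complex and n
  proof -
    have "norm q ^ n * norm (a * c) \<le> 1 * R\<^sup>2"
      using sq[OF that] q_lt by (intro mult_mono power_le_one) auto
    then show ?thesis by (simp add: norm_mult norm_power)
  qed
  have b1: "norm (x * s) \<le> R\<^sup>2" "norm (q ^ N * (x * s)) \<le> R\<^sup>2" "norm (x * t) \<le> R\<^sup>2"
    "norm (s / x) \<le> R\<^sup>2" "norm (q / (s / x)) \<le> R\<^sup>2" "norm (q / (x * s)) \<le> R\<^sup>2" "norm (q / (x * t)) \<le> R\<^sup>2"
    "norm (q ^ Suc k * (x / s)) \<le> R\<^sup>2" "norm (q ^ Suc N * (1 / (x * t))) \<le> R\<^sup>2" "norm (q ^ (Suc k + N) * (x / t)) \<le> R\<^sup>2"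
    using sq[OF R(1,3)] sqq[OF R(1,3), of N] sq[OF R(1,5)] sq[OF R(3,2)] sqq[OF R(1,4), of 1]
      sqq[OF R(2,4), of 1] sqq[OF R(2,6), of 1] sqq[OF R(1,4), of "Suc k"] sqq[OF R(2,6), of "Suc N"]
      sqq[OF R(1,6), of "Suc k + N"] nz
    by simp_all
  have D: "norm D \<le> ?E ^ 6"
  proof -
    have "norm D \<le> ?E * ?E * ?E * ?E * ?E * ?E"
      unfolding D_def by (intro norm_mult_le norm_fpoch_le' norm_qinf_le' b1)
    then show ?thesis by (simp add: power_numeral_reduce)
  qed
  have C: "norm q ^ k * norm C \<le> \<rho> ^ k * ?E ^ 3"
    unfolding C_def
  proof (rule norm_cross_factor_le)
    show "norm (s / x * (x * t)) \<le> \<rho>" using \<rho>(1) nz by simp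
  qed (use nz \<rho>(2) b1 in simp_all)
  have B: "norm (?F (b 3) * ?F (b 4) * ?F (b 5) * ?F (b 6)) \<le> ?E ^ 3 * ?E ^ 3 * ?E ^ 3 * ?E ^ 3"
    by (intro norm_mult_le[of "?F (b 3) * ?F (b 4) * ?F (b 5)"] norm_mult_le[of "?F (b 3) * ?F (b 4)"]
        norm_mult_le[of "?F (b 3)"] norm_bil_factor_le R) auto
  have eq: "bil_term q (b(1 := s * q ^ N, 2 := t / q ^ N)) x k =
     q ^ k * (1 - x\<^sup>2 * q ^ (2 * k)) * (q ^ N / (s ^ (2 * N) * q ^ (N * N)) * C * D *
      (?F (b 3) * ?F (b 4) * ?F (b 5) * ?F (b 6)))"
    unfolding bil_term_def prod_1_6 C_def D_def
    unfolding shifted_factors_eq[OF nz, symmetric]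
    by (simp add: mult.assoc)
  have nn: "norm (q ^ k * (1 - x\<^sup>2 * q ^ (2 * k)) * (q ^ N / (s ^ (2 * N) * q ^ (N * N)) * C * D * X))
     = ?S * norm (1 - x\<^sup>2 * q ^ (2 * k)) * (norm q ^ k * norm C) * norm D * norm X" for X
    by (simp add: norm_mult norm_divide norm_power mult_ac)
  have "norm (bil_term q (b(1 := s * q ^ N, 2 := t / q ^ N)) x k)
     \<le> ?S * (1 + R\<^sup>2) * (\<rho> ^ k * ?E ^ 3) * ?E ^ 6 * (?E ^ 3 * ?E ^ 3 * ?E ^ 3 * ?E ^ 3)"
    unfolding eq nn using norm_well_poised_factor_le[OF R(1)] order_trans[OF norm_ge_zero \<rho>(2)]
    by (intro mult_mono C D B order_refl mult_nonneg_nonneg) auto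
  also have "\<dots> = ?S * ((1 + R\<^sup>2) * (?E ^ 3 * ?E ^ 6 * (?E ^ 3 * ?E ^ 3 * ?E ^ 3 * ?E ^ 3))) * \<rho> ^ k"
    by (simp only: mult_ac)
  also have "?E ^ 3 * ?E ^ 6 * (?E ^ 3 * ?E ^ 3 * ?E ^ 3 * ?E ^ 3) = ?E ^ 21"
    unfolding power_add[symmetric] by simp
  finally show ?thesis .
qed

lemma norm_bil_sum_shift_le:
  assumes p: "p \<noteq> 0" "norm p < 1" and b: "\<And>j. j \<in> {3..6} \<Longrightarrow> b j \<noteq> 0" and x: "x \<noteq> 0" and "r > 0"
  shows "\<exists>K\<ge>0. \<forall>N s. norm s = r \<longrightarrow> norm (bil_sum q (b(1 := s * q ^ N, 2 := p / s / q ^ N)) x)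
     \<le> K * (norm q ^ N / (r ^ (2 * N) * norm q ^ (N * N)))"
proof -
  define \<rho> where "\<rho> = max (norm p) (norm q)"
  have "norm q \<le> \<rho>" by (simp add: \<rho>_def)
  then have \<rho>: "0 \<le> \<rho>" "\<rho> < 1" using p(2) q_lt order_trans[OF norm_ge_zero] by (blast, simp add: \<rho>_def)
  \<comment> \<open>The variable is used both as \<open>x\<close> and as \<open>1 / x\<close>, so \<open>R\<close> dominates every quantity together with its reciprocal.\<close>
  define R where "R = norm x + norm (1 / x) + r + 1 / r + norm p / r + r / norm p
      + (\<Sum>j=3..6. norm (b j)) + (\<Sum>j=3..6. norm (1 / b j))"
  have pos: "norm x \<ge> 0" "norm (1 / x) \<ge> 0" "1 / r \<ge> 0" "norm p / r \<ge> 0" "r / norm p \<ge> 0"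
    "(\<Sum>j::nat=3..6. norm (b j)) \<ge> 0" "(\<Sum>j::nat=3..6. norm (1 / b j)) \<ge> 0"
    using \<open>r > 0\<close> by (auto intro!: sum_nonneg)
  have mem: "norm (b j) \<le> (\<Sum>j=3..6. norm (b j))" "norm (1 / b j) \<le> (\<Sum>j=3..6. norm (1 / b j))"
    if "j \<in> {3..6}" for j
    using that by (intro member_le_sum; simp)+
  have R: "norm x \<le> R" "norm (1 / x) \<le> R" "r \<le> R" "1 / r \<le> R" "norm p / r \<le> R" "r / norm p \<le> R"
    "\<And>j. j \<in> {3..6} \<Longrightarrow> norm (b j) \<le> R" "\<And>j. j \<in> {3..6} \<Longrightarrow> norm (1 / b j) \<le> R"
    unfolding R_def using pos mem \<open>r > 0\<close> by (smt (verit))+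
  define M where "M = (1 + R\<^sup>2) * exp (R\<^sup>2 / (1 - norm q)) ^ 21"
  have "M \<ge> 0" by (simp add: M_def)
  define K where "K = (1 + (norm x)\<^sup>2) * (M / (1 - \<rho>))"
  have K: "norm (bil_sum q (b(1 := s * q ^ N, 2 := p / s / q ^ N)) x)
     \<le> K * (norm q ^ N / (r ^ (2 * N) * norm q ^ (N * N)))" if s: "norm s = r" for N s
  proof -
    define S where "S = norm q ^ N / (r ^ (2 * N) * norm q ^ (N * N))"
    have S0: "S \<ge> 0" using \<open>r > 0\<close> by (simp add: S_def)
    have s0: "s \<noteq> 0" using s \<open>r > 0\<close> by auto
    have st: "s * (p / s) = p" using s0 by simp
    let ?b = "b(1 := s * q ^ N, 2 := p / s / q ^ N)"
    have bd: "norm (bil_term q ?b y k) \<le> S * M * \<rho> ^ k" if "y = x \<or> y = 1 / x" for y k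
      unfolding S_def M_def s[symmetric]
      by (rule norm_bil_term_shift_le)
        (use R s s0 p x that st in \<open>auto simp: norm_divide \<rho>_def\<close>)
    have sm: "summable (\<lambda>k. S * M * \<rho> ^ k)" using \<rho> by (intro summable_mult summable_geometric) auto
    have tot: "(\<Sum>k. S * M * \<rho> ^ k) = S * (M / (1 - \<rho>))"
      using \<rho> by (simp add: suminf_mult summable_geometric suminf_geometric)
    have 1: "norm (\<Sum>k. bil_term q ?b x k) \<le> S * (M / (1 - \<rho>))"
      unfolding tot[symmetric] by (rule norm_suminf_le[OF _ sm]) (use bd in simp)
    have "norm (bil_term q ?b (1 / x) (Suc k)) \<le> S * M * \<rho> ^ k" for k
    proof -
      have "norm (bil_term q ?b (1 / x) (Suc k)) \<le> S * M * \<rho> ^ Suc k" using bd by blast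
      also have "\<rho> ^ Suc k \<le> \<rho> ^ k" using \<rho> by (simp add: mult_left_le_one_le)
      finally show ?thesis using S0 \<open>M \<ge> 0\<close> by (simp add: mult_left_mono)
    qed
    then have 2: "norm (\<Sum>k. bil_term q ?b (1 / x) (Suc k)) \<le> S * (M / (1 - \<rho>))"
      unfolding tot[symmetric] by (rule norm_suminf_le[OF _ sm])
    have "norm (bil_sum q ?b x) \<le> norm (\<Sum>k. bil_term q ?b x k) + norm (x\<^sup>2 * (\<Sum>k. bil_term q ?b (1 / x) (Suc k)))"
      unfolding bil_sum_def by (rule norm_triangle_ineq4)
    also have "\<dots> \<le> S * (M / (1 - \<rho>)) + (norm x)\<^sup>2 * (S * (M / (1 - \<rho>)))"
      unfolding norm_mult norm_power by (rule add_mono[OF 1 mult_left_mono[OF 2]]) simp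
    also have "\<dots> = K * S" by (simp add: K_def algebra_simps)
    finally show ?thesis by (simp add: S_def)
  qed
  have "K \<ge> 0" unfolding K_def using \<open>M \<ge> 0\<close> \<rho> by (intro mult_nonneg_nonneg) auto
  then show ?thesis using K by blast
qed

lemma theta_shift_pair:
  assumes "y \<noteq> 0" "z \<noteq> 0"
  shows "theta q (y * q ^ N) * theta q (z / q ^ N) = (z / y) ^ N / q ^ (N * N) * (theta q y * theta q z)"
proof (induction N)
  case (Suc N)
  have 1: "theta q (y * q ^ Suc N) = - theta q (y * q ^ N) / (y * q ^ N)"
    using theta_mult_q[of "y * q ^ N"] assms q_nz by (simp add: mult_ac)
  have 2: "theta q (z / q ^ Suc N) = - (z / q ^ N / q) * theta q (z / q ^ N)"
    using theta_divide_q[of "z / q ^ N"] assms q_nz by (simp add: mult_ac)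
  have "theta q (y * q ^ Suc N) * theta q (z / q ^ Suc N)
     = z / y / (q ^ N * q ^ N * q) * (theta q (y * q ^ N) * theta q (z / q ^ N))"
    unfolding 1 2 using assms q_nz by (simp add: field_simps)
  also have "\<dots> = (z / y) ^ Suc N / q ^ (Suc N * Suc N) * (theta q y * theta q z)"
    unfolding Suc using assms q_nz by (simp add: power_add field_simps)
  finally show ?case .
qed simp

text \<open>
  Both products in the theta combination acquire the same factor, so the growth of the combination is known
  exactly.
\<close>

lemma theta_comb_shift:
  assumes nz: "s \<noteq> 0" "t \<noteq> 0" "m \<noteq> 0"
  shows "theta_comb q (b(1 := s * q ^ N, 2 := t / q ^ N)) m = (t / s) ^ N / q ^ (N * N) * theta_comb q (b(1 := s, 2 := t)) m"
proof -
  have 1: "theta q (m * (s * q ^ N)) * theta q (m * (t / q ^ N)) = (t / s) ^ N / q ^ (N * N) * (theta q (m * s) * theta q (m * t))"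
    using theta_shift_pair[of "m * s" "m * t" N] nz by (simp add: mult.assoc)
  have "m / (t / q ^ N) = m / t * q ^ N" "m / (s * q ^ N) = m / s / q ^ N" by simp_all
  then have 2: "theta q (m / (s * q ^ N)) * theta q (m / (t / q ^ N)) = (t / s) ^ N / q ^ (N * N) * (theta q (m / s) * theta q (m / t))"
    using theta_shift_pair[of "m / t" "m / s" N] nz by (simp add: mult.commute)
  have upd: "(b(1 := c, 2 := d)) 1 = c" "(b(1 := c, 2 := d)) 2 = d" "(b(1 := c, 2 := d)) 3 = b 3"
    "(b(1 := c, 2 := d)) 4 = b 4" "(b(1 := c, 2 := d)) 5 = b 5" "(b(1 := c, 2 := d)) 6 = b 6" for c d
    by simp_all
  show ?thesis unfolding theta_comb_def prod_1_6 upd 1 2 right_diff_distrib by (simp only: mult_ac)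
qed

end

section \<open>Comparison of the determinant with the product along the family\<close>

lemma pair_family_upd:
  fixes c d :: complex and b :: "nat \<Rightarrow> complex"
  shows "(b(1 := c, 2 := d)) 1 = c" "(b(1 := c, 2 := d)) 2 = d" "(b(1 := c, 2 := d)) 3 = b 3"
    "(b(1 := c, 2 := d)) 4 = b 4" "(b(1 := c, 2 := d)) 5 = b 5" "(b(1 := c, 2 := d)) 6 = b 6"
  by simp_all

lemma prod_3_6: "(\<Prod>j=3..6. f j) = f 3 * f 4 * f 5 * f (6::nat)"
  by (simp add: numeral_eq_Suc prod.atLeast_Suc_atMost mult.assoc)

text \<open>
  The factors of the product over pairs that vary with \<open>s\<close> when \<open>b 1 = s\<close> and \<open>b 2 = p / s\<close>; the product of the
  others is \<open>pair_const\<close>.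
\<close>

definition pair_fun :: "complex \<Rightarrow> complex \<Rightarrow> (nat \<Rightarrow> complex) \<Rightarrow> complex \<Rightarrow> complex" where
  "pair_fun q p b s = (\<Prod>j=3..6. qpoch_inf q (q / (s * b j))) * (\<Prod>j=3..6. qpoch_inf q (q * s / (p * b j)))"

definition pair_const :: "complex \<Rightarrow> complex \<Rightarrow> (nat \<Rightarrow> complex) \<Rightarrow> complex" where
  "pair_const q p b = (let e = (\<lambda>i j. qpoch_inf q (q / (b i * b j))) in
      qpoch_inf q (q / p) * e 3 4 * e 3 5 * e 3 6 * e 4 5 * e 4 6 * e 5 6)"

lemma pair_prod_family:
  assumes "s \<noteq> 0"
  shows "pair_prod q (b(1 := s, 2 := p / s)) = pair_const q p b * pair_fun q p b s"
  unfolding pair_prod_eq pair_const_def pair_fun_def Let_def prod_3_6 pair_family_upd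
  using assms by (simp add: mult_ac)

locale pair_family = q_base +
  fixes p :: complex and b :: "nat \<Rightarrow> complex"
  assumes p_nz: "p \<noteq> 0" and p_lt: "norm p < 1"
    and c_nz: "\<And>j. j \<in> {3..6} \<Longrightarrow> b j \<noteq> 0" and p_prod: "p * (\<Prod>j=3..6. b j) = q"
begin

abbreviation fam :: "complex \<Rightarrow> nat \<Rightarrow> complex" where
  "fam s \<equiv> b(1 := s, 2 := p / s)"

lemma six_params_fam:
  assumes "s \<noteq> 0"
  shows "six_params q (fam s)"
proof
  fix j :: nat assume "j \<in> {1..6}"
  then consider "j = 1" | "j = 2" | "j \<in> {3..6}" by fastforce
  then show "fam s j \<noteq> 0" using assms p_nz c_nz by cases auto
next
  show "(\<Prod>j=1..6. fam s j) = q"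
    using assms p_prod unfolding prod_1_6 prod_3_6 pair_family_upd by (simp add: mult.assoc)
qed

lemma holomorphic_pair_fun: "pair_fun q p b holomorphic_on - {0}"
  unfolding pair_fun_def using p_nz c_nz by (intro holomorphic_intros) auto

lemma holomorphic_det_fam:
  assumes "x \<noteq> 0" "m \<noteq> 0"
  shows "(\<lambda>s. det_fun q (fam s) x m) holomorphic_on - {0}"
proof (rule holomorphic_det_fun)
  fix j :: nat assume j: "j \<in> {1..6}"
  then consider "j = 1" | "j = 2" | "j \<in> {3..6}" by fastforce
  then show "(\<lambda>s. fam s j) holomorphic_on - {0}"
    by cases (auto intro!: holomorphic_intros)
  show "fam s j \<noteq> 0" if "s \<in> - {0}" for s
    using six_params.b_nz[OF six_params_fam j] that by simp
qed (use assms in \<open>auto intro!: holomorphic_intros\<close>)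

text \<open>
  Up to constants this bounds the determinant from above and \<open>pair_fun\<close> from below on the circle of radius
  \<open>r * norm q ^ N\<close>. That the same expression serves for both makes the quotient bounded.
\<close>

definition scale :: "real \<Rightarrow> nat \<Rightarrow> real" where
  "scale r N = (norm p * norm q / r ^ 4) ^ N / norm q ^ (2 * (N * N))"

text \<open>
  The growing factors are reflected, so that only initial segments and tails of fixed infinite products remain.
  Each of these is bounded below by an infinite product without zeros on the circle, divided by the upper bound
  for the complementary part.
\<close>

lemma pair_fun_lower_bound:
  assumes "r > 0"
    and avoid1: "\<And>j n. j \<in> {3..6} \<Longrightarrow> r * norm (b j) \<noteq> norm q powi n"
    and avoid2: "\<And>j n. j \<in> {3..6} \<Longrightarrow> r * (1 / norm (p * b j)) \<noteq> norm q powi n"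
  shows "\<exists>d>0. \<forall>N s. norm s = r \<longrightarrow> d * scale r N \<le> norm (pair_fun q p b (s * q ^ N))"
proof -
  define L where "L = (\<lambda>s. \<Prod>j=3..6. qpoch_inf q (s * b j) * qpoch_inf q (q / (s * b j)) * qpoch_inf q (q * s / (p * b j)))"
  have not1: "s * b j \<notin> qpowers q" if "norm s = r" "j \<in> {3..6}" for s j
  proof
    assume "s * b j \<in> qpowers q"
    then obtain n :: int where "s * b j = q powi n" by (auto simp: qpowers_def)
    then have "norm (s * b j) = norm q powi n" by (simp only: norm_power_int)
    then show False using avoid1[OF that(2), of n] that(1) by (simp add: norm_mult)
  qed
  have not2: "s / (p * b j) \<notin> qpowers q" if "norm s = r" "j \<in> {3..6}" for s j
  proof
    assume "s / (p * b j) \<in> qpowers q"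
    then obtain n :: int where "s / (p * b j) = q powi n" by (auto simp: qpowers_def)
    then have "norm (s / (p * b j)) = norm q powi n" by (simp only: norm_power_int)
    then show False using avoid2[OF that(2), of n] that(1) by (simp add: norm_divide)
  qed
  have Lnz: "L s \<noteq> 0" if s: "norm s = r" for s
  proof -
    have "qpoch_inf q (s * b j) * qpoch_inf q (q / (s * b j)) * qpoch_inf q (q * s / (p * b j)) \<noteq> 0"
      if j: "j \<in> {3..6}" for j
    proof -
      have "s * b j = q / (q / (s * b j))" "s / (p * b j) = (q * s / (p * b j)) / q" using q_nz by simp_all
      then have "q / (s * b j) \<notin> qpowers q" "q * s / (p * b j) \<notin> qpowers q"
        using not1[OF s j] not2[OF s j] qpowers_divide[OF q_in_qpowers, of "q / (s * b j)"]
          qpowers_divide[OF _ q_in_qpowers, of "q * s / (p * b j)"] by argo+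
      then show ?thesis using not1[OF s j] qinf_eq_0_imp by auto
    qed
    then show ?thesis unfolding L_def by (simp add: prod_zero_iff)
  qed
  have "L holomorphic_on - {0}"
    unfolding L_def using p_nz c_nz by (intro holomorphic_intros) auto
  then have "continuous_on (sphere 0 r) L"
    using assms(1) by (intro continuous_on_subset[OF holomorphic_on_imp_continuous_on]) auto
  then have "continuous_on (sphere 0 r) (\<lambda>s. inverse (L s))"
    using Lnz by (intro continuous_on_inverse) auto
  then have "bounded ((\<lambda>s. inverse (L s)) ` sphere 0 r)"
    by (intro compact_imp_bounded compact_continuous_image) auto
  then obtain B where B0: "\<forall>z\<in>(\<lambda>s. inverse (L s)) ` sphere 0 r. norm z \<le> B"
    unfolding bounded_iff by blast
  have B: "norm (inverse (L s)) \<le> max B 1" if "norm s = r" for s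
    using B0 that by (simp add: le_max_iff_disj)
  \<comment> \<open>Taking \<open>max B 1\<close> keeps the inverse positive without inspecting \<open>B\<close>.\<close>
  define d1 where "d1 = inverse (max B 1)"
  have d1: "d1 > 0" by (simp add: d1_def)
  have Ld: "d1 \<le> norm (L s)" if "norm s = r" for s
    using B[OF that] Lnz[OF that] le_imp_inverse_le[OF B[OF that]] by (simp add: d1_def norm_inverse)
  define R where "R = (\<Sum>j=3..6. r * norm (b j) + r * norm q / norm (p * b j))"
  define E where "E = exp (R / (1 - norm q))"
  have E0: "E > 0" by (simp add: E_def)
  have R: "r * norm (b j) \<le> R" "r * norm q / norm (p * b j) \<le> R" if "j \<in> {3..6}" for j
  proof -
    have "r * norm (b j) + r * norm q / norm (p * b j) \<le> R"
      unfolding R_def using that assms(1) by (intro member_le_sum) auto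
    moreover have "r * norm (b j) \<ge> 0" "r * norm q / norm (p * b j) \<ge> 0" using assms(1) by auto
    ultimately show "r * norm (b j) \<le> R" "r * norm q / norm (p * b j) \<le> R" by linarith+
  qed
  have "d1 / E ^ 8 * scale r N \<le> norm (pair_fun q p b (s * q ^ N))" if s: "norm s = r" for N s
  proof -
    have s0: "s \<noteq> 0" using s assms(1) by auto
    let ?T = "norm q ^ (\<Sum>{..N})"
    have fac: "norm (q / (s * b j)) ^ N / ?T *
         norm (qpoch_inf q (s * b j) * qpoch_inf q (q / (s * b j)) * qpoch_inf q (q * s / (p * b j)))
        \<le> E\<^sup>2 * (norm (qpoch_inf q (q / (s * q ^ N * b j))) * norm (qpoch_inf q (q * (s * q ^ N) / (p * b j))))"
      if j: "j \<in> {3..6}" for j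
    proof -
      define y where "y = q / (s * b j)"
      define u where "u = q * s / (p * b j)"
      have y: "y \<noteq> 0" using q_nz s0 c_nz[OF j] by (simp add: y_def)
      have qy: "q / y = s * b j" using q_nz by (simp add: y_def)
      have 1: "qpoch_inf q (q / (s * q ^ N * b j)) = (- y) ^ N / q ^ (\<Sum>{..N}) * fpoch q (s * b j) N * qpoch_inf q y"
        using qinf_divide_power[OF y, of N] unfolding qy by (simp add: y_def mult_ac)
      have 2: "norm (qpoch_inf q (s * b j)) \<le> norm (fpoch q (s * b j) N) * E"
      proof -
        have "norm (s * b j * q ^ N) \<le> norm (s * b j) * 1"
          unfolding norm_mult[of "s * b j"] norm_power using q_lt by (intro mult_left_mono power_le_one) auto
        also have "\<dots> \<le> R" using R(1)[OF j] s by (simp add: norm_mult)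
        finally have "norm (qpoch_inf q (s * b j * q ^ N)) \<le> E" unfolding E_def by (rule norm_qinf_le')
        then show ?thesis unfolding qinf_split[of "s * b j" N] norm_mult by (intro mult_left_mono) auto
      qed
      have 3: "norm (qpoch_inf q u) \<le> E * norm (qpoch_inf q (u * q ^ N))"
      proof -
        have "norm u \<le> R" using R(2)[OF j] s by (simp add: u_def norm_mult norm_divide mult.commute)
        then have "norm (fpoch q u N) \<le> E" unfolding E_def by (rule norm_fpoch_le')
        then show ?thesis unfolding qinf_split[of u N] norm_mult by (intro mult_right_mono) auto
      qed
      have uq: "q * (s * q ^ N) / (p * b j) = u * q ^ N" by (simp add: u_def)
      have "norm y ^ N / ?T * norm (qpoch_inf q (s * b j) * qpoch_inf q y * qpoch_inf q u)
         = norm y ^ N / ?T * norm (qpoch_inf q y) * (norm (qpoch_inf q (s * b j)) * norm (qpoch_inf q u))"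
        by (simp add: norm_mult)
      also have "\<dots> \<le> norm y ^ N / ?T * norm (qpoch_inf q y) * ((norm (fpoch q (s * b j) N) * E) * (E * norm (qpoch_inf q (u * q ^ N))))"
        using E0 by (intro mult_left_mono mult_mono 2 3) auto
      also have "\<dots> = E\<^sup>2 * (norm (qpoch_inf q (q / (s * q ^ N * b j))) * norm (qpoch_inf q (u * q ^ N)))"
        unfolding 1 by (simp add: norm_mult norm_divide norm_power power2_eq_square)
      finally show ?thesis unfolding uq y_def u_def .
    qed
    have "(\<Prod>j=3..6. norm (q / (s * b j)) ^ N / ?T *
         norm (qpoch_inf q (s * b j) * qpoch_inf q (q / (s * b j)) * qpoch_inf q (q * s / (p * b j))))
       \<le> (\<Prod>j::nat=3..6. E\<^sup>2 * (norm (qpoch_inf q (q / (s * q ^ N * b j))) * norm (qpoch_inf q (q * (s * q ^ N) / (p * b j)))))"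
      by (intro prod_mono conjI fac mult_nonneg_nonneg) auto
    also have "\<dots> = E ^ 8 * norm (pair_fun q p b (s * q ^ N))"
      unfolding pair_fun_def by (simp add: prod.distrib norm_mult prod_norm flip: power_mult)
    also have "(\<Prod>j=3..6. norm (q / (s * b j)) ^ N / ?T *
         norm (qpoch_inf q (s * b j) * qpoch_inf q (q / (s * b j)) * qpoch_inf q (q * s / (p * b j))))
       = scale r N * norm (L s)"
    proof -
      have "norm p * (\<Prod>j=3..6. norm (b j)) = norm q"
        using arg_cong[OF p_prod, of norm] by (simp add: norm_mult prod_norm)
      then have pb: "(\<Prod>j=3..6. norm (b j)) = norm q / norm p" using p_nz by (simp add: field_simps)
      have "(\<Prod>j=3..6. norm (q / (s * b j))) = norm q ^ 4 / (r ^ 4 * (\<Prod>j=3..6. norm (b j)))"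
        by (simp add: norm_mult norm_divide prod_dividef prod.distrib s)
      also have "\<dots> = norm p * norm q / r ^ 4 * norm q ^ 2"
        unfolding pb using q_nz assms(1) p_nz by (simp add: field_simps power4_eq_xxxx power2_eq_square)
      finally have pr: "(\<Prod>j=3..6. norm (q / (s * b j))) = norm p * norm q / r ^ 4 * norm q ^ 2" .
      have "(\<Prod>j=3..6. norm (q / (s * b j)) ^ N) = (norm p * norm q / r ^ 4) ^ N * (norm q ^ 2) ^ N"
        unfolding power_mult_distrib[symmetric] pr[symmetric]
        by (rule prod_power_distrib[symmetric])
      moreover have "(\<Prod>j::nat=3..6. ?T) = norm q ^ (2 * (N * N)) * (norm q ^ 2) ^ N"
      proof -
        have "(\<Prod>j::nat=3..6. ?T) = norm q ^ ((\<Sum>{..N} + \<Sum>{..N}) + (\<Sum>{..N} + \<Sum>{..N}))"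
          unfolding prod_3_6 power_add by (simp only: mult.assoc)
        also have "(\<Sum>{..N} + \<Sum>{..N}) + (\<Sum>{..N} + \<Sum>{..N}) = 2 * (N * N) + 2 * N"
          unfolding gauss_sum_atMost by simp
        finally show ?thesis by (simp only: power_add power_mult)
      qed
      ultimately have "(\<Prod>j=3..6. norm (q / (s * b j)) ^ N / ?T) = scale r N"
        unfolding prod_dividef scale_def using q_nz by simp
      then show ?thesis unfolding prod.distrib L_def prod_norm by simp
    qed
    finally have "scale r N * norm (L s) \<le> E ^ 8 * norm (pair_fun q p b (s * q ^ N))" .
    moreover have "scale r N * d1 \<le> scale r N * norm (L s)"
      using Ld[OF s] assms(1) by (intro mult_left_mono) (auto simp: scale_def)
    ultimately show ?thesis using E0 by (simp add: field_simps)
  qed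
  then show ?thesis using d1 E0 by (intro exI[of _ "d1 / E ^ 8"]) auto
qed

lemma det_fun_upper_bound:
  assumes "r > 0" "x \<noteq> 0" "m \<noteq> 0"
  shows "\<exists>K\<ge>0. \<forall>N s. norm s = r \<longrightarrow> norm (det_fun q (fam (s * q ^ N)) x m) \<le> K * scale r N"
proof -
  have bnd: "\<exists>K\<ge>0. \<forall>N s. norm s = r \<longrightarrow>
      norm (bil_sum q (fam (s * q ^ N)) y * theta_comb q (fam (s * q ^ N)) w) \<le> K * scale r N"
    if y: "y \<noteq> 0" and w: "w \<noteq> 0" for y w
  proof -
    obtain K1 where K1': "K1 \<ge> 0 \<and> (\<forall>N s. norm s = r \<longrightarrow>
        norm (bil_sum q (b(1 := s * q ^ N, 2 := p / s / q ^ N)) y)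
          \<le> K1 * (norm q ^ N / (r ^ (2 * N) * norm q ^ (N * N))))"
      by (rule exE[OF norm_bil_sum_shift_le[OF p_nz p_lt c_nz y assms(1)]])
    have K1: "K1 \<ge> 0" by (rule K1'[THEN conjunct1])
    have K1b: "norm (bil_sum q (b(1 := s * q ^ N, 2 := p / s / q ^ N)) y)
          \<le> K1 * (norm q ^ N / (r ^ (2 * N) * norm q ^ (N * N)))" if "norm s = r" for s N
      by (rule K1'[THEN conjunct2, rule_format, OF that])
    have "(\<lambda>s. theta_comb q (fam s) w) holomorphic_on - {0}"
      unfolding theta_comb_def prod_1_6 pair_family_upd
      using w p_nz c_nz by (intro holomorphic_intros) auto
    then obtain B where B: "B > 0" "\<And>s. norm s = r \<Longrightarrow> norm (theta_comb q (fam s) w) \<le> B"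
      using bounded_on_circle assms(1) by blast
    have main: "norm (bil_sum q (fam (s * q ^ N)) y * theta_comb q (fam (s * q ^ N)) w) \<le> K1 * B * scale r N"
      if s: "norm s = r" for N s
    proof -
      have s0: "s \<noteq> 0" using s assms(1) by auto
      have fam: "fam (s * q ^ N) = b(1 := s * q ^ N, 2 := p / s / q ^ N)" by simp
      have th: "theta_comb q (fam (s * q ^ N)) w = (p / s / s) ^ N / q ^ (N * N) * theta_comb q (fam s) w"
        unfolding fam using s0 p_nz w by (intro theta_comb_shift) auto
      have "norm (theta_comb q (fam (s * q ^ N)) w) \<le> (norm p / r\<^sup>2) ^ N / norm q ^ (N * N) * B"
      proof -
        have "norm ((p / s / s) ^ N / q ^ (N * N)) = (norm p / r\<^sup>2) ^ N / norm q ^ (N * N)"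
          by (simp add: norm_divide norm_power norm_mult s power2_eq_square)
        then have "norm (theta_comb q (fam (s * q ^ N)) w)
            = (norm p / r\<^sup>2) ^ N / norm q ^ (N * N) * norm (theta_comb q (fam s) w)"
          unfolding th norm_mult[of _ "theta_comb q (fam s) w"] by (simp only:)
        also have "\<dots> \<le> (norm p / r\<^sup>2) ^ N / norm q ^ (N * N) * B"
          by (rule mult_left_mono[OF B(2)[OF s]]) simp
        finally show ?thesis .
      qed
      then have "norm (bil_sum q (fam (s * q ^ N)) y * theta_comb q (fam (s * q ^ N)) w)
         \<le> (K1 * (norm q ^ N / (r ^ (2 * N) * norm q ^ (N * N)))) * ((norm p / r\<^sup>2) ^ N / norm q ^ (N * N) * B)"
        unfolding fam by (rule norm_mult_le[OF K1b[OF s]])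
      also have "\<dots> = K1 * B * scale r N"
      proof -
        have "norm p * norm q / r ^ 4 = norm q / r\<^sup>2 * (norm p / r\<^sup>2)"
          by (simp add: power4_eq_xxxx power2_eq_square mult_ac)
        then have e1: "(norm p * norm q / r ^ 4) ^ N = norm q ^ N / r ^ (2 * N) * (norm p / r\<^sup>2) ^ N"
          by (simp only: power_mult_distrib power_divide power_mult)
        have e2: "norm q ^ (2 * (N * N)) = norm q ^ (N * N) * norm q ^ (N * N)"
          by (simp only: mult_2 power_add)
        show ?thesis unfolding scale_def e1 e2 by (simp only: times_divide_eq_left times_divide_eq_right
              divide_divide_eq_left mult_ac)
      qed
      finally show ?thesis .
    qed
    show ?thesis
    proof (intro exI[of _ "K1 * B"] conjI allI impI)
      show "0 \<le> K1 * B" using K1 B(1) by simp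
    qed (rule main)
  qed
  obtain K1 where K1': "K1 \<ge> 0 \<and> (\<forall>N s. norm s = r \<longrightarrow>
      norm (bil_sum q (fam (s * q ^ N)) x * theta_comb q (fam (s * q ^ N)) m) \<le> K1 * scale r N)"
    by (rule exE[OF bnd[OF assms(2,3)]])
  obtain K2 where K2': "K2 \<ge> 0 \<and> (\<forall>N s. norm s = r \<longrightarrow>
      norm (bil_sum q (fam (s * q ^ N)) m * theta_comb q (fam (s * q ^ N)) x) \<le> K2 * scale r N)"
    by (rule exE[OF bnd[OF assms(3,2)]])
  note K1 = K1'[THEN conjunct1] K1'[THEN conjunct2, rule_format]
  note K2 = K2'[THEN conjunct1] K2'[THEN conjunct2, rule_format]
  have main: "norm (det_fun q (fam (s * q ^ N)) x m) \<le> (K1 + norm (m / x) * K2) * scale r N" if s: "norm s = r" for N s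
  proof -
    have "det_fun q (fam (s * q ^ N)) x m = bil_sum q (fam (s * q ^ N)) x * theta_comb q (fam (s * q ^ N)) m
       - m / x * (bil_sum q (fam (s * q ^ N)) m * theta_comb q (fam (s * q ^ N)) x)"
      unfolding det_fun_def by (simp only: mult.assoc)
    then have "norm (det_fun q (fam (s * q ^ N)) x m) \<le> norm (bil_sum q (fam (s * q ^ N)) x * theta_comb q (fam (s * q ^ N)) m)
       + norm (m / x * (bil_sum q (fam (s * q ^ N)) m * theta_comb q (fam (s * q ^ N)) x))"
      by (simp only: norm_triangle_ineq4)
    also have "\<dots> \<le> K1 * scale r N + norm (m / x) * (K2 * scale r N)"
      by (intro add_mono K1(2)[OF s] norm_mult_le K2(2)[OF s] order_refl)
    finally show ?thesis by (simp only: distrib_right mult.assoc)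
  qed
  show ?thesis
  proof (intro exI[of _ "K1 + norm (m / x) * K2"] conjI allI impI)
    show "0 \<le> K1 + norm (m / x) * K2" using K1(1) K2(1) by simp
  qed (rule main)
qed

end

section \<open>Evaluation of the determinant for generic parameters\<close>

lemma prod_permute_params:
  assumes "\<pi> permutes {1..6::nat}"
  shows "(\<Prod>j=1..6. F ((b \<circ> \<pi>) j)) = (\<Prod>j=1..6. F (b j))"
  using prod.permute[OF assms, of "\<lambda>j. F (b j)"] by (simp add: o_def)

text \<open>
  All ingredients are symmetric in the parameters.
\<close>

lemma det_fun_permute:
  assumes "\<pi> permutes {1..6::nat}"
  shows "det_fun q (b \<circ> \<pi>) x m = det_fun q b x m"
proof -
  have bt: "bil_term q (b \<circ> \<pi>) = bil_term q b"
    unfolding bil_term_def fun_eq_iff prod_permute_params[OF assms, of "\<lambda>c. fpoch q (_ * c) _ * qpoch_inf q (q / (_ * c)) * qpoch_inf q (q ^ Suc _ * _ / c)"]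
    by simp
  have bs: "bil_sum q (b \<circ> \<pi>) = bil_sum q b" by (simp add: fun_eq_iff bil_sum_def bt)
  have tc: "theta_comb q (b \<circ> \<pi>) = theta_comb q b"
    unfolding theta_comb_def fun_eq_iff prod_permute_params[OF assms, of "\<lambda>c. theta q (_ * c)"]
      prod_permute_params[OF assms, of "\<lambda>c. theta q (_ / c)"] by simp
  show ?thesis by (simp add: det_fun_def bs tc)
qed

context pair_family
begin

lemma det_fam_swap:
  assumes "s \<noteq> 0"
  shows "det_fun q (fam (p / s)) x m = det_fun q (fam s) x m"
proof -
  have "fam (p / s) = fam s \<circ> Transposition.transpose 1 2"
    using assms p_nz by (auto simp: fun_eq_iff Transposition.transpose_def)
  moreover have "Transposition.transpose 1 2 permutes {1..6::nat}"
    by (rule permutes_swap_id) auto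
  ultimately show ?thesis by (simp only: det_fun_permute)
qed

lemma pair_fun_swap:
  assumes "s \<noteq> 0"
  shows "pair_fun q p b (p / s) = pair_fun q p b s"
  unfolding pair_fun_def using assms p_nz by (simp add: mult.commute)

text \<open>
  This covers the circles shrinking to 0. The expanding ones are treated by the symmetry \<open>s \<mapsto> p / s\<close>, which
  exchanges the two moving parameters.
\<close>

lemma det_fam_le_pair_fun:
  assumes "r > 0" "x \<noteq> 0" "m \<noteq> 0"
    and avoid1: "\<And>j n. j \<in> {3..6} \<Longrightarrow> r * norm (b j) \<noteq> norm q powi n"
    and avoid2: "\<And>j n. j \<in> {3..6} \<Longrightarrow> r * (1 / norm (p * b j)) \<noteq> norm q powi n"
  shows "\<exists>K. \<forall>N s. norm s = r \<longrightarrow> pair_fun q p b (s * q ^ N) \<noteq> 0 \<and>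
     norm (det_fun q (fam (s * q ^ N)) x m) \<le> K * norm (pair_fun q p b (s * q ^ N))"
proof -
  obtain d where d': "d > 0 \<and> (\<forall>N s. norm s = r \<longrightarrow> d * scale r N \<le> norm (pair_fun q p b (s * q ^ N)))"
    by (rule exE[OF pair_fun_lower_bound[OF assms(1) avoid1 avoid2]])
  obtain K where K': "K \<ge> 0 \<and> (\<forall>N s. norm s = r \<longrightarrow> norm (det_fun q (fam (s * q ^ N)) x m) \<le> K * scale r N)"
    by (rule exE[OF det_fun_upper_bound[OF assms(1-3)]])
  have sc: "scale r N > 0" for N
    unfolding scale_def using p_nz q_nz assms(1) by (intro divide_pos_pos zero_less_power mult_pos_pos) auto
  show ?thesis
  proof (intro exI[of _ "K / d"] allI impI conjI)
    fix N :: nat and s :: complex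
    assume s: "norm s = r"
    have 1: "d * scale r N \<le> norm (pair_fun q p b (s * q ^ N))"
      by (rule d'[THEN conjunct2, rule_format, OF s])
    have d: "d > 0" using d' by (rule conjunct1)
    then have "0 < d * scale r N" using sc by (rule mult_pos_pos)
    then show "pair_fun q p b (s * q ^ N) \<noteq> 0" using 1 by auto
    have "norm (det_fun q (fam (s * q ^ N)) x m) \<le> K * scale r N"
      by (rule K'[THEN conjunct2, rule_format, OF s])
    also have "K * scale r N = K / d * (d * scale r N)" using d by simp
    also have "\<dots> \<le> K / d * norm (pair_fun q p b (s * q ^ N))"
      using 1 d K' by (intro mult_left_mono) auto
    finally show "norm (det_fun q (fam (s * q ^ N)) x m) \<le> K / d * norm (pair_fun q p b (s * q ^ N))" .
  qed
qed

end

text \<open>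
  The conditions make the zeros of \<open>pair_fun\<close> simple, let the determinant vanish at all of them, and allow the
  evaluation at \<open>s = 1 / b 3\<close>.
\<close>

locale generic_family = pair_family +
  fixes m :: complex
  assumes m_nz: "m \<noteq> 0" and m_sq: "m\<^sup>2 \<notin> qpowers q"
    and gen_mult: "\<And>i j. i \<in> {3..6} \<Longrightarrow> j \<in> {3..6} \<Longrightarrow> b i * b j \<notin> qpowers q"
    and gen_divide: "\<And>i j. i \<in> {3..6} \<Longrightarrow> j \<in> {3..6} \<Longrightarrow> i \<noteq> j \<Longrightarrow> b i / b j \<notin> qpowers q"
    and gen_p: "\<And>i j. i \<in> {3..6} \<Longrightarrow> j \<in> {3..6} \<Longrightarrow> p * b i * b j \<notin> qpowers q"
    and gen_m: "\<And>j. j \<in> {3..6} \<Longrightarrow> m * b j \<notin> qpowers q" "\<And>j. j \<in> {3..6} \<Longrightarrow> m / b j \<notin> qpowers q"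
begin

lemma factor1_eq_0_imp:
  assumes "s \<noteq> 0" "j \<in> {3..6}" "qpoch_inf q (q / (s * b j)) = 0"
  shows "s * b j \<in> qpowers q"
proof -
  have "s * b j = q / (q / (s * b j))" using q_nz by simp
  then show ?thesis using qpowers_divide[OF q_in_qpowers qinf_eq_0_imp[OF assms(3)]] by simp
qed

lemma factor2_eq_0_imp:
  assumes "s \<noteq> 0" "j \<in> {3..6}" "qpoch_inf q (q * s / (p * b j)) = 0"
  shows "s / (p * b j) \<in> qpowers q"
proof -
  have "s / (p * b j) = (q * s / (p * b j)) / q" using q_nz by simp
  then show ?thesis using qpowers_divide[OF qinf_eq_0_imp[OF assms(3)] q_in_qpowers] by simp
qed

lemma basis_nonzero:
  assumes "t \<noteq> 0" "j \<in> {3..6}" "t * b j \<in> qpowers q"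
  shows "odd_theta_basis m t \<noteq> 0"
proof -
  have "b j * b j = (t * b j) * (t * b j) / t\<^sup>2" "m / b j = (t * m) / (t * b j)" "m * b j = (m / t) * (t * b j)"
    using assms(1) by (simp_all add: power2_eq_square)
  then show ?thesis
    using gen_mult[OF assms(2,2)] gen_m[OF assms(2)] qpowers_mult[OF assms(3,3)] assms(3)
      qpowers_mult qpowers_divide odd_theta_basis_eq_0_iff[OF m_nz assms(1)] by metis
qed

text \<open>
  At a zero of \<open>pair_fun\<close> one of the products \<open>b 1 * b j\<close> and \<open>b 2 * b j\<close> is a positive power of \<open>q\<close>.
\<close>

lemma det_fam_eq_0:
  assumes "s \<noteq> 0" "x \<noteq> 0" "pair_fun q p b s = 0"
  shows "det_fun q (fam s) x m = 0"
proof -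
  have "(\<exists>j\<in>{3..6}. qpoch_inf q (q / (s * b j)) = 0) \<or> (\<exists>j\<in>{3..6}. qpoch_inf q (q * s / (p * b j)) = 0)"
    using assms(3) unfolding pair_fun_def by (simp only: mult_eq_0_iff prod_zero_iff finite_atLeastAtMost)
  then show ?thesis
  proof (elim disjE bexE)
    fix j :: nat assume j: "j \<in> {3..6}" and 0: "qpoch_inf q (q / (s * b j)) = 0"
    obtain n where "q / (s * b j) * q ^ n = 1" using 0 qinf_eq_0_iff by blast
    then have n: "fam s 1 * fam s j = q ^ Suc n" using j assms(1) c_nz[OF j] by (auto simp: field_simps)
    have "odd_theta_basis m (fam s 1) \<noteq> 0"
      using basis_nonzero[OF assms(1) j factor1_eq_0_imp[OF assms(1) j 0]] by simp
    then show ?thesis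
      using j by (intro six_params.det_fun_eq_0_if_pair[OF six_params_fam[OF assms(1)] _ _ n m_nz m_sq _ assms(2)]) auto
  next
    fix j :: nat assume j: "j \<in> {3..6}" and 0: "qpoch_inf q (q * s / (p * b j)) = 0"
    obtain n where "q * s / (p * b j) * q ^ n = 1" using 0 qinf_eq_0_iff by blast
    then have n: "fam s 2 * fam s j = q ^ Suc n" using j assms(1) c_nz[OF j] p_nz by (auto simp: field_simps)
    have "p / s * b j = inverse (s / (p * b j))" by simp
    then have "p / s * b j \<in> qpowers q" using qpowers_inverse[OF factor2_eq_0_imp[OF assms(1) j 0]] by simp
    then have "odd_theta_basis m (fam s 2) \<noteq> 0"
      using basis_nonzero[of "p / s" j] assms(1) j p_nz by simp
    then show ?thesis
      using j by (intro six_params.det_fun_eq_0_if_pair[OF six_params_fam[OF assms(1)] _ _ n m_nz m_sq _ assms(2)]) auto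
  qed
qed

text \<open>
  The genericity conditions prevent two of the eight factors from vanishing together.
\<close>

lemma simple_zero_pair_fun:
  assumes s: "s \<noteq> 0" and "pair_fun q p b s = 0"
  shows "simple_zero (pair_fun q p b) s"
proof -
  define A where "A = (\<lambda>j s. qpoch_inf q (q / (s * b j)))"
  define B where "B = (\<lambda>j s. qpoch_inf q (q * s / (p * b j)))"
  have diff: "f field_differentiable at s" if "f holomorphic_on - {0}" for f
    using that s by (intro holomorphic_on_imp_differentiable_at[where s = "- {0}"]) auto
  have hA: "A j holomorphic_on - {0}" and hB: "B j holomorphic_on - {0}" if "j \<in> {3..6}" for j
    unfolding A_def B_def using c_nz[OF that] p_nz by (auto intro!: holomorphic_intros)
  have eq: "pair_fun q p b = (\<lambda>s. (\<Prod>j=3..6. A j s) * (\<Prod>j=3..6. B j s))"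
    by (simp add: fun_eq_iff pair_fun_def A_def B_def)
  have A0: "s * b j \<in> qpowers q" if "j \<in> {3..6}" "A j s = 0" for j
    using factor1_eq_0_imp[OF s] that by (simp add: A_def)
  have B0: "s / (p * b j) \<in> qpowers q" if "j \<in> {3..6}" "B j s = 0" for j
    using factor2_eq_0_imp[OF s] that by (simp add: B_def)
  have AA: "A j s \<noteq> 0" if "i \<in> {3..6}" "A i s = 0" "j \<in> {3..6}" "j \<noteq> i" for i j
  proof
    assume "A j s = 0"
    then have "(s * b j) / (s * b i) \<in> qpowers q" using A0 that qpowers_divide by blast
    then show False using gen_divide[OF that(3,1,4)] s by simp
  qed
  have AB: "B j s \<noteq> 0" if "i \<in> {3..6}" "A i s = 0" "j \<in> {3..6}" for i j
  proof
    assume "B j s = 0"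
    then have "(s * b i) / (s / (p * b j)) \<in> qpowers q" using A0 B0 that qpowers_divide by blast
    then show False using gen_p[OF that(1,3)] s by (simp add: mult_ac)
  qed
  have BB: "B j s \<noteq> 0" if "i \<in> {3..6}" "B i s = 0" "j \<in> {3..6}" "j \<noteq> i" for i j
  proof
    assume "B j s = 0"
    then have "(s / (p * b i)) / (s / (p * b j)) \<in> qpowers q" using B0 that qpowers_divide by blast
    then show False using gen_divide[OF that(3,1,4)] s p_nz by simp
  qed
  have dA: "(\<lambda>s. \<Prod>j=3..6. A j s) holomorphic_on - {0}" and dB: "(\<lambda>s. \<Prod>j=3..6. B j s) holomorphic_on - {0}"
    using hA hB by (auto intro!: holomorphic_intros)
  have "(\<exists>i\<in>{3..6}. A i s = 0) \<or> (\<exists>i\<in>{3..6}. B i s = 0)"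
    using assms(2) unfolding eq by (simp only: mult_eq_0_iff prod_zero_iff finite_atLeastAtMost)
  then show ?thesis
  proof (elim disjE bexE)
    fix i :: nat assume i: "i \<in> {3..6}" "A i s = 0"
    have "simple_zero (qpoch_inf q) (q / (s * b i))" using i(2) by (intro simple_zero_qinf) (simp add: A_def)
    then have "simple_zero (A i) s" unfolding A_def
      by (rule simple_zero_compose[where f = "qpoch_inf q" and h = "\<lambda>s. q / (s * b i)" and D = "- (q / (s\<^sup>2 * b i))"])
        (use s c_nz[OF i(1)] q_nz in \<open>auto intro!: derivative_eq_intros simp: power2_eq_square\<close>)
    then have "simple_zero (\<lambda>s. \<Prod>j=3..6. A j s) s"
      using i AA[OF i] diff[OF hA] by (intro simple_zero_prod) auto
    moreover have "(\<Prod>j=3..6. B j s) \<noteq> 0" using AB[OF i] by (simp add: prod_zero_iff)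
    ultimately show ?thesis unfolding eq by (intro simple_zero_mult_left diff dB)
  next
    fix i :: nat assume i: "i \<in> {3..6}" "B i s = 0"
    have "simple_zero (qpoch_inf q) (q * s / (p * b i))" using i(2) by (intro simple_zero_qinf) (simp add: B_def)
    then have "simple_zero (B i) s" unfolding B_def
      by (rule simple_zero_compose[where f = "qpoch_inf q" and h = "\<lambda>s. q * s / (p * b i)" and D = "q / (p * b i)"])
        (use s c_nz[OF i(1)] q_nz p_nz in \<open>auto intro!: derivative_eq_intros\<close>)
    then have "simple_zero (\<lambda>s. \<Prod>j=3..6. B j s) s"
      using i BB[OF i] diff[OF hB] by (intro simple_zero_prod) auto
    moreover have "(\<Prod>j=3..6. A j s) \<noteq> 0" using AB i by (auto simp: prod_zero_iff)
    ultimately show ?thesis unfolding eq by (intro simple_zero_mult_right diff dA)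
  qed
qed

text \<open>
  The quotient is holomorphic on the punctured plane and bounded on circles of radii tending to 0 and to infinity,
  hence constant.
\<close>

lemma det_fam_eq_const_mult:
  assumes x: "x \<noteq> 0"
  shows "\<exists>c. \<forall>s. s \<noteq> 0 \<longrightarrow> det_fun q (fam s) x m = c * pair_fun q p b s"
proof -
  have "\<exists>h. h holomorphic_on - {0} \<and> (\<forall>s\<in>- {0}. det_fun q (fam s) x m = pair_fun q p b s * h s)"
    using holomorphic_det_fam[OF x m_nz] holomorphic_pair_fun det_fam_eq_0[OF _ x] simple_zero_pair_fun
    by (intro holomorphic_divide_simple_zeros) auto
  then obtain h where h: "h holomorphic_on - {0}" "\<And>s. s \<noteq> 0 \<Longrightarrow> det_fun q (fam s) x m = pair_fun q p b s * h s"
    by auto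
  define a :: "nat \<times> bool \<Rightarrow> real" where
    "a = (\<lambda>(j, c). if c then norm (b j) else 1 / norm (p * b j))"
  have "a i > 0" if "i \<in> {3..6} \<times> UNIV" for i
    using that c_nz p_nz by (auto simp: a_def)
  then obtain \<rho> where \<rho>: "\<rho> > 0" "\<And>i n. i \<in> {3..6} \<times> UNIV \<Longrightarrow> \<rho> * a i \<noteq> norm q powi n"
    using exists_radius_avoiding[of "{3..6} \<times> UNIV" a "norm q"] by (auto simp: countable_finite)
  have av1: "\<rho> * norm (b j) \<noteq> norm q powi n" if "j \<in> {3..6}" for j n
    using \<rho>(2)[of "(j, True)" n] that by (simp add: a_def)
  have av2: "\<rho> * (1 / norm (p * b j)) \<noteq> norm q powi n" if "j \<in> {3..6}" for j n
    using \<rho>(2)[of "(j, False)" n] that by (simp add: a_def)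
  \<comment> \<open>The map \<open>s \<mapsto> p / s\<close> takes the circle of radius \<open>\<rho>\<close> to the one of radius \<open>norm p / \<rho>\<close>.\<close>
  define \<rho>' where "\<rho>' = norm p / \<rho>"
  have \<rho>'0: "\<rho>' > 0" using \<rho>(1) p_nz by (simp add: \<rho>'_def)
  have av1': "\<rho>' * norm (b j) \<noteq> norm q powi n" if "j \<in> {3..6}" for j n
  proof
    assume *: "\<rho>' * norm (b j) = norm q powi n"
    have "\<rho> * (1 / norm (p * b j)) = inverse (\<rho>' * norm (b j))"
      by (simp add: \<rho>'_def norm_mult)
    also have "\<dots> = norm q powi (- n)" unfolding * by (simp add: power_int_minus)
    finally show False using av2[OF that] by blast
  qed
  have av2': "\<rho>' * (1 / norm (p * b j)) \<noteq> norm q powi n" if "j \<in> {3..6}" for j n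
  proof
    assume *: "\<rho>' * (1 / norm (p * b j)) = norm q powi n"
    have "\<rho> * norm (b j) = inverse (\<rho>' * (1 / norm (p * b j)))"
      using p_nz by (simp add: \<rho>'_def norm_mult)
    also have "\<dots> = norm q powi (- n)" unfolding * by (simp add: power_int_minus)
    finally show False using av1[OF that] by blast
  qed
  obtain K1 where K1: "\<forall>N s. norm s = \<rho> \<longrightarrow> pair_fun q p b (s * q ^ N) \<noteq> 0 \<and>
     norm (det_fun q (fam (s * q ^ N)) x m) \<le> K1 * norm (pair_fun q p b (s * q ^ N))"
    by (rule exE[OF det_fam_le_pair_fun[OF \<rho>(1) x m_nz av1 av2]])
  obtain K2 where K2: "\<forall>N s. norm s = \<rho>' \<longrightarrow> pair_fun q p b (s * q ^ N) \<noteq> 0 \<and>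
     norm (det_fun q (fam (s * q ^ N)) x m) \<le> K2 * norm (pair_fun q p b (s * q ^ N))"
    by (rule exE[OF det_fam_le_pair_fun[OF \<rho>'0 x m_nz av1' av2']])
  have hle: "norm (h z) \<le> K"
    if "z \<noteq> 0" "pair_fun q p b z \<noteq> 0" "norm (det_fun q (fam z) x m) \<le> K * norm (pair_fun q p b z)" for z K
    using that h(2)[OF that(1)] by (simp add: norm_mult mult.commute[of _ "norm (h z)"])
  have "\<exists>c. \<forall>z. z \<noteq> 0 \<longrightarrow> h z = c"
  proof (rule bounded_on_circles_imp_constant[OF h(1) norm_q_pos q_lt \<rho>(1)])
    fix z :: complex and n :: int
    assume z: "norm z = \<rho> * norm q powi n"
    then have z0: "z \<noteq> 0" using \<rho>(1) q_nz by auto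
    show "norm (h z) \<le> max K1 K2"
    proof (cases "n \<ge> 0")
      case True
      define s where "s = z / q ^ nat n"
      have "norm s = \<rho>" using z True q_nz by (simp add: s_def norm_divide norm_power power_int_def)
      moreover have "s * q ^ nat n = z" using q_nz by (simp add: s_def)
      ultimately have "pair_fun q p b z \<noteq> 0 \<and> norm (det_fun q (fam z) x m) \<le> K1 * norm (pair_fun q p b z)"
        using K1[rule_format, of s "nat n"] by (simp only: simp_thms)
      then have "norm (h z) \<le> K1" using hle[OF z0] by blast
      then show ?thesis by (simp add: le_max_iff_disj)
    next
      case False
      define s where "s = p / z / q ^ nat (- n)"
      have "norm s = \<rho>'"
        using z False q_nz \<rho>(1) by (simp add: s_def norm_divide norm_mult norm_power power_int_def \<rho>'_def field_simps)
      moreover have "s * q ^ nat (- n) = p / z" using q_nz by (simp add: s_def)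
      ultimately have "pair_fun q p b (p / z) \<noteq> 0 \<and> norm (det_fun q (fam (p / z)) x m) \<le> K2 * norm (pair_fun q p b (p / z))"
        using K2[rule_format, of s "nat (- n)"] by (simp only: simp_thms)
      then have "norm (h z) \<le> K2"
        unfolding det_fam_swap[OF z0] pair_fun_swap[OF z0] using hle[OF z0] by blast
      then show ?thesis by (simp add: le_max_iff_disj)
    qed
  qed
  then obtain c where "\<And>z. z \<noteq> 0 \<Longrightarrow> h z = c" by blast
  then show ?thesis using h(2) by (auto simp: mult.commute)
qed

text \<open>
  The constant is found at \<open>s = 1 / b 3\<close>, where \<open>b 1 * b 3 = 1\<close> and \<open>det_fun_at_terminating\<close> applies.
\<close>

lemma det_fam_eval:
  assumes x: "x \<noteq> 0" and s: "s \<noteq> 0"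
  shows "det_fun q (fam s) x m = qpoch_inf q q * pair_prod q (fam s) * theta q (m\<^sup>2) * odd_theta_basis m x"
proof -
  obtain c where c: "\<And>s. s \<noteq> 0 \<Longrightarrow> det_fun q (fam s) x m = c * pair_fun q p b s"
    using det_fam_eq_const_mult[OF x] by blast
  have mem: "3 \<in> {3..6::nat}" "4 \<in> {3..6::nat}" by simp_all
  have b3: "b 3 \<noteq> 0" using c_nz[OF mem(1)] .
  \<comment> \<open>At \<open>s0\<close> the first and third parameters have product 1.\<close>
  define s0 where "s0 = 1 / b 3"
  have s0: "s0 \<noteq> 0" using b3 by (simp add: s0_def)
  have inv: "y \<notin> qpowers q" if "inverse y \<notin> qpowers q" for y using that qpowers_inverse by blast
  have "det_fun q (fam s0) x m = qpoch_inf q q * pair_prod q (fam s0) * theta q (m\<^sup>2) * odd_theta_basis m x"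
  proof (rule six_params.det_fun_at_terminating[OF six_params_fam[OF s0]], unfold pair_family_upd)
    show "s0 * b 3 = 1" using b3 by (simp add: s0_def)
    have "inverse (s0\<^sup>2) = b 3 * b 3" by (simp add: s0_def power2_eq_square)
    then show "s0\<^sup>2 \<notin> qpowers q" using gen_mult[OF mem(1,1)] inv by metis
    show "(b 4)\<^sup>2 \<notin> qpowers q" using gen_mult[OF mem(2,2)] by (simp add: power2_eq_square)
    show "b 4 * s0 \<notin> qpowers q" using gen_divide[OF mem(2,1)] by (simp add: s0_def)
    show "b 4 / s0 \<notin> qpowers q" using gen_mult[OF mem(2,1)] by (simp add: s0_def)
    show "s0 * m \<notin> qpowers q" using gen_m(2)[OF mem(1)] by (simp add: s0_def)
    show "m / s0 \<notin> qpowers q" using gen_m(1)[OF mem(1)] by (simp add: s0_def)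
  qed (rule m_nz m_sq x)+
  then have eq: "c * pair_fun q p b s0 = qpoch_inf q q * pair_const q p b * theta q (m\<^sup>2) * odd_theta_basis m x * pair_fun q p b s0"
    unfolding c[OF s0] pair_prod_family[OF s0] by (simp only: mult_ac)
  have "qpoch_inf q (q / (s0 * b j)) \<noteq> 0" if j: "j \<in> {3..6}" for j
  proof (cases "j = 3")
    case True
    then show ?thesis using b3 qinf_q_nonzero by (simp add: s0_def)
  next
    case False
    have "s0 * b j \<notin> qpowers q" using gen_divide[OF j mem(1) False] by (simp add: s0_def)
    then show ?thesis using factor1_eq_0_imp[OF s0 j] by blast
  qed
  moreover have "qpoch_inf q (q * s0 / (p * b j)) \<noteq> 0" if j: "j \<in> {3..6}" for j
  proof -
    have "inverse (s0 / (p * b j)) = p * b j * b 3" by (simp add: s0_def)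
    then have "s0 / (p * b j) \<notin> qpowers q" using gen_p[OF j mem(1)] inv by metis
    then show ?thesis using factor2_eq_0_imp[OF s0 j] by blast
  qed
  ultimately have "pair_fun q p b s0 \<noteq> 0" unfolding pair_fun_def by (simp add: prod_zero_iff)
  then have "c = qpoch_inf q q * pair_const q p b * theta q (m\<^sup>2) * odd_theta_basis m x" using eq by simp
  then show ?thesis unfolding c[OF s] pair_prod_family[OF s] by (simp only: mult_ac)
qed

end

section \<open>Removal of the genericity conditions\<close>

lemma countable_exp_hits:
  fixes e :: real
  assumes "e \<noteq> 0" "C > 0"
  shows "countable {t. \<exists>n::int. C * exp (e * t) = r powi n}"
proof (rule countable_subset)
  show "{t. \<exists>n::int. C * exp (e * t) = r powi n} \<subseteq> range (\<lambda>n::int. ln (r powi n / C) / e)"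
  proof safe
    fix t and n :: int assume "C * exp (e * t) = r powi n"
    then have "exp (e * t) = r powi n / C" using assms(2) by (simp add: field_simps)
    then have "ln (r powi n / C) = e * t" by (metis ln_exp)
    then have "t = ln (r powi n / C) / e" using assms(1) by simp
    then show "t \<in> range (\<lambda>n::int. ln (r powi n / C) / e)" by blast
  qed
qed simp

text \<open>
  The weights sum to 0, so the perturbation preserves the product of the parameters. The powers of 3 are chosen so
  that every monomial occurring in the genericity conditions has nonzero weight.
\<close>

definition perturb_exp :: "nat \<Rightarrow> real" where
  "perturb_exp j = (if j = 3 then 1 else if j = 4 then 3 else if j = 5 then 9 else if j = 6 then 27 else - 20)"

definition perturb :: "(nat \<Rightarrow> complex) \<Rightarrow> complex \<Rightarrow> nat \<Rightarrow> complex" where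
  "perturb b z j = b j * exp (of_real (perturb_exp j) * z)"

context six_params
begin

lemma norm_perturb: "norm (perturb b (of_real t) j) = norm (b j) * exp (perturb_exp j * t)"
  by (simp add: perturb_def norm_mult)

text \<open>
  Along the perturbation the modulus of each monomial in the genericity conditions is strictly monotone in \<open>t\<close>, so
  only countably many \<open>t\<close> are excluded. The first two weights are negative, which keeps the product of the first
  two parameters inside the unit disc.
\<close>

lemma exists_generic_perturbation:
  assumes "\<epsilon> > 0" "m \<noteq> 0" "m\<^sup>2 \<notin> qpowers q" and p: "norm (b 1 * b 2) < 1"
  shows "\<exists>t. 0 < t \<and> t < \<epsilon> \<and>
    generic_family q (perturb b (of_real t) 1 * perturb b (of_real t) 2) (perturb b (of_real t)) m"
proof -
  define S where "S = (\<lambda>C e. {t::real. \<exists>n::int. C * exp (e * t) = norm q powi n})"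
  let ?a = perturb_exp
  define bad where "bad = (\<Union>i\<in>{3..6}. \<Union>j\<in>{3..6}. S (norm (b i * b j)) (?a i + ?a j) \<union>
      S (norm (b 1 * b 2 * b i * b j)) (?a 1 + ?a 2 + ?a i + ?a j) \<union>
      (if i = j then {} else S (norm (b i / b j)) (?a i - ?a j)) \<union>
      S (norm (m * b j)) (?a j) \<union> S (norm (m / b j)) (- ?a j))"
  have nz: "b 1 \<noteq> 0" "b 2 \<noteq> 0" "\<And>j. j \<in> {3..6} \<Longrightarrow> b j \<noteq> 0" using b_nz by auto
  have cases: "j = 3 \<or> j = 4 \<or> j = 5 \<or> j = 6" if "j \<in> {3..6}" for j :: nat using that by auto
  have aj: "?a j \<noteq> 0" "- ?a j \<noteq> 0" if "j \<in> {3..6}" for j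
    using cases[OF that] by (auto simp: perturb_exp_def)
  have aij: "?a i + ?a j \<noteq> 0" "?a 1 + ?a 2 + ?a i + ?a j \<noteq> 0" "i \<noteq> j \<Longrightarrow> ?a i - ?a j \<noteq> 0"
    if "i \<in> {3..6}" "j \<in> {3..6}" for i j
    using cases[OF that(1)] cases[OF that(2)] by (auto simp: perturb_exp_def)
  have cS: "countable (S C e)" if "e \<noteq> 0" "C > 0" for C e
    unfolding S_def using that by (rule countable_exp_hits)
  have "countable bad"
    unfolding bad_def
  proof (intro countable_UN countable_Un)
    fix i j :: nat assume ij: "i \<in> {3..6}" "j \<in> {3..6}"
    have pos: "norm (b i * b j) > 0" "norm (b 1 * b 2 * b i * b j) > 0" "norm (b i / b j) > 0"
      "norm (m * b j) > 0" "norm (m / b j) > 0"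
      using nz(1,2) nz(3)[OF ij(1)] nz(3)[OF ij(2)] assms(2) by simp_all
    show "countable (S (norm (b i * b j)) (?a i + ?a j))"
      by (rule cS[OF aij(1)[OF ij] pos(1)])
    show "countable (S (norm (b 1 * b 2 * b i * b j)) (?a 1 + ?a 2 + ?a i + ?a j))"
      by (rule cS[OF aij(2)[OF ij] pos(2)])
    show "countable (if i = j then {} else S (norm (b i / b j)) (?a i - ?a j))"
      using cS[OF aij(3)[OF ij] pos(3)] by simp
    show "countable (S (norm (m * b j)) (?a j))" by (rule cS[OF aj(1)[OF ij(2)] pos(4)])
    show "countable (S (norm (m / b j)) (- ?a j))" by (rule cS[OF aj(2)[OF ij(2)] pos(5)])
  qed simp_all
  moreover have "uncountable {0<..<\<epsilon>}" using assms(1) by (simp add: uncountable_open_interval)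
  ultimately have "\<not> {0<..<\<epsilon>} \<subseteq> bad" using countable_subset by blast
  then obtain t where t: "t \<in> {0<..<\<epsilon>}" "t \<notin> bad" by blast
  let ?b = "perturb b (of_real t)"
  have notS: "t \<notin> S (norm (b i * b j)) (?a i + ?a j)"
    "t \<notin> S (norm (b 1 * b 2 * b i * b j)) (?a 1 + ?a 2 + ?a i + ?a j)"
    "i \<noteq> j \<Longrightarrow> t \<notin> S (norm (b i / b j)) (?a i - ?a j)"
    "t \<notin> S (norm (m * b j)) (?a j)" "t \<notin> S (norm (m / b j)) (- ?a j)"
    if "i \<in> {3..6}" "j \<in> {3..6}" for i j
  proof -
    have U: "t \<notin> S (norm (b i * b j)) (?a i + ?a j) \<union>
      S (norm (b 1 * b 2 * b i * b j)) (?a 1 + ?a 2 + ?a i + ?a j) \<union>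
      (if i = j then {} else S (norm (b i / b j)) (?a i - ?a j)) \<union>
      S (norm (m * b j)) (?a j) \<union> S (norm (m / b j)) (- ?a j)"
      using t(2) that unfolding bad_def by blast
    then show "t \<notin> S (norm (b i * b j)) (?a i + ?a j)"
      "t \<notin> S (norm (b 1 * b 2 * b i * b j)) (?a 1 + ?a 2 + ?a i + ?a j)"
      "t \<notin> S (norm (m * b j)) (?a j)" "t \<notin> S (norm (m / b j)) (- ?a j)"
      by blast+
    show "t \<notin> S (norm (b i / b j)) (?a i - ?a j)" if "i \<noteq> j"
      using U unfolding if_not_P[OF that] by blast
  qed
  have key: "u \<notin> qpowers q" if "t \<notin> S C e" "norm u = C * exp (e * t)" for u C e
  proof
    assume "u \<in> qpowers q"
    then obtain n :: int where "u = q powi n" by (auto simp: qpowers_def)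
    then have "norm u = norm q powi n" by (simp only: norm_power_int)
    then show False using that by (auto simp: S_def)
  qed
  have "generic_family q (?b 1 * ?b 2) ?b m"
  proof
    show "?b 1 * ?b 2 \<noteq> 0" using nz by (simp add: perturb_def)
    have "norm (?b 1 * ?b 2) = norm (b 1 * b 2) * exp (- 40 * t)"
      by (simp add: norm_mult norm_perturb perturb_exp_def mult_ac flip: exp_add)
    also have "\<dots> \<le> norm (b 1 * b 2) * 1" using t(1) by (intro mult_left_mono) auto
    finally show "norm (?b 1 * ?b 2) < 1" using p by simp
    show "?b j \<noteq> 0" if "j \<in> {3..6}" for j using nz(3)[OF that] by (simp add: perturb_def)
    have "exp (of_real (?a 1) * of_real t) * exp (of_real (?a 2) * of_real t) * (exp (of_real (?a 3) * of_real t)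
       * exp (of_real (?a 4) * of_real t) * exp (of_real (?a 5) * of_real t) * exp (of_real (?a 6) * complex_of_real t)) = 1"
      by (simp add: perturb_exp_def flip: exp_add)
    moreover have "b 1 * b 2 * (b 3 * b 4 * b 5 * b 6) = q"
      using b_prod unfolding prod_1_6 by (simp only: mult_ac)
    moreover have "?b 1 * ?b 2 * (\<Prod>j=3..6. ?b j) = (b 1 * b 2 * (b 3 * b 4 * b 5 * b 6)) *
      (exp (of_real (?a 1) * of_real t) * exp (of_real (?a 2) * of_real t) * (exp (of_real (?a 3) * of_real t)
       * exp (of_real (?a 4) * of_real t) * exp (of_real (?a 5) * of_real t) * exp (of_real (?a 6) * complex_of_real t)))"
      unfolding prod_3_6 perturb_def by (simp only: mult_ac)
    ultimately show "?b 1 * ?b 2 * (\<Prod>j=3..6. ?b j) = q" by (simp only: mult_1_right)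
    show "m \<noteq> 0" "m\<^sup>2 \<notin> qpowers q" by fact+
    show "?b i * ?b j \<notin> qpowers q" if "i \<in> {3..6}" "j \<in> {3..6}" for i j
      by (rule key[OF notS(1)[OF that]]) (simp add: norm_mult norm_perturb distrib_right exp_add)
    show "?b 1 * ?b 2 * ?b i * ?b j \<notin> qpowers q" if "i \<in> {3..6}" "j \<in> {3..6}" for i j
      by (rule key[OF notS(2)[OF that]]) (unfold norm_mult norm_perturb distrib_right exp_add, simp only: mult_ac)
    show "?b i / ?b j \<notin> qpowers q" if "i \<in> {3..6}" "j \<in> {3..6}" "i \<noteq> j" for i j
      by (rule key[OF notS(3)[OF that]]) (simp add: norm_divide norm_perturb left_diff_distrib exp_diff)
    show "m * ?b j \<notin> qpowers q" if "j \<in> {3..6}" for j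
      by (rule key[OF notS(4)[OF that that]]) (simp add: norm_mult norm_perturb)
    show "m / ?b j \<notin> qpowers q" if "j \<in> {3..6}" for j
      by (rule key[OF notS(5)[OF that that]]) (simp add: norm_divide norm_perturb exp_minus field_simps)
  qed
  then show ?thesis using t(1) by auto
qed

text \<open>
  If \<open>m\<^sup>2 \<in> q^\<int>\<close>, both sides vanish. Otherwise the difference of the two sides is continuous along the perturbation
  and vanishes at arguments arbitrarily close to 0.
\<close>

lemma det_fun_eval_if_small_pair:
  assumes x: "x \<noteq> 0" and m: "m \<noteq> 0" and p: "norm (b 1 * b 2) < 1"
  shows "det_fun q b x m = qpoch_inf q q * pair_prod q b * theta q (m\<^sup>2) * odd_theta_basis m x"
proof (cases "m\<^sup>2 \<in> qpowers q")
  case True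
  then show ?thesis using det_fun_eq_0_if_square[OF x m] m by (simp add: theta_eq_0_iff)
next
  case False
  \<comment> \<open>The perturbation parameter is complex so that continuity comes from holomorphy.\<close>
  define D where "D = (\<lambda>z. det_fun q (perturb b z) x m
      - qpoch_inf q q * pair_prod q (perturb b z) * theta q (m\<^sup>2) * odd_theta_basis m x)"
  have bz: "(\<lambda>z. perturb b z j) holomorphic_on UNIV" for j
    unfolding perturb_def by (intro holomorphic_intros)
  have bnz: "perturb b z j \<noteq> 0" if "j \<in> {1..6}" for z j
    using b_nz[OF that] by (simp add: perturb_def)
  have "(\<lambda>z. det_fun q (perturb b z) x m) holomorphic_on UNIV"
    using x m bz bnz by (intro holomorphic_det_fun) auto
  moreover have "(\<lambda>z. pair_prod q (perturb b z)) holomorphic_on UNIV"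
    unfolding pair_prod_eq Let_def
    by (intro holomorphic_intros bz) (simp_all add: bnz)
  ultimately have "D holomorphic_on UNIV"
    unfolding D_def by (intro holomorphic_intros)
  then have cont: "isCont D 0"
    using holomorphic_on_imp_continuous_on continuous_on_eq_continuous_at open_UNIV by blast
  have D0: "D 0 = 0"
  proof (rule ccontr)
    assume nz: "D 0 \<noteq> 0"
    obtain \<delta> where \<delta>: "\<delta> > 0" "\<And>z. dist z 0 < \<delta> \<Longrightarrow> D z \<noteq> 0"
      using continuous_at_avoid[OF cont nz] by (auto simp: dist_commute)
    obtain t where t: "0 < t" "t < \<delta>"
      and gen: "generic_family q (perturb b (of_real t) 1 * perturb b (of_real t) 2) (perturb b (of_real t)) m"
      using exists_generic_perturbation[OF \<delta>(1) m False p] by blast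
    let ?b = "perturb b (of_real t)"
    have b1: "?b 1 \<noteq> 0" by (rule bnz) simp
    have "?b(1 := ?b 1, 2 := ?b 1 * ?b 2 / ?b 1) = ?b" using b1 by (simp add: fun_eq_iff)
    then have "D (of_real t) = 0"
      using generic_family.det_fam_eval[OF gen x b1] by (simp add: D_def)
    then show False using \<delta>(2)[of "of_real t"] t by (simp add: dist_norm)
  qed
  have "perturb b 0 = b" by (simp add: perturb_def fun_eq_iff)
  then show ?thesis using D0 by (simp add: D_def)
qed

lemma six_params_permute:
  assumes "\<pi> permutes {1..6}"
  shows "six_params q (b \<circ> \<pi>)"
proof
  show "(b \<circ> \<pi>) j \<noteq> 0" if "j \<in> {1..6}" for j
    using b_nz permutes_in_image[OF assms] that by simp
  show "(\<Prod>j=1..6. (b \<circ> \<pi>) j) = q"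
    using prod_permute_params[OF assms, of "\<lambda>c. c" b] b_prod by simp
qed

lemma det_fun_eval_permuted:
  assumes "x \<noteq> 0" "m \<noteq> 0" and \<pi>: "\<pi> permutes {1..6}" and "norm (b (\<pi> 1) * b (\<pi> 2)) < 1"
    and "pair_prod q (b \<circ> \<pi>) = pair_prod q b"
  shows "det_fun q b x m = qpoch_inf q q * pair_prod q b * theta q (m\<^sup>2) * odd_theta_basis m x"
  using six_params.det_fun_eval_if_small_pair[OF six_params_permute[OF \<pi>] assms(1,2)] assms(4,5)
  by (simp add: det_fun_permute[OF \<pi>])

text \<open>
  The products \<open>b 1 * b 2\<close>, \<open>b 3 * b 4\<close> and \<open>b 5 * b 6\<close> multiply to \<open>q\<close>, so one of them has modulus less than 1. By
  symmetry it may be taken to be the first.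
\<close>

theorem det_fun_eval:
  assumes "x \<noteq> 0" "m \<noteq> 0"
  shows "det_fun q b x m = qpoch_inf q q * pair_prod q b * theta q (m\<^sup>2) * odd_theta_basis m x"
proof -
  have perm: "Transposition.transpose 1 i \<circ> Transposition.transpose 2 j permutes {1..6::nat}"
    if "i \<in> {1..6}" "j \<in> {1..6}" for i j
    using that by (intro permutes_compose permutes_swap_id) auto
  have "norm (b 1 * b 2) < 1 \<or> norm (b 3 * b 4) < 1 \<or> norm (b 5 * b 6) < 1"
  proof (rule ccontr)
    assume "\<not> ?thesis"
    then have "1 * 1 * 1 \<le> norm (b 1 * b 2) * norm (b 3 * b 4) * norm (b 5 * b 6)"
      by (intro mult_mono) auto
    also have "\<dots> = norm q"
      using arg_cong[OF b_prod, of norm] unfolding prod_1_6 by (simp only: norm_mult mult_ac)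
    finally show False using q_lt by simp
  qed
  then show ?thesis
  proof (elim disjE)
    assume "norm (b 1 * b 2) < 1"
    then show ?thesis by (rule det_fun_eval_if_small_pair[OF assms])
  next
    let ?\<pi> = "Transposition.transpose 1 3 \<circ> Transposition.transpose 2 (4::nat)"
    assume 34: "norm (b 3 * b 4) < 1"
    have v: "(b \<circ> ?\<pi>) 1 = b 3" "(b \<circ> ?\<pi>) 2 = b 4" "(b \<circ> ?\<pi>) 3 = b 1" "(b \<circ> ?\<pi>) 4 = b 2"
      "(b \<circ> ?\<pi>) 5 = b 5" "(b \<circ> ?\<pi>) 6 = b 6"
      by (simp_all add: Transposition.transpose_def)
    have "pair_prod q (b \<circ> ?\<pi>) = pair_prod q b"
      unfolding pair_prod_eq Let_def v by (simp only: mult_ac)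
    then show ?thesis
      using 34 v by (intro det_fun_eval_permuted[OF assms perm]) (simp_all only: o_apply, simp_all)
  next
    let ?\<pi> = "Transposition.transpose 1 5 \<circ> Transposition.transpose 2 (6::nat)"
    assume 56: "norm (b 5 * b 6) < 1"
    have v: "(b \<circ> ?\<pi>) 1 = b 5" "(b \<circ> ?\<pi>) 2 = b 6" "(b \<circ> ?\<pi>) 3 = b 3" "(b \<circ> ?\<pi>) 4 = b 4"
      "(b \<circ> ?\<pi>) 5 = b 1" "(b \<circ> ?\<pi>) 6 = b 2"
      by (simp_all add: Transposition.transpose_def)
    have "pair_prod q (b \<circ> ?\<pi>) = pair_prod q b"
      unfolding pair_prod_eq Let_def v by (simp only: mult_ac)
    then show ?thesis
      using 56 v by (intro det_fun_eval_permuted[OF assms perm]) (simp_all only: o_apply, simp_all)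
  qed
qed

end

section \<open>The bilateral series\<close>

lemma upt_1_7: "[1..<7] = [1, 2, 3, 4, 5, 6::nat]"
  by (simp add: upt_rec numeral_eq_Suc)

lemma prod_list_upper_params:
  "(\<Prod>a\<leftarrow>upper_params q l b. f a) = f (l * q) * f (- l * q) * (\<Prod>j=1..6. f (l * b j))"
  for f :: "complex \<Rightarrow> complex"
  unfolding upper_params_def prod_1_6 upt_1_7 by (simp add: mult.assoc)

lemma prod_list_lower_params:
  "(\<Prod>a\<leftarrow>lower_params q l b. f a) = f l * f (- l) * (\<Prod>j=1..6. f (l * q / b j))"
  for f :: "complex \<Rightarrow> complex"
  unfolding lower_params_def prod_1_6 upt_1_7 by (simp add: mult.assoc)

lemma set_upper_params: "set (upper_params q l b) = {l * q, - l * q} \<union> (\<lambda>j. l * b j) ` {1..6}"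
  by (auto simp: upper_params_def)

lemma set_lower_params: "set (lower_params q l b) = {l, - l} \<union> (\<lambda>j. l * q / b j) ` {1..6}"
  by (auto simp: lower_params_def)

lemma qpoch_nat: "qpoch q a (int k) = fpoch q a k"
  by (simp add: qpoch_def fpoch_def)

lemma (in q_base) qpoch_neg: "qpoch q a (- int (Suc k)) = inverse (fpoch q (a / q ^ Suc k) (Suc k))"
proof -
  have *: "(\<Prod>j=1..n. 1 - a * q powi (- int j)) = fpoch q (a / q ^ n) n" for n
  proof (induction n)
    case (Suc n)
    have "(\<Prod>j=1..Suc n. 1 - a * q powi (- int j)) = (\<Prod>j=1..n. 1 - a * q powi (- int j)) * (1 - a * q powi (- int (Suc n)))"
      by simp
    also have "q powi (- int (Suc n)) = inverse (q ^ Suc n)"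
      by (simp only: power_int_minus power_int_of_nat)
    also have "a * inverse (q ^ Suc n) = a / q ^ Suc n" by (simp only: divide_inverse)
    also have "(\<Prod>j=1..n. 1 - a * q powi (- int j)) * (1 - a / q ^ Suc n) = fpoch q (a / q ^ Suc n) (Suc n)"
      unfolding Suc fpoch_Suc_left using q_nz by simp
    finally show ?case .
  qed simp
  have "\<not> (- int (Suc k) \<ge> 0)" by simp
  then show ?thesis unfolding qpoch_def by (simp only: if_False minus_minus nat_int *)
qed

context six_params
begin

definition series_prefactor :: "complex \<Rightarrow> complex" where
  "series_prefactor l = (1 - l\<^sup>2) * (\<Prod>j=1..6. qpoch_inf q (q * l / b j) * qpoch_inf q (q * inverse l / b j))"

definition series_term :: "complex \<Rightarrow> int \<Rightarrow> complex" where
  "series_term l k = (\<Prod>a\<leftarrow>upper_params q l b. qpoch q a k) / (\<Prod>c\<leftarrow>lower_params q l b. qpoch q c k) * q powi k"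

text \<open>
  The very-well-poised part telescopes: \<open>(1 - c) * fpoch q (c * q) k = fpoch q c k * (1 - c * q ^ k)\<close>.
\<close>

lemma very_well_poised_pair:
  "(1 - l) * (1 - (- l)) * (fpoch q (l * q) k * fpoch q (- l * q) k)
    = (1 - l\<^sup>2 * q ^ (2 * k)) * (fpoch q l k * fpoch q (- l) k)"
proof -
  have 1: "(1 - c) * fpoch q (c * q) k = fpoch q c k * (1 - c * q ^ k)" for c
    using fpoch_Suc_left[of q c k] fpoch_Suc[of q c k] by simp
  have "1 - l\<^sup>2 * q ^ (2 * k) = (1 - l * q ^ k) * (1 - (- l) * q ^ k)"
    by (simp add: right_diff_distrib left_diff_distrib distrib_left power2_eq_square mult_2 power_add)
  moreover have "(1 - l) * (1 - (- l)) * (fpoch q (l * q) k * fpoch q (- l * q) k)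
      = ((1 - l) * fpoch q (l * q) k) * ((1 - (- l)) * fpoch q (- l * q) k)"
    by (simp only: mult_ac)
  ultimately show ?thesis unfolding 1 by (simp only: mult_ac)
qed

text \<open>
  The lower parameters are nonvanishing by hypothesis, so each infinite product of the prefactor splits into the
  denominator of the term and the tail that appears in \<open>bil_term\<close>.
\<close>

lemma series_term_nonneg:
  assumes l: "l \<noteq> 0" and den: "\<And>c n. c \<in> set (lower_params q l b) \<Longrightarrow> 1 - c * q ^ n \<noteq> 0"
  shows "series_prefactor l * series_term l (int k) = bil_term q b l k"
proof -
  have nz: "fpoch q c k \<noteq> 0" if "c \<in> set (lower_params q l b)" for c
    using den[OF that] by (auto simp: fpoch_eq_0_iff)
  have nl: "fpoch q l k \<noteq> 0" "fpoch q (- l) k \<noteq> 0" "\<And>j. j \<in> {1..6} \<Longrightarrow> fpoch q (l * q / b j) k \<noteq> 0"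
    by (rule nz; force simp: set_lower_params)+
  define P where "P = (\<Prod>j=1..6. qpoch_inf q (q * l / b j) * qpoch_inf q (q * inverse l / b j))"
  have "P * ((\<Prod>j=1..6. fpoch q (l * b j) k) / (\<Prod>j=1..6. fpoch q (l * q / b j) k))
     = (\<Prod>j=1..6. fpoch q (l * b j) k * qpoch_inf q (q / (l * b j)) * qpoch_inf q (q ^ Suc k * l / b j))"
    unfolding P_def prod_dividef[symmetric] prod.distrib[symmetric]
  proof (rule prod.cong[OF refl])
    fix j :: nat assume j: "j \<in> {1..6}"
    have "qpoch_inf q (q * l / b j) = fpoch q (l * q / b j) k * qpoch_inf q (q ^ Suc k * l / b j)"
      using qinf_split[of "l * q / b j" k] by (simp add: mult_ac)
    moreover have "q * inverse l / b j = q / (l * b j)" by (simp add: field_simps)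
    ultimately show "qpoch_inf q (q * l / b j) * qpoch_inf q (q * inverse l / b j) * (fpoch q (l * b j) k / fpoch q (l * q / b j) k)
      = fpoch q (l * b j) k * qpoch_inf q (q / (l * b j)) * qpoch_inf q (q ^ Suc k * l / b j)"
      using nl(3)[OF j] by simp
  qed
  moreover have "(1 - l\<^sup>2) * ((fpoch q (l * q) k * fpoch q (- l * q) k) / (fpoch q l k * fpoch q (- l) k)) = 1 - l\<^sup>2 * q ^ (2 * k)"
    using very_well_poised_pair[of l k] nl(1,2) by (simp add: field_simps power2_eq_square)
  moreover have "series_prefactor l * series_term l (int k) =
     q ^ k * ((1 - l\<^sup>2) * ((fpoch q (l * q) k * fpoch q (- l * q) k) / (fpoch q l k * fpoch q (- l) k))) *
     (P * ((\<Prod>j=1..6. fpoch q (l * b j) k) / (\<Prod>j=1..6. fpoch q (l * q / b j) k)))"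
    unfolding series_prefactor_def series_term_def prod_list_upper_params prod_list_lower_params qpoch_nat P_def
    by simp
  ultimately show ?thesis unfolding bil_term_def by (simp only:)
qed

text \<open>
  For a negative index the upper parameters give the denominators. Reflecting all finite products of length \<open>n\<close>
  yields the term of index \<open>n\<close> at \<open>1 / l\<close>; the monomials combine by the condition on the product of the
  parameters.
\<close>

lemma series_term_neg:
  assumes l: "l \<noteq> 0"
    and den: "\<And>a n. a \<in> set (upper_params q l b) \<Longrightarrow> n \<ge> 1 \<Longrightarrow> 1 - a * q powi (- int n) \<noteq> 0"
    and one: "1 - l \<noteq> 0" "1 - (- l) \<noteq> 0"
  shows "series_prefactor l * series_term l (- int (Suc k)) = - l\<^sup>2 * bil_term q b (1 / l) (Suc k)"
proof -
  define n where "n = Suc k"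
  have nz: "fpoch q (a / q ^ n) n \<noteq> 0" if a: "a \<in> set (upper_params q l b)" for a
  proof
    assume "fpoch q (a / q ^ n) n = 0"
    then obtain i where i: "i < n" "a / q ^ n * q ^ i = 1" by (auto simp: fpoch_eq_0_iff)
    have "q ^ n = q ^ i * q ^ (n - i)" using i(1) by (simp flip: power_add)
    then have "a * inverse (q ^ (n - i)) = 1" using i(2) q_nz by (simp add: field_simps)
    moreover have "q powi (- int (n - i)) = inverse (q ^ (n - i))"
      by (simp only: power_int_minus power_int_of_nat)
    ultimately have "1 - a * q powi (- int (n - i)) = 0" by simp
    moreover have "n - i \<ge> 1" using i(1) by linarith
    ultimately show False using den[OF a] by blast
  qed
  have nl: "fpoch q (l * q / q ^ n) n \<noteq> 0" "fpoch q (- l * q / q ^ n) n \<noteq> 0" "\<And>j. j \<in> {1..6} \<Longrightarrow> fpoch q (l * b j / q ^ n) n \<noteq> 0"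
    by (rule nz; force simp: set_upper_params)+
  define P where "P = (\<Prod>j=1..6. qpoch_inf q (q * l / b j) * qpoch_inf q (q * inverse l / b j))"
  define R where "R = (\<Prod>j=1..6. fpoch q (1 / l * b j) n * qpoch_inf q (q / (1 / l * b j)) * qpoch_inf q (q ^ Suc n * (1 / l) / b j))"
  have "P * ((\<Prod>j=1..6. fpoch q (l * q / b j / q ^ n) n) / (\<Prod>j=1..6. fpoch q (l * b j / q ^ n) n))
     = (\<Prod>j=1..6. (q / (b j * b j)) ^ n * (fpoch q (1 / l * b j) n * qpoch_inf q (q / (1 / l * b j)) * qpoch_inf q (q ^ Suc n * (1 / l) / b j)))"
    unfolding P_def prod_dividef[symmetric] prod.distrib[symmetric]
  proof (rule prod.cong[OF refl])
    fix j :: nat assume j: "j \<in> {1..6}"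
    have bj: "b j \<noteq> 0" using b_nz[OF j] .
    have e1: "fpoch q (l * q / b j / q ^ n) n = (- (l * q / b j)) ^ n / q ^ (\<Sum>{..n}) * fpoch q (1 / l * b j) n"
      using fpoch_reflect[of "l * q / b j" n] l bj q_nz by simp
    have e2: "fpoch q (l * b j / q ^ n) n = (- (l * b j)) ^ n / q ^ (\<Sum>{..n}) * fpoch q (q / (l * b j)) n"
      using fpoch_reflect[of "l * b j" n] l bj by simp
    have fnz: "fpoch q (q / (l * b j)) n \<noteq> 0" using nl(3)[OF j] unfolding e2 by auto
    have e3: "qpoch_inf q (q * inverse l / b j) = fpoch q (q / (l * b j)) n * qpoch_inf q (q ^ Suc n * (1 / l) / b j)"
      using qinf_split[of "q / (l * b j)" n] by (simp add: divide_inverse mult_ac)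
    have e4: "q * l / b j = q / (1 / l * b j)" by simp
    have e5: "(- (l * q / b j)) ^ n / (- (l * b j)) ^ n = (q / (b j * b j)) ^ n"
      using l bj by (simp flip: power_divide)
    have "fpoch q (l * q / b j / q ^ n) n / fpoch q (l * b j / q ^ n) n
      = ((- (l * q / b j)) ^ n / (- (l * b j)) ^ n) * (fpoch q (1 / l * b j) n / fpoch q (q / (l * b j)) n)"
      unfolding e1 e2 using q_nz by simp
    then show "qpoch_inf q (q * l / b j) * qpoch_inf q (q * inverse l / b j) * (fpoch q (l * q / b j / q ^ n) n / fpoch q (l * b j / q ^ n) n)
      = (q / (b j * b j)) ^ n * (fpoch q (1 / l * b j) n * qpoch_inf q (q / (1 / l * b j)) * qpoch_inf q (q ^ Suc n * (1 / l) / b j))"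
      unfolding e5 e4 e3 using fnz by simp
  qed
  also have "\<dots> = (\<Prod>j=1..6. (q / (b j * b j)) ^ n) * R"
    unfolding R_def by (simp only: prod.distrib)
  also have "(\<Prod>j=1..6. (q / (b j * b j)) ^ n) = (q ^ 4) ^ n"
  proof -
    have "(\<Prod>j=1..6. q / (b j * b j)) = q ^ 6 / (q * q)"
      unfolding prod_dividef prod.distrib b_prod by simp
    also have "\<dots> = q ^ 4" using q_nz by (simp add: power_numeral_reduce)
    finally show ?thesis by (simp only: prod_power_distrib[symmetric])
  qed
  finally have A: "P * ((\<Prod>j=1..6. fpoch q (l * q / b j / q ^ n) n) / (\<Prod>j=1..6. fpoch q (l * b j / q ^ n) n)) = (q ^ 4) ^ n * R" .
  have B: "(1 - l\<^sup>2) * (fpoch q (l / q ^ n) n * fpoch q (- l / q ^ n) n / (fpoch q (l * q / q ^ n) n * fpoch q (- l * q / q ^ n) n))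
     = 1 - l\<^sup>2 / q ^ (2 * n)"
  proof -
    have sh: "(1 - c) * fpoch q (c / q ^ n) n = (1 - c / q ^ n) * fpoch q (c * q / q ^ n) n" for c
      using fpoch_Suc_left[of q "c / q ^ n" n] fpoch_Suc[of q "c / q ^ n" n] q_nz by (simp add: mult.commute)
    have "(1 - l\<^sup>2) * (fpoch q (l / q ^ n) n * fpoch q (- l / q ^ n) n)
       = ((1 - l) * fpoch q (l / q ^ n) n) * ((1 - (- l)) * fpoch q (- l / q ^ n) n)"
      by (simp add: algebra_simps power2_eq_square)
    also have "\<dots> = (1 - l\<^sup>2 / q ^ (2 * n)) * (fpoch q (l * q / q ^ n) n * fpoch q (- l * q / q ^ n) n)"
    proof -
      have "q ^ (2 * n) = q ^ n * q ^ n" by (simp only: mult_2 power_add)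
      then have "l\<^sup>2 / q ^ (2 * n) = (l / q ^ n)\<^sup>2" by (simp add: power2_eq_square)
      moreover have "1 - u\<^sup>2 = (1 - u) * (1 - (- u))" for u :: complex
        by (simp add: algebra_simps power2_eq_square)
      ultimately have pr: "1 - l\<^sup>2 / q ^ (2 * n) = (1 - l / q ^ n) * (1 - (- l) / q ^ n)"
        by (simp only: minus_divide_left)
      show ?thesis unfolding sh pr by (simp only: mult_ac)
    qed
    finally show ?thesis using nl(1,2) by simp
  qed
  have T: "series_prefactor l * series_term l (- int n) =
     inverse (q ^ n) * ((1 - l\<^sup>2) * (fpoch q (l / q ^ n) n * fpoch q (- l / q ^ n) n / (fpoch q (l * q / q ^ n) n * fpoch q (- l * q / q ^ n) n))) *
     (P * ((\<Prod>j=1..6. fpoch q (l * q / b j / q ^ n) n) / (\<Prod>j=1..6. fpoch q (l * b j / q ^ n) n)))"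
  proof -
    have qn: "qpoch q a (- int n) = inverse (fpoch q (a / q ^ n) n)" for a
      unfolding n_def by (rule qpoch_neg)
    have iv: "(\<Prod>j=1..6. inverse (f j)) = inverse (\<Prod>j=1..6. f j)" for f :: "nat \<Rightarrow> complex"
      by (simp add: prod_inversef[unfolded o_def])
    have "q powi (- int n) = inverse (q ^ n)" by (simp only: power_int_minus power_int_of_nat)
    then show ?thesis
      unfolding series_prefactor_def series_term_def prod_list_upper_params prod_list_lower_params qn P_def iv
      by (simp add: divide_inverse mult_ac)
  qed
  have C: "1 - l\<^sup>2 / q ^ (2 * n) = - l\<^sup>2 * inverse (q ^ (2 * n)) * (1 - (1 / l)\<^sup>2 * q ^ (2 * n))"
    using l q_nz by (simp add: field_simps)
  have "(q ^ 4) ^ n = q ^ n * (q ^ n * q ^ (2 * n))"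
    by (simp add: power_mult[symmetric] power_add[symmetric])
  moreover have "inverse X * inverse Y * (X * (X * Y)) = X" if "X \<noteq> 0" "Y \<noteq> 0" for X Y :: complex
    using that by (simp add: field_simps)
  ultimately have D: "inverse (q ^ n) * inverse (q ^ (2 * n)) * (q ^ 4) ^ n = q ^ n"
    by (simp only: q_power_nz simp_thms)
  have "series_prefactor l * series_term l (- int n)
     = - l\<^sup>2 * ((inverse (q ^ n) * inverse (q ^ (2 * n)) * (q ^ 4) ^ n) * (1 - (1 / l)\<^sup>2 * q ^ (2 * n)) * R)"
    unfolding T A B unfolding C by (simp only: mult_ac)
  then show ?thesis unfolding D unfolding bil_term_def R_def n_def .
qed

lemma prefactor_mult_bilateral_psi:
  assumes l: "l \<noteq> 0" and den: "psi_denominators_nonzero q (upper_params q l b) (lower_params q l b)"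
  shows "series_prefactor l * bilateral_psi q (upper_params q l b) (lower_params q l b) q = bil_sum q b l"
proof -
  let ?F = "\<lambda>k. series_prefactor l * series_term l k"
  have den1: "1 - c * q ^ n \<noteq> 0" if "c \<in> set (lower_params q l b)" for c n
    using den that by (auto simp: psi_denominators_nonzero_def)
  have den2: "1 - a * q powi (- int n) \<noteq> 0" if "a \<in> set (upper_params q l b)" "n \<ge> 1" for a n
    using den that unfolding psi_denominators_nonzero_def by blast
  have one: "1 - l \<noteq> 0" "1 - (- l) \<noteq> 0"
    using den1[of l 0] den1[of "- l" 0] by (simp_all add: set_lower_params)
  have pos: "(?F \<circ> int) = bil_term q b l"
    using series_term_nonneg[OF l den1] by (simp add: fun_eq_iff)
  have neg: "(?F \<circ> (\<lambda>k. - int (Suc k))) = (\<lambda>k. - l\<^sup>2 * bil_term q b (1 / l) (Suc k))"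
    unfolding fun_eq_iff o_def using series_term_neg[OF l den2 one] by blast
  have "(bil_term q b l has_sum (\<Sum>k. bil_term q b l k)) UNIV"
    by (rule norm_summable_imp_has_sum[OF summable_norm_bil_term summable_sums[OF summable_bil_term]])
  then have s1: "(?F has_sum (\<Sum>k. bil_term q b l k)) (range int)"
    by (subst has_sum_reindex) (simp_all only: pos inj_of_nat)
  have "((\<lambda>k. bil_term q b (1 / l) (Suc k)) has_sum (\<Sum>k. bil_term q b (1 / l) (Suc k))) UNIV"
  proof (rule norm_summable_imp_has_sum)
    show "summable (\<lambda>k. norm (bil_term q b (1 / l) (Suc k)))"
      using summable_norm_bil_term[of "1 / l"] by (subst summable_Suc_iff)
    show "(\<lambda>k. bil_term q b (1 / l) (Suc k)) sums (\<Sum>k. bil_term q b (1 / l) (Suc k))"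
      using summable_bil_term[of "1 / l"] by (intro summable_sums) (subst summable_Suc_iff)
  qed
  then have "((\<lambda>k. - l\<^sup>2 * bil_term q b (1 / l) (Suc k)) has_sum (- l\<^sup>2 * (\<Sum>k. bil_term q b (1 / l) (Suc k)))) UNIV"
    by (rule has_sum_cmult_right)
  moreover have "inj (\<lambda>k. - int (Suc k))" by (auto simp: inj_def)
  ultimately have s2: "(?F has_sum (- l\<^sup>2 * (\<Sum>k. bil_term q b (1 / l) (Suc k)))) (range (\<lambda>k. - int (Suc k)))"
    by (subst has_sum_reindex) (simp_all only: neg)
  have un: "range int \<union> range (\<lambda>k. - int (Suc k)) = UNIV"
  proof (intro set_eqI iffI UNIV_I)
    fix z :: int
    show "z \<in> range int \<union> range (\<lambda>k. - int (Suc k))"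
      by (cases z rule: int_cases) auto
  qed
  have "(?F has_sum ((\<Sum>k. bil_term q b l k) + (- l\<^sup>2 * (\<Sum>k. bil_term q b (1 / l) (Suc k))))) (range int \<union> range (\<lambda>k. - int (Suc k)))"
    by (rule has_sum_Un_disjoint[OF s1 s2]) auto
  then have "infsum ?F UNIV = bil_sum q b l"
    unfolding un bil_sum_def by (auto dest!: infsumI)
  then show ?thesis
    unfolding bilateral_psi_def series_term_def[symmetric] by (simp only: infsum_cmult_right')
qed

lemma psi_side_eq:
  assumes "l \<noteq> 0" "psi_denominators_nonzero q (upper_params q l b) (lower_params q l b)"
  shows "psi_side q b l m = bil_sum q b l * theta_comb q b m / theta q (m / l)"
proof -
  have "psi_side q b l m = theta_comb q b m * (series_prefactor l / theta q (m / l))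
      * bilateral_psi q (upper_params q l b) (lower_params q l b) q"
    unfolding psi_side_def theta_comb_def series_prefactor_def ..
  then show ?thesis unfolding prefactor_mult_bilateral_psi[OF assms, symmetric] by simp
qed

end

theorem proposition2p1:
  fixes q l m :: complex and b :: "nat \<Rightarrow> complex"
  assumes "0 < norm q" and "norm q < 1"
    and "l \<noteq> 0" and "m \<noteq> 0" and "\<And>j. j \<in> {1..6} \<Longrightarrow> b j \<noteq> 0"
    and "theta q (m / l) \<noteq> 0" and "theta q (l / m) \<noteq> 0"
    and "psi_denominators_nonzero q (upper_params q l b) (lower_params q l b)"
    and "psi_denominators_nonzero q (upper_params q m b) (lower_params q m b)"
    and "b 1 * b 2 * b 3 * b 4 * b 5 * b 6 = q"
  shows "psi_side q b l m + psi_side q b m l =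
    qpoch_inf q q * (theta q (l ^ 2) * theta q (m ^ 2) * theta q (l * m))
    * (\<Prod>(i, j) \<in> {(i, j). 1 \<le> i \<and> i < j \<and> j \<le> 6}. qpoch_inf q (q / (b i * b j)))"
proof -
  interpret six_params q b
  proof
    show "q \<noteq> 0" "norm q < 1" using assms(1,2) by auto
    show "b j \<noteq> 0" if "j \<in> {1..6}" for j using assms(5)[OF that] .
    show "(\<Prod>j=1..6. b j) = q" unfolding prod_1_6 by (rule assms(10))
  qed
  have eq: "theta q (l / m) = - theta q (m / l) / (m / l)"
    using theta_inverse[of "m / l"] assms(3,4) by simp
  have "psi_side q b m l = - (m / l * bil_sum q b m * theta_comb q b l) / theta q (m / l)"
    unfolding psi_side_eq[OF assms(4,9)] eq by (simp add: mult_ac)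
  then have "psi_side q b l m + psi_side q b m l = det_fun q b l m / theta q (m / l)"
    unfolding psi_side_eq[OF assms(3,8)] det_fun_def by (simp add: diff_divide_distrib)
  also have "\<dots> = qpoch_inf q q * pair_prod q b * theta q (m\<^sup>2) * (theta q (l\<^sup>2) * theta q (l * m))"
    unfolding det_fun_eval[OF assms(3,4)] odd_theta_basis_def using assms(6) by simp
  finally show ?thesis unfolding pair_prod_def by (simp only: mult_ac)
qed

end
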